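(* Let $(M,\omega)$ be a 3-plectic manifold. Then $L_\infty(M,\omega)$ and $\mathrm{Leib}(M,\omega)$ are isomorphic as weak Lie 3-algebras (i.e. in the category of weak Lie 3-algebras and weak morphisms).
   Context: An $n$-plectic manifold $(M,\omega)$ is a smooth manifold with a closed $(n+1)$-form $\omega$ that is non-degenerate: $\iota(v)\omega=0$ implies $v=0$. An $(n-1)$-form $\alpha$ is Hamiltonian if there is a vector field $v_\alpha$ with $d\alpha=-\iota(v_\alpha)\omega$. Put $v_\alpha=0$ whenever $\alpha$ is not Hamiltonian, in particular when $\alpha$ is not an $(n-1)$-form. Notation: $\iota(v_1,\dots,v_k)=\iota(v_k)\cdots\iota(v_1)$; $\mathcal{L}(v)$ is the Lie derivative. For a 3-plectic manifold both structures live on the 3-term complex (over $\mathbb{R}$) $L_0=\Omega^2_{\mathrm{Ham}}(M)$ (Hamiltonian 2-forms), $L_1=\Omega^1(M)$, $L_2=C^\infty(M)$, with the de Rham differential $L_2\to L_1\to L_0$. All unlisted structure maps are zero. $L_\infty(M,\omega)$: $\lambda_2(\alpha,\beta)=\iota(v_\alpha,v_\beta)\omega$, $\lambda_3(\alpha,\beta,\gamma)=-\iota(v_\alpha,v_\beta,v_\gamma)\omega$, $\lambda_4(\alpha,\beta,\gamma,\eta)=-\iota(v_\alpha,v_\beta,v_\gamma,v_\eta)\omega$. $\mathrm{Leib}(M,\omega)$: $\lambda_2'(\alpha,\beta)=\mathcal{L}(v_\alpha)\beta$, $\lambda_{2;1}'(\alpha,\beta)=\iota(v_\alpha)\beta+\iota(v_\beta)\alpha$.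 Both are weak Lie 3-algebras in the following sense. Conventions. Complexes are over $\Bbbk=\mathbb{R}$ with differential of degree $-1$; the Koszul sign rule is used. A 3-term complex is $(L,d)=L_0\xleftarrow{d}L_1\xleftarrow{d}L_2$, concentrated in degrees $0,1,2$. A map $L^{\otimes n}\to L'[k]$ means a linear map raising degree by $k$. For a multilinear map $\mu$: $\mu^\sigma(v_1,\dots,v_n)=\varepsilon\,\mu(v_{\sigma^{-1}(1)},\dots,v_{\sigma^{-1}(n)})$ with $\varepsilon$ the Koszul sign ($(123)$ means $1\mapsto2\mapsto3\mapsto1$); $\partial(\mu)=d\circ\mu-(-1)^{|\mu|}\mu\circ d_{L^{\otimes n}}$; $(\mu\circ_i\nu)(v_1,\dots,v_{n+k-1})=(-1)^{|\nu|(|v_1|+\dots+|v_{i-1}|)}\mu(v_1,\dots,v_{i-1},\nu(v_i,\dots,v_{i+k-1}),v_{i+k},\dots)$ for $\nu$ of arity $k$; $\mu\circ(\nu_1,\dots,\nu_m)=\mu\circ(\nu_1\otimes\dots\otimes\nu_m)$ and $\mu\circ(\nu_1,\dots,\nu_m)^\sigma=(\mu\circ(\nu_1,\dots,\nu_m))^\sigma$. Leibniz 3-algebra. A 3-term complex $(L,d)$ with maps $\lambda_2\colon L^{\otimes2}\to L$, $\lambda_3\colon L^{\otimes3}\to L[1]$, $\lambda_4\colon L^{\otimes4}\to L[2]$ such that $\partial(\lambda_2)=0$; $\partial(\lambda_3)=\lambda_2\circ_2\lambda_2-\lambda_2\circ_1\lambda_2-(\lambda_2\circ_2\lambda_2)^{(12)}$;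 $\partial(\lambda_4)=\lambda_2\circ_1\lambda_3+\lambda_2\circ_2\lambda_3-(\lambda_2\circ_2\lambda_3)^{(12)}+(\lambda_2\circ_2\lambda_3)^{(123)}-\lambda_3\circ_1\lambda_2+\lambda_3\circ_2\lambda_2-(\lambda_3\circ_2\lambda_2)^{(12)}-\lambda_3\circ_3\lambda_2+(\lambda_3\circ_3\lambda_2)^{(23)}-(\lambda_3\circ_3\lambda_2)^{(132)}$; $0=\lambda_2\circ_1\lambda_4-\lambda_2\circ_2\lambda_4+(\lambda_2\circ_2\lambda_4)^{(12)}-(\lambda_2\circ_2\lambda_4)^{(123)}+(\lambda_2\circ_2\lambda_4)^{(1234)}+\lambda_3\circ_1\lambda_3+\lambda_3\circ_2\lambda_3-(\lambda_3\circ_2\lambda_3)^{(12)}+(\lambda_3\circ_2\lambda_3)^{(123)}+\lambda_3\circ_3\lambda_3-(\lambda_3\circ_3\lambda_3)^{(23)}+(\lambda_3\circ_3\lambda_3)^{(132)}+(\lambda_3\circ_3\lambda_3)^{(234)}-(\lambda_3\circ_3\lambda_3)^{(1342)}+(\lambda_3\circ_3\lambda_3)^{(13)(24)}+\lambda_4\circ_1\lambda_2-\lambda_4\circ_2\lambda_2+(\lambda_4\circ_2\lambda_2)^{(12)}+\lambda_4\circ_3\lambda_2-(\lambda_4\circ_3\lambda_2)^{(23)}+(\lambda_4\circ_3\lambda_2)^{(132)}-\lambda_4\circ_4\lambda_2+(\lambda_4\circ_4\lambda_2)^{(34)}-(\lambda_4\circ_4\lambda_2)^{(243)}+(\lambda_4\circ_4\lambda_2)^{(1432)}$.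 Weak Lie 3-algebra $(L,d,\lambda)$. A Leibniz 3-algebra together with maps $\lambda_{2;1}\colon L^{\otimes2}\to L[1]$, $\lambda_{2;1,1}\colon L^{\otimes2}\to L[2]$, $\lambda_{3;1},\lambda_{3;2}\colon L^{\otimes3}\to L[2]$ such that $\partial(\lambda_{2;1})=\lambda_2+\lambda_2^{(12)}$; $\partial(\lambda_{2;1,1})=\lambda_{2;1}-\lambda_{2;1}^{(12)}$; $\partial(\lambda_{3;1})=\lambda_3+\lambda_3^{(12)}+\lambda_2\circ_1\lambda_{2;1}$; $\partial(\lambda_{3;2})=\lambda_3+\lambda_3^{(23)}-\lambda_2\circ_2\lambda_{2;1}+\lambda_{2;1}\circ_1\lambda_2+(\lambda_{2;1}\circ_2\lambda_2)^{(12)}$; $\lambda_{2;1,1}+\lambda_{2;1,1}^{(12)}=0$; $\lambda_{3;1}-\lambda_{3;1}^{(12)}=\lambda_2\circ_1\lambda_{2;1,1}$; $\lambda_{3;1}-\lambda_{3;2}^{(12)}+\lambda_{3;1}^{(132)}-\lambda_{3;2}+\lambda_{3;1}^{(23)}-\lambda_{3;2}^{(123)}=\lambda_{2;1}\circ_2\lambda_{2;1}+\lambda_{2;1}\circ_1\lambda_{2;1}+(\lambda_{2;1}\circ_2\lambda_{2;1})^{(12)}+(\lambda_{2;1,1}\circ_2\lambda_2)^{(132)}$; $\lambda_{3;2}-\lambda_{3;2}^{(23)}=-\lambda_2\circ_2\lambda_{2;1,1}+\lambda_{2;1,1}\circ_1\lambda_2+(\lambda_{2;1,1}\circ_2\lambda_2)^{(12)}$;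 $\lambda_4+\lambda_4^{(12)}=\lambda_2\circ_1\lambda_{3;1}-\lambda_{3;1}\circ_3\lambda_2+(\lambda_2\circ_2\lambda_{3;1})^{(123)}+\lambda_3\circ_1\lambda_{2;1}$; $\lambda_4+\lambda_4^{(23)}=\lambda_2\circ_1\lambda_{3;2}-\lambda_3\circ_2\lambda_{2;1}+\lambda_2\circ_2\lambda_{3;1}-\lambda_{3;1}\circ_1\lambda_2-(\lambda_{3;1}\circ_2\lambda_2)^{(12)}-(\lambda_{3;1}\circ_3\lambda_2)^{(132)}$; $\lambda_4+\lambda_4^{(34)}=\lambda_{2;1}\circ_1\lambda_3-\lambda_{3;2}\circ_1\lambda_2+\lambda_{3;2}\circ_2\lambda_2-(\lambda_{3;2}\circ_2\lambda_2)^{(12)}+\lambda_3\circ_3\lambda_{2;1}+(\lambda_{3;2}\circ_3\lambda_2)^{(23)}-(\lambda_{3;2}\circ_3\lambda_2)^{(132)}+\lambda_2\circ_2\lambda_{3;2}-(\lambda_2\circ_2\lambda_{3;2})^{(12)}+(\lambda_{2;1}\circ_2\lambda_3)^{(123)}$. Weak morphism of weak Lie 3-algebras $f\colon(L,d,\lambda)\to(L',d',\lambda')$. Maps $f_1\colon L\to L'$, $f_2\colon L^{\otimes2}\to L'[1]$, $f_{2;1}\colon L^{\otimes2}\to L'[2]$, $f_3\colon L^{\otimes3}\to L'[2]$ such that $\partial(f_1)=0$; $\partial(f_2)=f_1\circ\lambda_2-\lambda_2'\circ(f_1,f_1)$; $\partial(f_3)=f_1\circ\lambda_3-f_2\circ_2\lambda_2+f_2\circ_1\lambda_2+(f_2\circ_2\lambda_2)^{(12)}-\lambda_3'\circ(f_1,f_1,f_1)-\lambda_2'\circ(f_1,f_2)+\lambda_2'\circ(f_2,f_1)+\lambda_2'\circ(f_1,f_2)^{(12)}$;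 $f_1\circ\lambda_4-\lambda_4'\circ(f_1,f_1,f_1,f_1)=f_2\circ_1\lambda_3+f_2\circ_2\lambda_3-(f_2\circ_2\lambda_3)^{(12)}+(f_2\circ_2\lambda_3)^{(123)}-f_3\circ_1\lambda_2+f_3\circ_2\lambda_2-(f_3\circ_2\lambda_2)^{(12)}-f_3\circ_3\lambda_2+(f_3\circ_3\lambda_2)^{(23)}-(f_3\circ_3\lambda_2)^{(132)}+\lambda_2'\circ(f_3,f_1)+\lambda_2'\circ(f_1,f_3)-\lambda_2'\circ(f_1,f_3)^{(12)}+\lambda_2'\circ(f_1,f_3)^{(123)}-\lambda_2'\circ(f_2,f_2)+\lambda_2'\circ(f_2,f_2)^{(23)}-\lambda_2'\circ(f_2,f_2)^{(132)}+\lambda_3'\circ(f_2,f_1,f_1)-\lambda_3'\circ(f_1,f_2,f_1)+\lambda_3'\circ(f_1,f_2,f_1)^{(12)}+\lambda_3'\circ(f_1,f_1,f_2)-\lambda_3'\circ(f_1,f_1,f_2)^{(23)}+\lambda_3'\circ(f_1,f_1,f_2)^{(132)}$; $\partial(f_{2;1})=-f_2-f_2^{(12)}+f_1\circ\lambda_{2;1}-\lambda_{2;1}'\circ(f_1,f_1)$; $f_1\circ\lambda_{2;1,1}-\lambda_{2;1,1}'\circ(f_1,f_1)=f_{2;1}-f_{2;1}^{(12)}$; $f_1\circ\lambda_{3;1}-\lambda_{3;1}'\circ(f_1,f_1,f_1)=f_3+f_3^{(12)}+f_2\circ_1\lambda_{2;1}+\lambda_2'\circ(f_{2;1},f_1)$;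 $f_1\circ\lambda_{3;2}-\lambda_{3;2}'\circ(f_1,f_1,f_1)=f_3+f_3^{(23)}-f_2\circ_2\lambda_{2;1}+f_{2;1}\circ_1\lambda_2+(f_{2;1}\circ_2\lambda_2)^{(12)}-\lambda_2'\circ(f_1,f_{2;1})-\lambda_{2;1}'\circ(f_2,f_1)-\lambda_{2;1}'\circ(f_1,f_2)^{(12)}$. Composition of weak morphisms: $(f'\circ f)_1=f_1'\circ f_1$; $(f'\circ f)_2=f_2'\circ(f_1,f_1)+f_1'\circ f_2$; $(f'\circ f)_{2;1}=f_{2;1}'\circ(f_1,f_1)+f_1'\circ f_{2;1}$; $(f'\circ f)_3=f_3'\circ(f_1,f_1,f_1)-f_2'\circ(f_2,f_1)+f_2'\circ(f_1,f_2)-f_2'\circ(f_1,f_2)^{(12)}+f_1'\circ f_3$. The identity has components $(f_1,f_2,f_{2;1},f_3)=(\mathrm{id},0,0,0)$. *)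

theory Defs
  imports
    "HOL-Analysis.Analysis"
    "HOL-Combinatorics.Cycles"
    "HOL-Library.Function_Algebras"
begin

section \<open>Graded multilinear maps\<close>

text \<open>
  A homogeneous element of a graded vector space is written as a pair of its degree and its
  value. A multilinear map is given by its arity, its degree and its values on tuples of
  homogeneous elements; the degree of a value is the sum of the degrees of the arguments and
  the degree of the map.
\<close>

datatype ('v, 'w) gmap =
  GMap (arity: nat) (deg: int) (app: "(int \<times> 'v) list \<Rightarrow> 'w")

definition ksign :: "int \<Rightarrow> real" where
  "ksign k = (if even k then 1 else - 1)"

definition tdeg :: "(int \<times> 'v) list \<Rightarrow> int" where
  "tdeg xs = (\<Sum>x\<leftarrow>xs. fst x)"

definition happ :: "('v, 'w) gmap \<Rightarrow> (int \<times> 'v) list \<Rightarrow> int \<times> 'w" where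
  "happ \<mu> xs = (tdeg xs + deg \<mu>, app \<mu> xs)"

definition zero_map :: "nat \<Rightarrow> int \<Rightarrow> ('v, 'w::zero) gmap" where
  "zero_map n k = GMap n k (\<lambda>xs. 0)"

definition id_map :: "('v, 'v) gmap" where
  "id_map = GMap 1 0 (\<lambda>xs. snd (xs ! 0))"

instantiation gmap :: (type, plus) plus
begin
definition "\<mu> + \<nu> = GMap (arity \<mu>) (deg \<mu>) (\<lambda>xs. app \<mu> xs + app \<nu> xs)"
instance ..
end

instantiation gmap :: (type, minus) minus
begin
definition "\<mu> - \<nu> = GMap (arity \<mu>) (deg \<mu>) (\<lambda>xs. app \<mu> xs - app \<nu> xs)"
instance ..
end

instantiation gmap :: (type, uminus) uminus
begin
definition "- \<mu> = GMap (arity \<mu>) (deg \<mu>) (\<lambda>xs. - app \<mu> xs)"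
instance ..
end

definition partial_comp ::
    "('v, 'w::real_vector) gmap \<Rightarrow> nat \<Rightarrow> ('v, 'v) gmap \<Rightarrow> ('v, 'w) gmap"
    ("_ \<circ>\<^bsub>_\<^esub> _" [71, 0, 71] 70) where
  "\<mu> \<circ>\<^bsub>i\<^esub> \<nu> = GMap (arity \<mu> + arity \<nu> - 1) (deg \<mu> + deg \<nu>)
     (\<lambda>xs. let us = take (i - 1) xs; vs = take (arity \<nu>) (drop (i - 1) xs);
               ws = drop (i - 1 + arity \<nu>) xs
           in ksign (deg \<nu> * tdeg us) *\<^sub>R app \<mu> (us @ happ \<nu> vs # ws))"

text \<open>
  The tensor product of \<open>\<nu>\<^sub>1, \<dots>, \<nu>\<^sub>m\<close> evaluated on a list of arguments: the Koszul sign that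
  arises when the maps \<open>\<nu>\<^sub>j\<close> move past the arguments of \<open>\<nu>\<^sub>i\<close> for \<open>i < j\<close>, and the list
  of the tensor factors of the result.
\<close>

primrec tensor_app ::
    "('v, 'w) gmap list \<Rightarrow> (int \<times> 'v) list \<Rightarrow> real \<times> (int \<times> 'w) list" where
  "tensor_app [] xs = (1, [])"
| "tensor_app (\<nu> # \<nu>s) xs =
     (let us = take (arity \<nu>) xs; (s, ys) = tensor_app \<nu>s (drop (arity \<nu>) xs)
      in (ksign ((\<Sum>\<rho>\<leftarrow>\<nu>s. deg \<rho>) * tdeg us) * s, happ \<nu> us # ys))"

definition full_comp ::
    "('w, 'u::real_vector) gmap \<Rightarrow> ('v, 'w) gmap list \<Rightarrow> ('v, 'u) gmap"
    (infix "\<odot>" 70) where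
  "\<mu> \<odot> \<nu>s = GMap (\<Sum>\<nu>\<leftarrow>\<nu>s. arity \<nu>) (deg \<mu> + (\<Sum>\<nu>\<leftarrow>\<nu>s. deg \<nu>))
     (\<lambda>xs. case tensor_app \<nu>s xs of (s, ys) \<Rightarrow> s *\<^sub>R app \<mu> ys)"

text \<open>
  Permutations act on the positions \<open>1, \<dots>, n\<close>. The Koszul sign of \<open>\<sigma>\<close> is the product over the
  inversions of \<open>\<sigma>\<close>.
\<close>

abbreviation cyc :: "nat list \<Rightarrow> nat \<Rightarrow> nat" where
  "cyc \<equiv> cycle_of_list"

lemma cyc_convention: "cyc [1, 2, 3] 1 = 2" "cyc [1, 2, 3] 2 = 3" "cyc [1, 2, 3] 3 = 1"
  by (simp_all add: transpose_def)

definition koszul :: "(nat \<Rightarrow> nat) \<Rightarrow> (int \<times> 'v) list \<Rightarrow> real" where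
  "koszul \<sigma> xs =
     (\<Prod>(i, j) \<in> {(i, j). 1 \<le> i \<and> i < j \<and> j \<le> length xs \<and> \<sigma> j < \<sigma> i}.
        ksign (fst (xs ! (i - 1)) * fst (xs ! (j - 1))))"

definition perm_map ::
    "('v, 'w::real_vector) gmap \<Rightarrow> (nat \<Rightarrow> nat) \<Rightarrow> ('v, 'w) gmap"
    ("_\<^bsup>_\<^esup>" [1000, 0] 1000) where
  "\<mu>\<^bsup>\<sigma>\<^esup> = GMap (arity \<mu>) (deg \<mu>)
     (\<lambda>xs. koszul \<sigma> xs *\<^sub>R app \<mu> (map (\<lambda>i. xs ! (inv \<sigma> i - 1)) [1..<Suc (arity \<mu>)]))"


section \<open>Three-term complexes\<close>

record 'v complex3 =
  gr :: "int \<Rightarrow> 'v set"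
  df :: "int \<Rightarrow> 'v \<Rightarrow> 'v"

definition complex3 :: "('v::real_vector, 'm) complex3_scheme \<Rightarrow> bool" where
  "complex3 A \<longleftrightarrow>
     (\<forall>i. subspace (gr A i)) \<and> (\<forall>i. i \<notin> {0, 1, 2} \<longrightarrow> gr A i = {0}) \<and>
     (\<forall>i. \<forall>x\<in>gr A i. df A i x \<in> gr A (i - 1)) \<and>
     (\<forall>i. \<forall>x\<in>gr A i. \<forall>y\<in>gr A i. \<forall>a b.
        df A i (a *\<^sub>R x + b *\<^sub>R y) = a *\<^sub>R df A i x + b *\<^sub>R df A i y) \<and>
     (\<forall>i. \<forall>x\<in>gr A i. df A (i - 1) (df A i x) = 0)"

definition hom_tuples :: "('v, 'm) complex3_scheme \<Rightarrow> nat \<Rightarrow> (int \<times> 'v) list set" where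
  "hom_tuples A n = {xs. length xs = n \<and> (\<forall>(i, x)\<in>set xs. x \<in> gr A i)}"

text \<open>\<open>multilin A B n k \<mu>\<close> says that \<open>\<mu>\<close> is a linear map \<open>A\<^sup>\<otimes>\<^sup>n \<rightarrow> B[k]\<close>.\<close>

definition multilin ::
    "('v::real_vector, 'm) complex3_scheme \<Rightarrow> ('w::real_vector, 'l) complex3_scheme \<Rightarrow>
     nat \<Rightarrow> int \<Rightarrow> ('v, 'w) gmap \<Rightarrow> bool" where
  "multilin A B n k \<mu> \<longleftrightarrow>
     arity \<mu> = n \<and> deg \<mu> = k \<and>
     (\<forall>xs\<in>hom_tuples A n. app \<mu> xs \<in> gr B (tdeg xs + k)) \<and>
     (\<forall>us ws i x y a b.
        us @ (i, x) # ws \<in> hom_tuples A n \<and> us @ (i, y) # ws \<in> hom_tuples A n \<longrightarrow>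
        app \<mu> (us @ (i, a *\<^sub>R x + b *\<^sub>R y) # ws) =
          a *\<^sub>R app \<mu> (us @ (i, x) # ws) + b *\<^sub>R app \<mu> (us @ (i, y) # ws))"

definition map_eq ::
    "('v, 'w) gmap \<Rightarrow> ('v, 'm) complex3_scheme \<Rightarrow> ('v, 'w) gmap \<Rightarrow> bool"
    ("_ \<approx>\<^bsub>_\<^esub> _" [51, 0, 51] 50) where
  "\<mu> \<approx>\<^bsub>A\<^esub> \<nu> \<longleftrightarrow> arity \<mu> = arity \<nu> \<and> deg \<mu> = deg \<nu> \<and>
     (\<forall>xs\<in>hom_tuples A (arity \<mu>). app \<mu> xs = app \<nu> xs)"

definition bdry ::
    "('v, 'm) complex3_scheme \<Rightarrow> ('w::real_vector, 'l) complex3_scheme \<Rightarrow>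
     ('v, 'w) gmap \<Rightarrow> ('v, 'w) gmap"
    ("\<partial>\<^bsub>_,_\<^esub> _" [0, 0, 90] 90) where
  "\<partial>\<^bsub>A,B\<^esub> \<mu> = GMap (arity \<mu>) (deg \<mu> - 1)
     (\<lambda>xs. df B (tdeg xs + deg \<mu>) (app \<mu> xs) - ksign (deg \<mu>) *\<^sub>R
        (\<Sum>j<length xs. ksign (tdeg (take j xs)) *\<^sub>R
           app \<mu> (xs[j := (fst (xs ! j) - 1, df A (fst (xs ! j)) (snd (xs ! j)))])))"


section \<open>Weak Lie 3-algebras\<close>

record 'v weak_lie3 = "'v complex3" +
  lam2 :: "('v, 'v) gmap"
  lam3 :: "('v, 'v) gmap"
  lam4 :: "('v, 'v) gmap"
  lam21 :: "('v, 'v) gmap"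
  lam211 :: "('v, 'v) gmap"
  lam31 :: "('v, 'v) gmap"
  lam32 :: "('v, 'v) gmap"

definition leibniz3_algebra :: "('v::real_vector, 'm) weak_lie3_scheme \<Rightarrow> bool" where
  "leibniz3_algebra A \<longleftrightarrow> complex3 A \<and>
   (let l2 = lam2 A; l3 = lam3 A; l4 = lam4 A in
    multilin A A 2 0 l2 \<and> multilin A A 3 1 l3 \<and> multilin A A 4 2 l4 \<and>
    (\<partial>\<^bsub>A,A\<^esub> l2 \<approx>\<^bsub>A\<^esub> zero_map 2 (- 1)) \<and>
    (\<partial>\<^bsub>A,A\<^esub> l3 \<approx>\<^bsub>A\<^esub> l2 \<circ>\<^bsub>2\<^esub> l2 - l2 \<circ>\<^bsub>1\<^esub> l2 - (l2 \<circ>\<^bsub>2\<^esub> l2)\<^bsup>cyc [1,2]\<^esup>) \<and>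
    (\<partial>\<^bsub>A,A\<^esub> l4 \<approx>\<^bsub>A\<^esub> l2 \<circ>\<^bsub>1\<^esub> l3 + l2 \<circ>\<^bsub>2\<^esub> l3 - (l2 \<circ>\<^bsub>2\<^esub> l3)\<^bsup>cyc [1,2]\<^esup>
         + (l2 \<circ>\<^bsub>2\<^esub> l3)\<^bsup>cyc [1,2,3]\<^esup> - l3 \<circ>\<^bsub>1\<^esub> l2 + l3 \<circ>\<^bsub>2\<^esub> l2 - (l3 \<circ>\<^bsub>2\<^esub> l2)\<^bsup>cyc [1,2]\<^esup>
         - l3 \<circ>\<^bsub>3\<^esub> l2 + (l3 \<circ>\<^bsub>3\<^esub> l2)\<^bsup>cyc [2,3]\<^esup> - (l3 \<circ>\<^bsub>3\<^esub> l2)\<^bsup>cyc [1,3,2]\<^esup>) \<and>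
    (zero_map 5 2 \<approx>\<^bsub>A\<^esub> l2 \<circ>\<^bsub>1\<^esub> l4 - l2 \<circ>\<^bsub>2\<^esub> l4 + (l2 \<circ>\<^bsub>2\<^esub> l4)\<^bsup>cyc [1,2]\<^esup>
         - (l2 \<circ>\<^bsub>2\<^esub> l4)\<^bsup>cyc [1,2,3]\<^esup> + (l2 \<circ>\<^bsub>2\<^esub> l4)\<^bsup>cyc [1,2,3,4]\<^esup> + l3 \<circ>\<^bsub>1\<^esub> l3 + l3 \<circ>\<^bsub>2\<^esub> l3
         - (l3 \<circ>\<^bsub>2\<^esub> l3)\<^bsup>cyc [1,2]\<^esup> + (l3 \<circ>\<^bsub>2\<^esub> l3)\<^bsup>cyc [1,2,3]\<^esup> + l3 \<circ>\<^bsub>3\<^esub> l3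
         - (l3 \<circ>\<^bsub>3\<^esub> l3)\<^bsup>cyc [2,3]\<^esup> + (l3 \<circ>\<^bsub>3\<^esub> l3)\<^bsup>cyc [1,3,2]\<^esup> + (l3 \<circ>\<^bsub>3\<^esub> l3)\<^bsup>cyc [2,3,4]\<^esup>
         - (l3 \<circ>\<^bsub>3\<^esub> l3)\<^bsup>cyc [1,3,4,2]\<^esup> + (l3 \<circ>\<^bsub>3\<^esub> l3)\<^bsup>cyc [1,3] \<circ> cyc [2,4]\<^esup> + l4 \<circ>\<^bsub>1\<^esub> l2
         - l4 \<circ>\<^bsub>2\<^esub> l2 + (l4 \<circ>\<^bsub>2\<^esub> l2)\<^bsup>cyc [1,2]\<^esup> + l4 \<circ>\<^bsub>3\<^esub> l2 - (l4 \<circ>\<^bsub>3\<^esub> l2)\<^bsup>cyc [2,3]\<^esup>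
         + (l4 \<circ>\<^bsub>3\<^esub> l2)\<^bsup>cyc [1,3,2]\<^esup> - l4 \<circ>\<^bsub>4\<^esub> l2 + (l4 \<circ>\<^bsub>4\<^esub> l2)\<^bsup>cyc [3,4]\<^esup>
         - (l4 \<circ>\<^bsub>4\<^esub> l2)\<^bsup>cyc [2,4,3]\<^esup> + (l4 \<circ>\<^bsub>4\<^esub> l2)\<^bsup>cyc [1,4,3,2]\<^esup>))"

definition weak_lie3_algebra :: "('v::real_vector, 'm) weak_lie3_scheme \<Rightarrow> bool" where
  "weak_lie3_algebra A \<longleftrightarrow> leibniz3_algebra A \<and>
   (let l2 = lam2 A; l3 = lam3 A; l4 = lam4 A;
        l21 = lam21 A; l211 = lam211 A; l31 = lam31 A; l32 = lam32 A in
    multilin A A 2 1 l21 \<and> multilin A A 2 2 l211 \<and>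
    multilin A A 3 2 l31 \<and> multilin A A 3 2 l32 \<and>
    (\<partial>\<^bsub>A,A\<^esub> l21 \<approx>\<^bsub>A\<^esub> l2 + l2\<^bsup>cyc [1,2]\<^esup>) \<and>
    (\<partial>\<^bsub>A,A\<^esub> l211 \<approx>\<^bsub>A\<^esub> l21 - l21\<^bsup>cyc [1,2]\<^esup>) \<and>
    (\<partial>\<^bsub>A,A\<^esub> l31 \<approx>\<^bsub>A\<^esub> l3 + l3\<^bsup>cyc [1,2]\<^esup> + l2 \<circ>\<^bsub>1\<^esub> l21) \<and>
    (\<partial>\<^bsub>A,A\<^esub> l32 \<approx>\<^bsub>A\<^esub> l3 + l3\<^bsup>cyc [2,3]\<^esup> - l2 \<circ>\<^bsub>2\<^esub> l21 + l21 \<circ>\<^bsub>1\<^esub> l2 + (l21 \<circ>\<^bsub>2\<^esub> l2)\<^bsup>cyc [1,2]\<^esup>) \<and>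
    (l211 + l211\<^bsup>cyc [1,2]\<^esup> \<approx>\<^bsub>A\<^esub> zero_map 2 2) \<and>
    (l31 - l31\<^bsup>cyc [1,2]\<^esup> \<approx>\<^bsub>A\<^esub> l2 \<circ>\<^bsub>1\<^esub> l211) \<and>
    (l31 - l32\<^bsup>cyc [1,2]\<^esup> + l31\<^bsup>cyc [1,3,2]\<^esup> - l32 + l31\<^bsup>cyc [2,3]\<^esup>
         - l32\<^bsup>cyc [1,2,3]\<^esup> \<approx>\<^bsub>A\<^esub> l21 \<circ>\<^bsub>2\<^esub> l21 + l21 \<circ>\<^bsub>1\<^esub> l21 + (l21 \<circ>\<^bsub>2\<^esub> l21)\<^bsup>cyc [1,2]\<^esup>
         + (l211 \<circ>\<^bsub>2\<^esub> l2)\<^bsup>cyc [1,3,2]\<^esup>) \<and>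
    (l32 - l32\<^bsup>cyc [2,3]\<^esup> \<approx>\<^bsub>A\<^esub> - (l2 \<circ>\<^bsub>2\<^esub> l211) + l211 \<circ>\<^bsub>1\<^esub> l2 + (l211 \<circ>\<^bsub>2\<^esub> l2)\<^bsup>cyc [1,2]\<^esup>) \<and>
    (l4 + l4\<^bsup>cyc [1,2]\<^esup> \<approx>\<^bsub>A\<^esub> l2 \<circ>\<^bsub>1\<^esub> l31 - l31 \<circ>\<^bsub>3\<^esub> l2 + (l2 \<circ>\<^bsub>2\<^esub> l31)\<^bsup>cyc [1,2,3]\<^esup>
         + l3 \<circ>\<^bsub>1\<^esub> l21) \<and>
    (l4 + l4\<^bsup>cyc [2,3]\<^esup> \<approx>\<^bsub>A\<^esub> l2 \<circ>\<^bsub>1\<^esub> l32 - l3 \<circ>\<^bsub>2\<^esub> l21 + l2 \<circ>\<^bsub>2\<^esub> l31 - l31 \<circ>\<^bsub>1\<^esub> l2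
         - (l31 \<circ>\<^bsub>2\<^esub> l2)\<^bsup>cyc [1,2]\<^esup> - (l31 \<circ>\<^bsub>3\<^esub> l2)\<^bsup>cyc [1,3,2]\<^esup>) \<and>
    (l4 + l4\<^bsup>cyc [3,4]\<^esup> \<approx>\<^bsub>A\<^esub> l21 \<circ>\<^bsub>1\<^esub> l3 - l32 \<circ>\<^bsub>1\<^esub> l2 + l32 \<circ>\<^bsub>2\<^esub> l2 - (l32 \<circ>\<^bsub>2\<^esub> l2)\<^bsup>cyc [1,2]\<^esup>
         + l3 \<circ>\<^bsub>3\<^esub> l21 + (l32 \<circ>\<^bsub>3\<^esub> l2)\<^bsup>cyc [2,3]\<^esup> - (l32 \<circ>\<^bsub>3\<^esub> l2)\<^bsup>cyc [1,3,2]\<^esup> + l2 \<circ>\<^bsub>2\<^esub> l32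
         - (l2 \<circ>\<^bsub>2\<^esub> l32)\<^bsup>cyc [1,2]\<^esup> + (l21 \<circ>\<^bsub>2\<^esub> l3)\<^bsup>cyc [1,2,3]\<^esup>))"

record ('v, 'w) weak_mor =
  mor1 :: "('v, 'w) gmap"
  mor2 :: "('v, 'w) gmap"
  mor21 :: "('v, 'w) gmap"
  mor3 :: "('v, 'w) gmap"

definition weak_morphism ::
    "('v::real_vector, 'm) weak_lie3_scheme \<Rightarrow> ('w::real_vector, 'l) weak_lie3_scheme \<Rightarrow>
     ('v, 'w) weak_mor \<Rightarrow> bool" where
  "weak_morphism A B f \<longleftrightarrow>
   (let l2 = lam2 A; l3 = lam3 A; l4 = lam4 A;
        l21 = lam21 A; l211 = lam211 A; l31 = lam31 A; l32 = lam32 A;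
        l2' = lam2 B; l3' = lam3 B; l4' = lam4 B;
        l21' = lam21 B; l211' = lam211 B; l31' = lam31 B; l32' = lam32 B;
        f1 = mor1 f; f2 = mor2 f; f21 = mor21 f; f3 = mor3 f in
    multilin A B 1 0 f1 \<and> multilin A B 2 1 f2 \<and>
    multilin A B 2 2 f21 \<and> multilin A B 3 2 f3 \<and>
    (\<partial>\<^bsub>A,B\<^esub> f1 \<approx>\<^bsub>A\<^esub> zero_map 1 (- 1)) \<and>
    (\<partial>\<^bsub>A,B\<^esub> f2 \<approx>\<^bsub>A\<^esub> f1 \<odot> [l2] - l2' \<odot> [f1, f1]) \<and>
    (\<partial>\<^bsub>A,B\<^esub> f3 \<approx>\<^bsub>A\<^esub> f1 \<odot> [l3] - f2 \<circ>\<^bsub>2\<^esub> l2 + f2 \<circ>\<^bsub>1\<^esub> l2 + (f2 \<circ>\<^bsub>2\<^esub> l2)\<^bsup>cyc [1,2]\<^esup>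
         - l3' \<odot> [f1, f1, f1] - l2' \<odot> [f1, f2] + l2' \<odot> [f2, f1] + (l2' \<odot> [f1, f2])\<^bsup>cyc [1,2]\<^esup>) \<and>
    (f1 \<odot> [l4] - l4' \<odot> [f1, f1, f1, f1] \<approx>\<^bsub>A\<^esub> f2 \<circ>\<^bsub>1\<^esub> l3 + f2 \<circ>\<^bsub>2\<^esub> l3 - (f2 \<circ>\<^bsub>2\<^esub> l3)\<^bsup>cyc [1,2]\<^esup>
         + (f2 \<circ>\<^bsub>2\<^esub> l3)\<^bsup>cyc [1,2,3]\<^esup> - f3 \<circ>\<^bsub>1\<^esub> l2 + f3 \<circ>\<^bsub>2\<^esub> l2 - (f3 \<circ>\<^bsub>2\<^esub> l2)\<^bsup>cyc [1,2]\<^esup>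
         - f3 \<circ>\<^bsub>3\<^esub> l2 + (f3 \<circ>\<^bsub>3\<^esub> l2)\<^bsup>cyc [2,3]\<^esup> - (f3 \<circ>\<^bsub>3\<^esub> l2)\<^bsup>cyc [1,3,2]\<^esup> + l2' \<odot> [f3, f1]
         + l2' \<odot> [f1, f3] - (l2' \<odot> [f1, f3])\<^bsup>cyc [1,2]\<^esup> + (l2' \<odot> [f1, f3])\<^bsup>cyc [1,2,3]\<^esup>
         - l2' \<odot> [f2, f2] + (l2' \<odot> [f2, f2])\<^bsup>cyc [2,3]\<^esup> - (l2' \<odot> [f2, f2])\<^bsup>cyc [1,3,2]\<^esup>
         + l3' \<odot> [f2, f1, f1] - l3' \<odot> [f1, f2, f1] + (l3' \<odot> [f1, f2, f1])\<^bsup>cyc [1,2]\<^esup>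
         + l3' \<odot> [f1, f1, f2] - (l3' \<odot> [f1, f1, f2])\<^bsup>cyc [2,3]\<^esup>
         + (l3' \<odot> [f1, f1, f2])\<^bsup>cyc [1,3,2]\<^esup>) \<and>
    (\<partial>\<^bsub>A,B\<^esub> f21 \<approx>\<^bsub>A\<^esub> - f2 - f2\<^bsup>cyc [1,2]\<^esup> + f1 \<odot> [l21] - l21' \<odot> [f1, f1]) \<and>
    (f1 \<odot> [l211] - l211' \<odot> [f1, f1] \<approx>\<^bsub>A\<^esub> f21 - f21\<^bsup>cyc [1,2]\<^esup>) \<and>
    (f1 \<odot> [l31] - l31' \<odot> [f1, f1, f1] \<approx>\<^bsub>A\<^esub> f3 + f3\<^bsup>cyc [1,2]\<^esup> + f2 \<circ>\<^bsub>1\<^esub> l21 + l2' \<odot> [f21, f1]) \<and>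
    (f1 \<odot> [l32] - l32' \<odot> [f1, f1, f1] \<approx>\<^bsub>A\<^esub> f3 + f3\<^bsup>cyc [2,3]\<^esup> - f2 \<circ>\<^bsub>2\<^esub> l21 + f21 \<circ>\<^bsub>1\<^esub> l2
         + (f21 \<circ>\<^bsub>2\<^esub> l2)\<^bsup>cyc [1,2]\<^esup> - l2' \<odot> [f1, f21] - l21' \<odot> [f2, f1]
         - (l21' \<odot> [f1, f2])\<^bsup>cyc [1,2]\<^esup>))"

definition mor_comp ::
    "('w, 'u::real_vector) weak_mor \<Rightarrow> ('v, 'w::real_vector) weak_mor \<Rightarrow> ('v, 'u) weak_mor" where
  "mor_comp f' f =
   (let f1 = mor1 f; f2 = mor2 f; f21 = mor21 f; f3 = mor3 f;
        f1' = mor1 f'; f2' = mor2 f'; f21' = mor21 f'; f3' = mor3 f' in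
    \<lparr> mor1 = f1' \<odot> [f1],
      mor2 = f2' \<odot> [f1, f1] + f1' \<odot> [f2],
      mor21 = f21' \<odot> [f1, f1] + f1' \<odot> [f21],
      mor3 = f3' \<odot> [f1, f1, f1] - f2' \<odot> [f2, f1] + f2' \<odot> [f1, f2]
        - (f2' \<odot> [f1, f2])\<^bsup>cyc [1,2]\<^esup> + f1' \<odot> [f3] \<rparr>)"

definition mor_id :: "('v, 'v::zero) weak_mor" where
  "mor_id = \<lparr> mor1 = id_map, mor2 = zero_map 2 1, mor21 = zero_map 2 2, mor3 = zero_map 3 2 \<rparr>"

definition mor_eq ::
    "('v, 'm) complex3_scheme \<Rightarrow> ('v, 'w) weak_mor \<Rightarrow> ('v, 'w) weak_mor \<Rightarrow> bool" where
  "mor_eq A f g \<longleftrightarrow> (mor1 f \<approx>\<^bsub>A\<^esub> mor1 g) \<and> (mor2 f \<approx>\<^bsub>A\<^esub> mor2 g) \<and>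
     (mor21 f \<approx>\<^bsub>A\<^esub> mor21 g) \<and> (mor3 f \<approx>\<^bsub>A\<^esub> mor3 g)"

definition weak_lie3_isomorphic ::
    "('v::real_vector) weak_lie3 \<Rightarrow> ('w::real_vector) weak_lie3 \<Rightarrow> bool" where
  "weak_lie3_isomorphic A B \<longleftrightarrow>
     weak_lie3_algebra A \<and> weak_lie3_algebra B \<and>
     (\<exists>f g. weak_morphism A B f \<and> weak_morphism B A g \<and>
        mor_eq A (mor_comp g f) mor_id \<and> mor_eq B (mor_comp f g) mor_id)"


section \<open>Smooth manifolds\<close>

text \<open>
  Model spaces are the library's \<open>Euclidean_space n\<close>, that is, the real sequences supported
  in \<open>{..<n}\<close>, so that the dimension is an arbitrary natural number. \<open>Ck k n U f\<close> means that
  \<open>f\<close> is of class \<open>C\<^sup>k\<close> on the open set \<open>U\<close>: the partial derivatives up to order \<open>k\<close> exist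
  and are continuous.
\<close>

primrec Ck :: "nat \<Rightarrow> nat \<Rightarrow> (nat \<Rightarrow> real) set \<Rightarrow> ((nat \<Rightarrow> real) \<Rightarrow> real) \<Rightarrow> bool" where
  "Ck 0 n U f \<longleftrightarrow> continuous_map (subtopology (Euclidean_space n) U) euclideanreal f"
| "Ck (Suc k) n U f \<longleftrightarrow>
     continuous_map (subtopology (Euclidean_space n) U) euclideanreal f \<and>
     (\<forall>i<n. (\<forall>x\<in>U. (\<lambda>t. f (x(i := t))) differentiable (at (x i))) \<and>
            Ck k n U (\<lambda>x. deriv (\<lambda>t. f (x(i := t))) (x i)))"

definition smooth_fun :: "nat \<Rightarrow> (nat \<Rightarrow> real) set \<Rightarrow> ((nat \<Rightarrow> real) \<Rightarrow> real) \<Rightarrow> bool" where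
  "smooth_fun n U f \<longleftrightarrow> (\<forall>k. Ck k n U f)"

record 'a smfd =
  mtop :: "'a topology"
  mdim :: nat
  atlas :: "('a set \<times> ('a \<Rightarrow> nat \<Rightarrow> real)) set"

definition is_chart :: "'a smfd \<Rightarrow> 'a set \<times> ('a \<Rightarrow> nat \<Rightarrow> real) \<Rightarrow> bool" where
  "is_chart M = (\<lambda>(U, \<phi>). openin (mtop M) U \<and> openin (Euclidean_space (mdim M)) (\<phi> ` U) \<and>
     homeomorphic_map (subtopology (mtop M) U)
       (subtopology (Euclidean_space (mdim M)) (\<phi> ` U)) \<phi>)"

definition smooth_manifold :: "'a smfd \<Rightarrow> bool" where
  "smooth_manifold M \<longleftrightarrow>
     Hausdorff_space (mtop M) \<and> second_countable (mtop M) \<and>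
     (\<forall>c\<in>atlas M. is_chart M c) \<and> (\<Union>(U, \<phi>)\<in>atlas M. U) = topspace (mtop M) \<and>
     (\<forall>(U, \<phi>)\<in>atlas M. \<forall>(V, \<psi>)\<in>atlas M. \<forall>i<mdim M.
        smooth_fun (mdim M) (\<phi> ` (U \<inter> V)) (\<lambda>x. \<psi> (inv_into U \<phi> x) i))"

text \<open>
  Functions on the manifold are extended by zero outside of the underlying space, so that the
  zero of the function type is the zero function on the manifold.
\<close>

definition Cinf :: "'a smfd \<Rightarrow> ('a \<Rightarrow> real) set" where
  "Cinf M = {f. (\<forall>p. p \<notin> topspace (mtop M) \<longrightarrow> f p = 0) \<and>
     (\<forall>(U, \<phi>)\<in>atlas M. smooth_fun (mdim M) (\<phi> ` U) (f \<circ> inv_into U \<phi>))}"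


section \<open>Vector fields and differential forms\<close>

text \<open>
  As in Helgason's book, vector fields are the derivations of the algebra of smooth functions,
  and differential forms of degree \<open>k\<close> are the alternating multilinear maps from
  \<open>k\<close>-tuples of vector fields to smooth functions, over the ring of smooth functions.
  Vector fields are extended by zero to non-smooth functions, and forms are extended by zero
  to lists that are not \<open>k\<close>-tuples of vector fields. A \<open>0\<close>-form is determined by its value on
  the empty list, an arbitrary smooth function.
\<close>

instantiation "fun" :: (type, real_vector) real_vector
begin
definition "r *\<^sub>R f = (\<lambda>x. r *\<^sub>R f x)"
instance
  by standard (simp_all add: scaleR_fun_def fun_eq_iff scaleR_add_right scaleR_add_left)
end

type_synonym 'a vfield = "('a \<Rightarrow> real) \<Rightarrow> ('a \<Rightarrow> real)"
type_synonym 'a dform = "'a vfield list \<Rightarrow> ('a \<Rightarrow> real)"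

definition vfields :: "'a smfd \<Rightarrow> 'a vfield set" where
  "vfields M = {X.
     (\<forall>f\<in>Cinf M. X f \<in> Cinf M) \<and> (\<forall>f. f \<notin> Cinf M \<longrightarrow> X f = 0) \<and>
     (\<forall>f\<in>Cinf M. \<forall>g\<in>Cinf M. \<forall>a b. X (a *\<^sub>R f + b *\<^sub>R g) = a *\<^sub>R X f + b *\<^sub>R X g) \<and>
     (\<forall>f\<in>Cinf M. \<forall>g\<in>Cinf M. X (f * g) = f * X g + g * X f)}"

definition vbracket :: "'a vfield \<Rightarrow> 'a vfield \<Rightarrow> 'a vfield" where
  "vbracket X Y = (\<lambda>f. X (Y f) - Y (X f))"

definition forms :: "'a smfd \<Rightarrow> nat \<Rightarrow> 'a dform set" where
  "forms M k = {\<alpha>.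
     (\<forall>xs. \<alpha> xs \<in> Cinf M) \<and>
     (\<forall>xs. \<not> (length xs = k \<and> set xs \<subseteq> vfields M) \<longrightarrow> \<alpha> xs = 0) \<and>
     (\<forall>xs. length xs = k \<and> set xs \<subseteq> vfields M \<longrightarrow>
        (\<forall>i<k. \<forall>X\<in>vfields M. \<forall>Y\<in>vfields M.
           \<alpha> (xs[i := X + Y]) = \<alpha> (xs[i := X]) + \<alpha> (xs[i := Y])) \<and>
        (\<forall>i<k. \<forall>X\<in>vfields M. \<forall>f\<in>Cinf M.
           \<alpha> (xs[i := (\<lambda>g. f * X g)]) = f * \<alpha> (xs[i := X])) \<and>
        (\<forall>i j. i < j \<and> j < k \<and> xs ! i = xs ! j \<longrightarrow> \<alpha> xs = 0))}"

definition omit :: "nat \<Rightarrow> 'b list \<Rightarrow> 'b list" where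
  "omit i xs = take i xs @ drop (Suc i) xs"

text \<open>The exterior derivative, normalised without the factor \<open>1/(k+1)\<close>.\<close>

definition ext_deriv :: "'a smfd \<Rightarrow> 'a dform \<Rightarrow> 'a dform" where
  "ext_deriv M \<alpha> xs = (if set xs \<subseteq> vfields M then
       (\<Sum>i<length xs. (- 1) ^ i *\<^sub>R (xs ! i) (\<alpha> (omit i xs))) +
       (\<Sum>(i, j)\<in>{(i, j). i < j \<and> j < length xs}.
          (- 1) ^ (i + j) *\<^sub>R \<alpha> (vbracket (xs ! i) (xs ! j) # omit i (omit j xs)))
     else 0)"

definition interior :: "'a vfield \<Rightarrow> 'a dform \<Rightarrow> 'a dform" where
  "interior X \<alpha> xs = \<alpha> (X # xs)"

text \<open>\<open>interiors [v\<^sub>1, \<dots>, v\<^sub>k]\<close> is \<open>\<iota>(v\<^sub>k) \<dots> \<iota>(v\<^sub>1)\<close>; the innermost contraction is with \<open>v\<^sub>1\<close>.\<close>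

definition interiors :: "'a vfield list \<Rightarrow> 'a dform \<Rightarrow> 'a dform" where
  "interiors vs \<alpha> = fold interior vs \<alpha>"

definition lie_deriv :: "'a smfd \<Rightarrow> 'a vfield \<Rightarrow> 'a dform \<Rightarrow> 'a dform" where
  "lie_deriv M X \<alpha> xs = (if set xs \<subseteq> vfields M then
       X (\<alpha> xs) - (\<Sum>i<length xs. \<alpha> (xs[i := vbracket X (xs ! i)]))
     else 0)"


section \<open>Plectic manifolds\<close>

text \<open>
  Non-degeneracy is a condition at every point \<open>p\<close>. Every tangent vector at \<open>p\<close> is the value of
  a vector field \<open>v\<close>; the value at \<open>p\<close> of a form depends only on the values of the vector
  fields at \<open>p\<close>; and \<open>v\<close> vanishes at \<open>p\<close> iff \<open>(v f)(p) = 0\<close> for all smooth \<open>f\<close>.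
\<close>

definition nondegenerate :: "'a smfd \<Rightarrow> nat \<Rightarrow> 'a dform \<Rightarrow> bool" where
  "nondegenerate M n \<omega> \<longleftrightarrow>
     (\<forall>p\<in>topspace (mtop M). \<forall>v\<in>vfields M.
        (\<forall>xs. length xs = n \<and> set xs \<subseteq> vfields M \<longrightarrow> interior v \<omega> xs p = 0) \<longrightarrow>
        (\<forall>f\<in>Cinf M. v f p = 0))"

definition plectic_manifold :: "nat \<Rightarrow> 'a smfd \<Rightarrow> 'a dform \<Rightarrow> bool" where
  "plectic_manifold n M \<omega> \<longleftrightarrow>
     smooth_manifold M \<and> \<omega> \<in> forms M (n + 1) \<and> ext_deriv M \<omega> = 0 \<and> nondegenerate M n \<omega>"

definition ham_forms :: "nat \<Rightarrow> 'a smfd \<Rightarrow> 'a dform \<Rightarrow> 'a dform set" where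
  "ham_forms n M \<omega> =
     {\<alpha> \<in> forms M (n - 1). \<exists>v\<in>vfields M. ext_deriv M \<alpha> = - interior v \<omega>}"

definition ham_vfield :: "nat \<Rightarrow> 'a smfd \<Rightarrow> 'a dform \<Rightarrow> 'a dform \<Rightarrow> 'a vfield" where
  "ham_vfield n M \<omega> \<alpha> = (if \<alpha> \<in> ham_forms n M \<omega>
     then THE v. v \<in> vfields M \<and> ext_deriv M \<alpha> = - interior v \<omega> else 0)"

text \<open>
  The 3-term complex of a 3-plectic manifold, with smooth functions as \<open>0\<close>-forms.
  The de Rham differential only acts in degrees \<open>1\<close> and \<open>2\<close>.
\<close>

definition plectic_gr :: "'a smfd \<Rightarrow> 'a dform \<Rightarrow> int \<Rightarrow> 'a dform set" where
  "plectic_gr M \<omega> i =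
     (if i = 0 then ham_forms 3 M \<omega> else if i = 1 then forms M 1
      else if i = 2 then forms M 0 else {0})"

definition plectic_df :: "'a smfd \<Rightarrow> int \<Rightarrow> 'a dform \<Rightarrow> 'a dform" where
  "plectic_df M i \<alpha> = (if i = 1 \<or> i = 2 then ext_deriv M \<alpha> else 0)"

definition Linfty :: "'a smfd \<Rightarrow> 'a dform \<Rightarrow> 'a dform weak_lie3" where
  "Linfty M \<omega> = (let v = \<lambda>x. ham_vfield 3 M \<omega> (snd x) in
     \<lparr> gr = plectic_gr M \<omega>, df = plectic_df M,
       lam2 = GMap 2 0 (\<lambda>xs. interiors (map v xs) \<omega>),
       lam3 = GMap 3 1 (\<lambda>xs. - interiors (map v xs) \<omega>),
       lam4 = GMap 4 2 (\<lambda>xs. - interiors (map v xs) \<omega>),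
       lam21 = zero_map 2 1, lam211 = zero_map 2 2,
       lam31 = zero_map 3 2, lam32 = zero_map 3 2 \<rparr>)"

definition Leib :: "'a smfd \<Rightarrow> 'a dform \<Rightarrow> 'a dform weak_lie3" where
  "Leib M \<omega> = (let v = \<lambda>x. ham_vfield 3 M \<omega> (snd x) in
     \<lparr> gr = plectic_gr M \<omega>, df = plectic_df M,
       lam2 = GMap 2 0 (\<lambda>xs. lie_deriv M (v (xs ! 0)) (snd (xs ! 1))),
       lam3 = zero_map 3 1, lam4 = zero_map 4 2,
       lam21 = GMap 2 1 (\<lambda>xs. interior (v (xs ! 0)) (snd (xs ! 1))
                             + interior (v (xs ! 1)) (snd (xs ! 0))),
       lam211 = zero_map 2 2, lam31 = zero_map 3 2, lam32 = zero_map 3 2 \<rparr>)"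

end

theory Submission
  imports Defs
begin

text \<open>
  The isomorphism is the identity in arity one, with \<open>f\<^sub>2(\<alpha>,\<beta>) = - \<iota>(v\<^sub>\<alpha>)\<beta>\<close>, \<open>f\<^sub>2\<^sub>;\<^sub>1 = 0\<close> and
  \<open>f\<^sub>3(\<alpha>,\<beta>,\<gamma>) = - \<iota>(v\<^sub>\<alpha>,v\<^sub>\<beta>)\<gamma>\<close>; its inverse is given by the same formulas with the sign of
  \<open>f\<^sub>2\<close> reversed. This works since \<open>\<L>(v\<^sub>\<alpha>)\<beta> = d\<iota>(v\<^sub>\<alpha>)\<beta> + \<iota>(v\<^sub>\<alpha>,v\<^sub>\<beta>)\<omega>\<close> for Hamiltonian \<open>\<alpha>\<close> and \<open>\<beta>\<close>.

  In every identity, each term has at most one argument that does not enter through its Hamiltonian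
  vector field. Elements of positive degree have no such vector field, so all terms vanish
  when two arguments have positive degree, and all Koszul signs are trivial otherwise. What remains
  is brought to a normal form by the Cartan relations, moving \<open>d\<close> to the right of the Lie
  derivatives and these to the right of the interior products, together with
  \<open>d\<alpha> = - \<iota>(v\<^sub>\<alpha>)\<omega>\<close>, \<open>d\<omega> = 0\<close> and \<open>\<L>(v\<^sub>\<alpha>)\<omega> = 0\<close>.
\<close>

section \<open>Smooth functions\<close>

text \<open>The formulas come from the axioms of a weak morphism. The condition on the boundary of
  \<open>f\<^sub>2\<close> asks for a primitive of -d\<iota>(v_\<alpha>)\<beta>, which suggests
  \<open>f\<^sub>2\<close>. Its symmetrisation is exactly minus \<open>lam21\<close> of the Leibniz
  side, which permits \<open>f\<^sub>2\<^sub>;\<^sub>1 = 0\<close>. The condition for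
  \<open>lam31\<close> then makes \<open>f\<^sub>3\<close> antisymmetric in its first two arguments,
  and the one for \<open>lam32\<close> prescribes its symmetrisation in the last two;
  \<iota>(v_\<alpha>)\<iota>(v_\<beta>)\<gamma> meets both.

  The normal form does not see relations that hold in one degree only, such as the vanishing of the
  contraction of a function. These are no consequence of the Cartan relations and are supplied
  separately where an identity depends on them.

  The Cartan relations are proved without coordinates: a form takes a list of derivations, and each
  operator obeys a recursion that strips the first argument. Charts matter only for showing that the
  smooth functions form an algebra.\<close>

lemma fun_upd_eventually_in_open:
  assumes U: "openin (Euclidean_space n) U" and x: "x \<in> U" and i: "i < n"
  shows "\<forall>\<^sub>F t in nhds (x i). x(i := t) \<in> U"
proof -
  have "x \<in> topspace (Euclidean_space n)"
    using U x openin_subset by blast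
  then have "continuous_map euclideanreal (Euclidean_space n) (\<lambda>t. x(i := t))"
    unfolding Euclidean_space_def using i
    by (auto simp: continuous_map_in_subtopology continuous_map_componentwise_UNIV)
  then have "open {t. x(i := t) \<in> U}"
    using openin_continuous_map_preimage[OF _ U] by fastforce
  with x show ?thesis
    by (auto simp: eventually_nhds)
qed

text \<open>A coordinate line through a point of an open \<open>U\<close> stays in \<open>U\<close>
  for parameters near the start, so partial derivatives on \<open>U\<close> see only the values on
  \<open>U\<close>. Outside of \<open>U\<close> the functions and their \<open>deriv\<close> are
  arbitrary, hence the sum and product rules can be used on \<open>U\<close> only.\<close>

lemma Ck_cong:
  assumes U: "openin (Euclidean_space n) U"
    and "\<And>x. x \<in> U \<Longrightarrow> f x = g x" and "Ck k n U f"
  shows "Ck k n U g"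
  using assms(2,3)
proof (induction k arbitrary: f g)
  case 0
  then show ?case
    by (auto intro: continuous_map_eq)
next
  case (Suc k)
  have ev: "\<forall>\<^sub>F t in nhds (x i). f (x(i := t)) = g (x(i := t))" if "x \<in> U" "i < n" for x i
    using fun_upd_eventually_in_open[OF U that] by eventually_elim (rule Suc.prems)
  have "(\<lambda>t. g (x(i := t))) differentiable (at (x i))" if "x \<in> U" "i < n" for x i
  proof -
    have "(\<lambda>t. f (x(i := t))) differentiable (at (x i))"
      using Suc.prems that by simp
    then show ?thesis
      using ev[OF that] unfolding real_differentiable_def
      by (auto simp: DERIV_cong_ev)
  qed
  moreover have "Ck k n U (\<lambda>x. deriv (\<lambda>t. g (x(i := t))) (x i))" if "i < n" for i
  proof (rule Suc.IH)
    show "Ck k n U (\<lambda>x. deriv (\<lambda>t. f (x(i := t))) (x i))"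
      using Suc.prems that by simp
    show "deriv (\<lambda>t. f (x(i := t))) (x i) = deriv (\<lambda>t. g (x(i := t))) (x i)" if "x \<in> U" for x
      by (rule deriv_cong_ev[OF ev[OF that \<open>i < n\<close>] refl])
  qed
  ultimately show ?case
    using Suc.prems by (auto intro: continuous_map_eq)
qed

text \<open>Serves the product rule, where a derivative is multiplied by an undifferentiated factor:
  the factor has one order more than the induction hypothesis asks for.\<close>

lemma Ck_SucD: "Ck (Suc k) n U f \<Longrightarrow> Ck k n U f"
  by (induction k arbitrary: f) auto

lemma Ck_const: "Ck k n U (\<lambda>x. c)"
  by (induction k arbitrary: c) auto

lemma Ck_add:
  assumes U: "openin (Euclidean_space n) U" and "Ck k n U f" "Ck k n U g"
  shows "Ck k n U (\<lambda>x. f x + g x)"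
  using assms(2,3)
proof (induction k arbitrary: f g)
  case 0
  then show ?case
    by (auto intro: continuous_map_add)
next
  case (Suc k)
  have "Ck k n U (\<lambda>x. deriv (\<lambda>t. f (x(i := t)) + g (x(i := t))) (x i))" if "i < n" for i
  proof (rule Ck_cong[OF U])
    show "Ck k n U (\<lambda>x. deriv (\<lambda>t. f (x(i := t))) (x i) + deriv (\<lambda>t. g (x(i := t))) (x i))"
      using Suc that by (auto simp del: fun_upd_apply)
    show "deriv (\<lambda>t. f (x(i := t))) (x i) + deriv (\<lambda>t. g (x(i := t))) (x i)
        = deriv (\<lambda>t. f (x(i := t)) + g (x(i := t))) (x i)" if "x \<in> U" for x
      using Suc.prems that \<open>i < n\<close>
      by (intro DERIV_imp_deriv[symmetric] DERIV_add)
        (auto simp: DERIV_deriv_iff_real_differentiable)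
  qed
  then show ?case
    using Suc.prems by (auto intro: continuous_map_add)
qed

lemma Ck_mult:
  assumes U: "openin (Euclidean_space n) U" and "Ck k n U f" "Ck k n U g"
  shows "Ck k n U (\<lambda>x. f x * g x)"
  using assms(2,3)
proof (induction k arbitrary: f g)
  case 0
  then show ?case
    by (auto intro: continuous_map_real_mult)
next
  case (Suc k)
  have "Ck k n U (\<lambda>x. deriv (\<lambda>t. f (x(i := t)) * g (x(i := t))) (x i))" if "i < n" for i
  proof (rule Ck_cong[OF U])
    show "Ck k n U (\<lambda>x. deriv (\<lambda>t. f (x(i := t))) (x i) * g x + deriv (\<lambda>t. g (x(i := t))) (x i) * f x)"
      using Suc.prems that Ck_SucD[OF Suc.prems(1)] Ck_SucD[OF Suc.prems(2)]
      by (intro Ck_add[OF U] Suc.IH) (auto simp del: fun_upd_apply)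
    show "deriv (\<lambda>t. f (x(i := t))) (x i) * g x + deriv (\<lambda>t. g (x(i := t))) (x i) * f x
        = deriv (\<lambda>t. f (x(i := t)) * g (x(i := t))) (x i)" if "x \<in> U" for x
    proof (rule DERIV_imp_deriv[symmetric])
      have "((\<lambda>t. f (x(i := t))) has_real_derivative deriv (\<lambda>t. f (x(i := t))) (x i)) (at (x i))"
           "((\<lambda>t. g (x(i := t))) has_real_derivative deriv (\<lambda>t. g (x(i := t))) (x i)) (at (x i))"
        using Suc.prems that \<open>i < n\<close> by (auto simp: DERIV_deriv_iff_real_differentiable)
      from DERIV_mult[OF this]
      show "((\<lambda>t. f (x(i := t)) * g (x(i := t))) has_real_derivative
          deriv (\<lambda>t. f (x(i := t))) (x i) * g x + deriv (\<lambda>t. g (x(i := t))) (x i) * f x) (at (x i))"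
        by simp
    qed
  qed
  then show ?case
    using Suc.prems by (auto intro: continuous_map_real_mult)
qed

lemma smooth_fun_add:
  "\<lbrakk>openin (Euclidean_space n) U; smooth_fun n U f; smooth_fun n U g\<rbrakk>
     \<Longrightarrow> smooth_fun n U (\<lambda>x. f x + g x)"
  by (simp add: smooth_fun_def Ck_add)

lemma smooth_fun_mult:
  "\<lbrakk>openin (Euclidean_space n) U; smooth_fun n U f; smooth_fun n U g\<rbrakk>
     \<Longrightarrow> smooth_fun n U (\<lambda>x. f x * g x)"
  by (simp add: smooth_fun_def Ck_mult)

text \<open>The constants inside the ring \<open>Cinf M\<close>, whose elements vanish off the
  manifold. They reduce linearity over the reals to linearity over smooth functions.\<close>

definition const_on :: "'a smfd \<Rightarrow> real \<Rightarrow> 'a \<Rightarrow> real" where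
  "const_on M c = (\<lambda>p. if p \<in> topspace (mtop M) then c else 0)"

locale smooth_mfd =
  fixes M :: "'a smfd"
  assumes smooth: "smooth_manifold M"
begin

lemma chart:
  assumes "(U, \<phi>) \<in> atlas M"
  shows "openin (Euclidean_space (mdim M)) (\<phi> ` U)" "U \<subseteq> topspace (mtop M)"
  using assms smooth openin_subset[of "mtop M" U]
  by (auto simp: smooth_manifold_def is_chart_def)

lemma Cinf_outside: "f \<in> Cinf M \<Longrightarrow> p \<notin> topspace (mtop M) \<Longrightarrow> f p = 0"
  by (simp add: Cinf_def)

lemma Cinf_add [intro, simp]: "f \<in> Cinf M \<Longrightarrow> g \<in> Cinf M \<Longrightarrow> f + g \<in> Cinf M"
  unfolding Cinf_def using smooth_fun_add chart by (fastforce simp: comp_def)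

lemma Cinf_mult [intro, simp]: "f \<in> Cinf M \<Longrightarrow> g \<in> Cinf M \<Longrightarrow> f * g \<in> Cinf M"
  unfolding Cinf_def using smooth_fun_mult chart by (fastforce simp: comp_def)

lemma Cinf_const [intro, simp]: "const_on M c \<in> Cinf M"
proof -
  have "smooth_fun (mdim M) (\<phi> ` U) (const_on M c \<circ> inv_into U \<phi>)" if "(U, \<phi>) \<in> atlas M" for U \<phi>
  proof -
    have "const_on M c (inv_into U \<phi> x) = c" if "x \<in> \<phi> ` U" for x
      using chart(2)[OF \<open>(U, \<phi>) \<in> atlas M\<close>] inv_into_into[OF that] by (auto simp: const_on_def)
    then show ?thesis
      unfolding smooth_fun_def
      by (intro allI Ck_cong[OF chart(1)[OF that] _ Ck_const[of _ _ _ c]]) simp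
  qed
  then show ?thesis
    by (auto simp: Cinf_def const_on_def)
qed

lemma const_on_mult: "f \<in> Cinf M \<Longrightarrow> const_on M c * f = c *\<^sub>R f"
  by (auto simp: const_on_def fun_eq_iff scaleR_fun_def Cinf_outside)

lemma Cinf_scaleR [intro, simp]: "f \<in> Cinf M \<Longrightarrow> c *\<^sub>R f \<in> Cinf M"
  using Cinf_mult[OF Cinf_const] by (metis const_on_mult)

lemma Cinf_0 [intro, simp]: "0 \<in> Cinf M"
  using Cinf_scaleR[OF Cinf_const, of 0 0] by simp

lemma Cinf_uminus [intro, simp]: "f \<in> Cinf M \<Longrightarrow> - f \<in> Cinf M"
  using Cinf_scaleR[of f "- 1"] by simp

lemma Cinf_diff [intro, simp]: "f \<in> Cinf M \<Longrightarrow> g \<in> Cinf M \<Longrightarrow> f - g \<in> Cinf M"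
  using Cinf_add[of f "- g"] by simp

lemma Cinf_sum [intro, simp]: "(\<And>i. i \<in> A \<Longrightarrow> f i \<in> Cinf M) \<Longrightarrow> sum f A \<in> Cinf M"
  by (induction A rule: infinite_finite_induct) auto

end

section \<open>Cartan calculus\<close>

lemma scaleR_fun_apply [simp]: "(c *\<^sub>R f) x = c *\<^sub>R f x"
  by (simp add: scaleR_fun_def)

context smooth_mfd
begin

section \<open>Derivations: module structure and Lie bracket\<close>

lemma vfield_Cinf [intro, simp]: "X \<in> vfields M \<Longrightarrow> X f \<in> Cinf M"
proof (cases "f \<in> Cinf M")
  case True
  assume "X \<in> vfields M"
  then have "\<forall>f\<in>Cinf M. X f \<in> Cinf M"
    unfolding vfields_def mem_Collect_eq by (elim conjE)
  with True show ?thesis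
    by simp
next
  case False
  assume "X \<in> vfields M"
  then have "\<forall>f. f \<notin> Cinf M \<longrightarrow> X f = 0"
    unfolding vfields_def mem_Collect_eq by (elim conjE)
  with False show ?thesis
    by simp
qed

lemma vfield_lin:
  assumes "X \<in> vfields M" "f \<in> Cinf M" "g \<in> Cinf M"
  shows "X (a *\<^sub>R f + b *\<^sub>R g) = a *\<^sub>R X f + b *\<^sub>R X g"
proof -
  have "\<forall>f\<in>Cinf M. \<forall>g\<in>Cinf M. \<forall>a b. X (a *\<^sub>R f + b *\<^sub>R g) = a *\<^sub>R X f + b *\<^sub>R X g"
    using assms(1) unfolding vfields_def mem_Collect_eq by (elim conjE)
  then show ?thesis
    using assms(2,3) by simp
qed

lemma vfieldsI:
  assumes "\<And>f. f \<in> Cinf M \<Longrightarrow> X f \<in> Cinf M"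
    and "\<And>f. f \<notin> Cinf M \<Longrightarrow> X f = 0"
    and "\<And>f g a b. \<lbrakk>f \<in> Cinf M; g \<in> Cinf M\<rbrakk> \<Longrightarrow> X (a *\<^sub>R f + b *\<^sub>R g) = a *\<^sub>R X f + b *\<^sub>R X g"
    and "\<And>f g. \<lbrakk>f \<in> Cinf M; g \<in> Cinf M\<rbrakk> \<Longrightarrow> X (f * g) = f * X g + g * X f"
  shows "X \<in> vfields M"
  unfolding vfields_def mem_Collect_eq by (intro conjI ballI allI impI assms)

lemma vfield_outside:
  assumes "X \<in> vfields M" "f \<notin> Cinf M"
  shows "X f = 0"
proof -
  have "\<forall>f. f \<notin> Cinf M \<longrightarrow> X f = 0"
    using assms(1) unfolding vfields_def mem_Collect_eq by (elim conjE)
  then show ?thesis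
    using assms(2) by simp
qed

lemma vfield_mult:
  assumes "X \<in> vfields M" "f \<in> Cinf M" "g \<in> Cinf M"
  shows "X (f * g) = f * X g + g * X f"
proof -
  have "\<forall>f\<in>Cinf M. \<forall>g\<in>Cinf M. X (f * g) = f * X g + g * X f"
    using assms(1) unfolding vfields_def mem_Collect_eq by (elim conjE)
  then show ?thesis
    using assms(2,3) by simp
qed

lemma vfield_add:
  "\<lbrakk>X \<in> vfields M; f \<in> Cinf M; g \<in> Cinf M\<rbrakk> \<Longrightarrow> X (f + g) = X f + X g"
  using vfield_lin[of X f g 1 1] by simp

lemma vfield_scaleR: "\<lbrakk>X \<in> vfields M; f \<in> Cinf M\<rbrakk> \<Longrightarrow> X (a *\<^sub>R f) = a *\<^sub>R X f"
  using vfield_lin[of X f f a 0] by simp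

lemma vfield_0: "X \<in> vfields M \<Longrightarrow> X 0 = 0"
  using vfield_scaleR[of X 0 0] by simp

lemma vfield_uminus: "\<lbrakk>X \<in> vfields M; f \<in> Cinf M\<rbrakk> \<Longrightarrow> X (- f) = - X f"
  using vfield_scaleR[of X f "- 1"] by simp

lemma vfield_diff:
  "\<lbrakk>X \<in> vfields M; f \<in> Cinf M; g \<in> Cinf M\<rbrakk> \<Longrightarrow> X (f - g) = X f - X g"
  using vfield_add[of X f "- g"] vfield_uminus[of X g] by simp

lemmas vfield_simps = vfield_add vfield_scaleR vfield_0 vfield_uminus vfield_diff vfield_mult

lemma vfields_add [intro, simp]:
  assumes "X \<in> vfields M" "Y \<in> vfields M"
  shows "X + Y \<in> vfields M"
  by (rule vfieldsI)
    (simp_all add: assms vfield_outside[OF assms(1)] vfield_outside[OF assms(2)]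
      vfield_simps[OF assms(1)] vfield_simps[OF assms(2)] fun_eq_iff algebra_simps)

lemma vfields_fmult [intro, simp]:
  assumes "X \<in> vfields M" "f \<in> Cinf M"
  shows "(\<lambda>g. f * X g) \<in> vfields M"
  by (rule vfieldsI)
    (use assms in \<open>simp_all add: vfield_outside[OF assms(1)] vfield_simps[OF assms(1)]
      fun_eq_iff scaleR_fun_apply algebra_simps\<close>)

lemma const_on_smult: "X \<in> vfields M \<Longrightarrow> (\<lambda>g. const_on M c * X g) = c *\<^sub>R X"
  by (auto simp: const_on_mult scaleR_fun_def[of c X])

lemma vfields_scaleR [intro, simp]: "X \<in> vfields M \<Longrightarrow> c *\<^sub>R X \<in> vfields M"
  using vfields_fmult[OF _ Cinf_const] by (metis const_on_smult)

lemma vfields_0 [intro, simp]: "0 \<in> vfields M"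
  by (rule vfieldsI) auto

lemma vfields_uminus [intro, simp]: "X \<in> vfields M \<Longrightarrow> - X \<in> vfields M"
  using vfields_scaleR[of X "- 1"] by simp

lemma vfields_diff [intro, simp]: "\<lbrakk>X \<in> vfields M; Y \<in> vfields M\<rbrakk> \<Longrightarrow> X - Y \<in> vfields M"
  using vfields_add[of X "- Y"] by simp

text \<open>In the Leibniz rule for the commutator the cross terms
  \<open>X f * Y g + X g * Y f\<close> are symmetric in \<open>X\<close> and \<open>Y\<close> and
  cancel.\<close>

lemma vfields_vbracket [intro, simp]:
  assumes "X \<in> vfields M" "Y \<in> vfields M"
  shows "vbracket X Y \<in> vfields M"
  unfolding vbracket_def
  by (rule vfieldsI)
    (simp_all add: assms vfield_outside[OF assms(1)] vfield_outside[OF assms(2)]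
      vfield_simps[OF assms(1)] vfield_simps[OF assms(2)] fun_eq_iff algebra_simps)

lemma vbracket_add_right:
  assumes "Z \<in> vfields M" "X \<in> vfields M" "Y \<in> vfields M"
  shows "vbracket Z (X + Y) = vbracket Z X + vbracket Z Y"
  by (simp add: vbracket_def fun_eq_iff assms vfield_simps[OF assms(1)])

lemma vbracket_swap: "vbracket Y X = - vbracket X Y"
  by (auto simp: vbracket_def fun_eq_iff)

lemma vbracket_self [simp]: "vbracket X X = 0"
  by (auto simp: vbracket_def fun_eq_iff)

lemma vbracket_0 [simp]: "Z \<in> vfields M \<Longrightarrow> vbracket Z 0 = 0" "Z \<in> vfields M \<Longrightarrow> vbracket 0 Z = 0"
  by (auto simp: vbracket_def fun_eq_iff vfield_0)

lemma vbracket_fmult_right: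
  assumes "Z \<in> vfields M" "X \<in> vfields M" "f \<in> Cinf M"
  shows "vbracket Z (\<lambda>g. f * X g) = (\<lambda>g. Z f * X g) + (\<lambda>g. f * vbracket Z X g)"
proof
  fix g
  show "vbracket Z (\<lambda>g. f * X g) g = ((\<lambda>g. Z f * X g) + (\<lambda>g. f * vbracket Z X g)) g"
    by (cases "g \<in> Cinf M")
      (simp_all add: assms vbracket_def vfield_simps[OF assms(1)] vfield_outside[OF assms(2)]
        vfield_outside[OF assms(1)] fun_eq_iff algebra_simps)
qed

lemma vbracket_jacobi:
  assumes "X \<in> vfields M" "Y \<in> vfields M" "Z \<in> vfields M"
  shows "vbracket (vbracket X Y) Z = vbracket X (vbracket Y Z) - vbracket Y (vbracket X Z)"
  by (simp add: vbracket_def fun_eq_iff assms vfield_simps[OF assms(1)] vfield_simps[OF assms(2)]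
      vfield_simps[OF assms(3)])

end

text \<open>
  Inhomogeneous forms, so that the interior product, the exterior derivative and the Lie
  derivative are operators on one space. Requiring \<open>\<alpha>\<close> to vanish only when two neighbouring
  arguments agree makes induction on the list of arguments possible.
\<close>

definition mforms :: "'a smfd \<Rightarrow> 'a dform set" where
  "mforms M = {\<alpha>.
     (\<forall>xs. \<alpha> xs \<in> Cinf M) \<and>
     (\<forall>xs. \<not> set xs \<subseteq> vfields M \<longrightarrow> \<alpha> xs = 0) \<and>
     (\<forall>us ws. \<forall>X\<in>vfields M. \<forall>Y\<in>vfields M. set us \<subseteq> vfields M \<longrightarrow> set ws \<subseteq> vfields M \<longrightarrow>
        \<alpha> (us @ (X + Y) # ws) = \<alpha> (us @ X # ws) + \<alpha> (us @ Y # ws)) \<and>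
     (\<forall>us ws. \<forall>X\<in>vfields M. \<forall>f\<in>Cinf M. set us \<subseteq> vfields M \<longrightarrow> set ws \<subseteq> vfields M \<longrightarrow>
        \<alpha> (us @ (\<lambda>g. f * X g) # ws) = f * \<alpha> (us @ X # ws)) \<and>
     (\<forall>us ws. \<forall>X\<in>vfields M. set us \<subseteq> vfields M \<longrightarrow> set ws \<subseteq> vfields M \<longrightarrow>
        \<alpha> (us @ X # X # ws) = 0)}"

context smooth_mfd
begin

section \<open>Multilinearity and alternation of inhomogeneous forms\<close>

lemma mforms_Cinf [intro, simp]: "\<alpha> \<in> mforms M \<Longrightarrow> \<alpha> xs \<in> Cinf M"
  unfolding mforms_def by blast

lemma mforms_outside: "\<alpha> \<in> mforms M \<Longrightarrow> \<not> set xs \<subseteq> vfields M \<Longrightarrow> \<alpha> xs = 0"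
  unfolding mforms_def by blast

lemma mformsI:
  assumes "\<And>xs. \<alpha> xs \<in> Cinf M" "\<And>xs. \<not> set xs \<subseteq> vfields M \<Longrightarrow> \<alpha> xs = 0"
    and "\<And>us ws X Y. \<lbrakk>set us \<subseteq> vfields M; set ws \<subseteq> vfields M; X \<in> vfields M; Y \<in> vfields M\<rbrakk> \<Longrightarrow>
       \<alpha> (us @ (X + Y) # ws) = \<alpha> (us @ X # ws) + \<alpha> (us @ Y # ws)"
    and "\<And>us ws X f. \<lbrakk>set us \<subseteq> vfields M; set ws \<subseteq> vfields M; X \<in> vfields M; f \<in> Cinf M\<rbrakk> \<Longrightarrow>
       \<alpha> (us @ (\<lambda>g. f * X g) # ws) = f * \<alpha> (us @ X # ws)"
    and "\<And>us ws X. \<lbrakk>set us \<subseteq> vfields M; set ws \<subseteq> vfields M; X \<in> vfields M\<rbrakk> \<Longrightarrow>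
       \<alpha> (us @ X # X # ws) = 0"
  shows "\<alpha> \<in> mforms M"
  unfolding mforms_def mem_Collect_eq by (intro conjI ballI allI impI; rule assms; assumption)

text \<open>If another argument fails to be a vector field, all three values are 0. The rule can
  therefore rewrite inside arbitrary lists.\<close>

lemma mforms_slot_add:
  assumes "\<alpha> \<in> mforms M" "X \<in> vfields M" "Y \<in> vfields M"
  shows "\<alpha> (us @ (X + Y) # ws) = \<alpha> (us @ X # ws) + \<alpha> (us @ Y # ws)"
proof (cases "set us \<subseteq> vfields M \<and> set ws \<subseteq> vfields M")
  case True
  have "\<forall>us ws. \<forall>X\<in>vfields M. \<forall>Y\<in>vfields M. set us \<subseteq> vfields M \<longrightarrow> set ws \<subseteq> vfields M \<longrightarrow>
        \<alpha> (us @ (X + Y) # ws) = \<alpha> (us @ X # ws) + \<alpha> (us @ Y # ws)"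
    using assms(1) unfolding mforms_def mem_Collect_eq by (elim conjE)
  with True assms(2,3) show ?thesis
    by simp
next
  case False
  then show ?thesis
    by (subst (1 2 3) mforms_outside[OF assms(1)]) auto
qed

lemma mforms_slot_fmult:
  assumes "\<alpha> \<in> mforms M" "X \<in> vfields M" "f \<in> Cinf M"
  shows "\<alpha> (us @ (\<lambda>g. f * X g) # ws) = f * \<alpha> (us @ X # ws)"
proof (cases "set us \<subseteq> vfields M \<and> set ws \<subseteq> vfields M")
  case True
  have "\<forall>us ws. \<forall>X\<in>vfields M. \<forall>f\<in>Cinf M. set us \<subseteq> vfields M \<longrightarrow> set ws \<subseteq> vfields M \<longrightarrow>
        \<alpha> (us @ (\<lambda>g. f * X g) # ws) = f * \<alpha> (us @ X # ws)"
    using assms(1) unfolding mforms_def mem_Collect_eq by (elim conjE)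
  with True assms(2,3) show ?thesis
    by simp
next
  case False
  then show ?thesis
    by (subst (1 2) mforms_outside[OF assms(1)]) auto
qed

lemma mforms_adj:
  assumes "\<alpha> \<in> mforms M"
  shows "\<alpha> (us @ X # X # ws) = 0"
proof (cases "set (us @ X # X # ws) \<subseteq> vfields M")
  case True
  have "\<forall>us ws. \<forall>X\<in>vfields M. set us \<subseteq> vfields M \<longrightarrow> set ws \<subseteq> vfields M \<longrightarrow>
        \<alpha> (us @ X # X # ws) = 0"
    using assms(1) unfolding mforms_def mem_Collect_eq by (elim conjE)
  with True show ?thesis
    by simp
next
  case False
  then show ?thesis
    by (rule mforms_outside[OF assms])
qed

lemmas mforms_slots = mforms_slot_add mforms_slot_fmult mforms_adj

text \<open>Polarisation: \<open>X + Y\<close> is put into two neighbouring slots and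
  expanded.\<close>

lemma mforms_swap:
  assumes a: "\<alpha> \<in> mforms M"
  shows "\<alpha> (us @ Y # X # ws) = - \<alpha> (us @ X # Y # ws)"
proof (cases "X \<in> vfields M \<and> Y \<in> vfields M")
  case True
  have "0 = \<alpha> (us @ (X + Y) # (X + Y) # ws)"
    by (simp only: mforms_adj[OF a])
  also have "\<dots> = \<alpha> (us @ X # (X + Y) # ws) + \<alpha> (us @ Y # (X + Y) # ws)"
    using True by (simp only: mforms_slot_add[OF a])
  also have "\<dots> = \<alpha> (us @ X # Y # ws) + \<alpha> (us @ Y # X # ws)"
    using True mforms_slot_add[OF a, of X Y "us @ [X]" ws] mforms_slot_add[OF a, of X Y "us @ [Y]" ws]
      mforms_adj[OF a, of us X ws] mforms_adj[OF a, of us Y ws]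
    by simp
  finally show ?thesis
    by (metis add_eq_0_iff)
next
  case False
  then show ?thesis
    by (subst (1 2) mforms_outside[OF a]) auto
qed

text \<open>The left copy of \<open>X\<close> is transposed to the right, one entry of
  \<open>vs\<close> at a time, until the two copies are neighbours; each transposition only changes
  the sign.\<close>

lemma mforms_alt: "\<alpha> \<in> mforms M \<Longrightarrow> \<alpha> (us @ X # vs @ X # ws) = 0"
proof (induction vs arbitrary: us)
  case Nil
  then show ?case
    using mforms_adj[of \<alpha> us X ws] by simp
next
  case (Cons Y vs)
  then show ?case
    using mforms_swap[of \<alpha> us X Y "vs @ X # ws"] Cons.IH[of "us @ [Y]"] by simp
qed

lemma mforms_slot_scaleR:
  assumes "\<alpha> \<in> mforms M" "X \<in> vfields M"
  shows "\<alpha> (us @ (c *\<^sub>R X) # ws) = c *\<^sub>R \<alpha> (us @ X # ws)"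
proof -
  have "\<alpha> (us @ (c *\<^sub>R X) # ws) = \<alpha> (us @ (\<lambda>g. const_on M c * X g) # ws)"
    using assms(2) by (simp only: const_on_smult)
  also have "\<dots> = c *\<^sub>R \<alpha> (us @ X # ws)"
    using assms by (simp only: mforms_slot_fmult Cinf_const const_on_mult mforms_Cinf)
  finally show ?thesis .
qed

lemma mforms_slot_0: "\<alpha> \<in> mforms M \<Longrightarrow> \<alpha> (us @ 0 # ws) = 0"
  using mforms_slot_scaleR[of \<alpha> 0 us 0 ws] by simp

lemma mforms_interior [intro, simp]:
  assumes "\<alpha> \<in> mforms M"
  shows "interior Y \<alpha> \<in> mforms M"
  unfolding interior_def
proof (rule mformsI)
  show "\<alpha> (Y # xs) = 0" if "\<not> set xs \<subseteq> vfields M" for xs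
    using that by (intro mforms_outside[OF assms]) auto
qed (use assms mforms_slot_add[of \<alpha> _ _ "Y # _"] mforms_slot_fmult[of \<alpha> _ _ "Y # _"]
      mforms_adj[of \<alpha> "Y # _"] in simp_all)

text \<open>Links the shapes of two sums: the bracket terms of \<open>ext_deriv\<close> put the new
  entry in front and omit the old one, those of \<open>lie_deriv\<close> replace it in place.
  Passing from one to the other takes \<open>j\<close> transpositions.\<close>

lemma mforms_move:
  "\<lbrakk>\<alpha> \<in> mforms M; j < length xs\<rbrakk> \<Longrightarrow> \<alpha> (Z # omit j xs) = (- 1) ^ j *\<^sub>R \<alpha> (xs[j := Z])"
proof (induction j arbitrary: \<alpha> xs)
  case 0
  then show ?case
    by (cases xs) (auto simp: omit_def)
next
  case (Suc k)
  then obtain Y ys where xs: "xs = Y # ys"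
    by (cases xs) auto
  from Suc.IH[OF mforms_interior[OF Suc.prems(1)], of ys Y] show ?case
    using Suc.prems mforms_swap[OF Suc.prems(1), of "[]" Z Y "omit k ys"]
    by (simp add: xs omit_def interior_def)
qed

lemma mforms_add [intro, simp]:
  assumes "\<alpha> \<in> mforms M" "\<beta> \<in> mforms M"
  shows "\<alpha> + \<beta> \<in> mforms M"
  by (rule mformsI)
    (simp_all add: assms mforms_outside[OF assms(1)] mforms_outside[OF assms(2)]
      mforms_slots[OF assms(1)] mforms_slots[OF assms(2)] algebra_simps)

lemma mforms_fmult [intro, simp]:
  assumes "\<alpha> \<in> mforms M" "f \<in> Cinf M"
  shows "(\<lambda>xs. f * \<alpha> xs) \<in> mforms M"
  by (rule mformsI)
    (simp_all add: assms mforms_outside[OF assms(1)] mforms_slots[OF assms(1)] algebra_simps)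

lemma mforms_scaleR [intro, simp]:
  assumes "\<alpha> \<in> mforms M"
  shows "c *\<^sub>R \<alpha> \<in> mforms M"
proof -
  have "(\<lambda>xs. const_on M c * \<alpha> xs) = c *\<^sub>R \<alpha>"
    using assms by (auto simp: const_on_mult scaleR_fun_def[of c \<alpha>])
  then show ?thesis
    using mforms_fmult[OF assms Cinf_const] by metis
qed

lemma mforms_0 [intro, simp]: "0 \<in> mforms M"
  by (rule mformsI) auto

lemma mforms_uminus [intro, simp]: "\<alpha> \<in> mforms M \<Longrightarrow> - \<alpha> \<in> mforms M"
  using mforms_scaleR[of \<alpha> "- 1"] by simp

lemma mforms_diff [intro, simp]: "\<alpha> \<in> mforms M \<Longrightarrow> \<beta> \<in> mforms M \<Longrightarrow> \<alpha> - \<beta> \<in> mforms M"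
  using mforms_add[of \<alpha> "- \<beta>"] by simp

section \<open>Recursions on the first argument\<close>

lemma lie_outside: "\<not> set xs \<subseteq> vfields M \<Longrightarrow> lie_deriv M X \<alpha> xs = 0"
  by (auto simp: lie_deriv_def)

lemma lie_Nil [simp]: "lie_deriv M X \<alpha> [] = X (\<alpha> [])"
  by (simp add: lie_deriv_def)

text \<open>The commutator relation of \<L>(X) and \<iota>(Y), read as a recursion on the list of
  arguments: the bracket with the first entry is the term \<open>i = 0\<close> of the sum.\<close>

lemma lie_Cons:
  "Y \<in> vfields M \<Longrightarrow> set xs \<subseteq> vfields M \<Longrightarrow>
     lie_deriv M X \<alpha> (Y # xs) = lie_deriv M X (interior Y \<alpha>) xs - \<alpha> (vbracket X Y # xs)"
  by (simp add: lie_deriv_def interior_def sum.lessThan_Suc_shift del: sum.lessThan_Suc)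

lemma ext_outside: "\<not> set xs \<subseteq> vfields M \<Longrightarrow> ext_deriv M \<alpha> xs = 0"
  by (auto simp: ext_deriv_def)

lemma ext_Nil [simp]: "ext_deriv M \<alpha> [] = 0"
  by (simp add: ext_deriv_def)

lemma sum_pairs:
  fixes g :: "nat \<Rightarrow> nat \<Rightarrow> 'c::comm_monoid_add"
  shows "(\<Sum>(i, j)\<in>{(i, j). i < j \<and> j < n}. g i j) = (\<Sum>j<n. \<Sum>i<j. g i j)"
proof -
  have "(\<Sum>j<n. \<Sum>i<j. g i j) = (\<Sum>(j, i)\<in>(SIGMA j:{..<n}. {..<j}). g i j)"
    by (rule sum.Sigma) auto
  also have "\<dots> = (\<Sum>(i, j)\<in>{(i, j). i < j \<and> j < n}. g i j)"
    by (rule sum.reindex_bij_witness[of _ prod.swap prod.swap]) auto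
  finally show ?thesis ..
qed

lemma omit_Cons [simp]: "omit 0 (x # xs) = xs" "omit (Suc i) (x # xs) = x # omit i xs"
  by (simp_all add: omit_def)

text \<open>Cartan's formula, read as a recursion. The terms that involve index 0 on its own or in a
  bracket assemble to the Lie derivative, by \<open>mforms_move\<close>. In the others the indices
  shift by one: the single sum changes sign by the shift, the double sum because \<open>X\<close>
  has to be moved in front of the bracket.\<close>

lemma ext_Cons:
  assumes a: "\<alpha> \<in> mforms M" and X: "X \<in> vfields M" and xs: "set xs \<subseteq> vfields M"
  shows "ext_deriv M \<alpha> (X # xs) = lie_deriv M X \<alpha> xs - ext_deriv M (interior X \<alpha>) xs"
proof -
  have "ext_deriv M \<alpha> (X # xs) = X (\<alpha> xs) - (\<Sum>i<length xs. (- 1) ^ i *\<^sub>R (xs ! i) (\<alpha> (X # omit i xs)))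
      + (\<Sum>j<length xs. - ((- 1) ^ j *\<^sub>R \<alpha> (vbracket X (xs ! j) # omit j xs))
           + (\<Sum>i<j. (- 1) ^ (i + j) *\<^sub>R \<alpha> (vbracket (xs ! i) (xs ! j) # X # omit i (omit j xs))))"
    using X xs
    by (simp add: ext_deriv_def sum_pairs sum.lessThan_Suc_shift sum_negf del: sum.lessThan_Suc)
  also have "\<dots> = X (\<alpha> xs) - (\<Sum>i<length xs. (- 1) ^ i *\<^sub>R (xs ! i) (\<alpha> (X # omit i xs)))
      + (\<Sum>j<length xs. - \<alpha> (xs[j := vbracket X (xs ! j)])
           - (\<Sum>i<j. (- 1) ^ (i + j) *\<^sub>R \<alpha> (X # vbracket (xs ! i) (xs ! j) # omit i (omit j xs))))"
    using mforms_swap[OF a, of "[]" _ X]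
    by (simp add: mforms_move[OF a] sum_negf flip: power_add mult_2)
  also have "\<dots> = lie_deriv M X \<alpha> xs - ext_deriv M (interior X \<alpha>) xs"
    using xs
    by (simp add: ext_deriv_def lie_deriv_def sum_pairs interior_def sum_subtractf sum_negf)
  finally show ?thesis .
qed

end

lemmas pointwise = plus_fun_apply minus_apply uminus_apply times_fun_apply zero_fun_apply
  scaleR_fun_apply

declare pointwise [simp del]

text \<open>
  Evaluating sums of forms and of vector fields, but not of functions on the manifold: those
  are elements of a ring.
\<close>

lemma dform_apply [simp]:
  fixes \<alpha> \<beta> :: "'a dform"
  shows "(\<alpha> + \<beta>) xs = \<alpha> xs + \<beta> xs" "(\<alpha> - \<beta>) xs = \<alpha> xs - \<beta> xs" "(- \<alpha>) xs = - \<alpha> xs"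
    "(0 :: 'a dform) xs = 0" "(c *\<^sub>R \<alpha>) xs = c *\<^sub>R \<alpha> xs"
  by (simp_all add: pointwise)

lemma vfield_apply:
  fixes X Y :: "'a vfield"
  shows "(X + Y) f = X f + Y f" "(X - Y) f = X f - Y f" "(- X) f = - X f"
    "(0 :: 'a vfield) f = 0" "(c *\<^sub>R X) f = c *\<^sub>R X f"
  by (simp_all add: pointwise)

lemma interior_add [simp]: "interior X (\<alpha> + \<beta>) = interior X \<alpha> + interior X \<beta>"
  by (rule ext) (simp add: interior_def)

lemma interior_diff [simp]: "interior X (\<alpha> - \<beta>) = interior X \<alpha> - interior X \<beta>"
  by (rule ext) (simp add: interior_def)

lemma interior_uminus [simp]: "interior X (- \<alpha>) = - interior X \<alpha>"
  by (rule ext) (simp add: interior_def)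

lemma interior_scaleR [simp]: "interior X (c *\<^sub>R \<alpha>) = c *\<^sub>R interior X \<alpha>"
  by (rule ext) (simp add: interior_def)

lemma interior_0 [simp]: "interior X 0 = 0"
  by (rule ext) (simp add: interior_def)

context smooth_mfd
begin

section \<open>Linearity of the three operators in the field and in the form\<close>

lemma interior_vadd:
  "\<lbrakk>X \<in> vfields M; Y \<in> vfields M; \<alpha> \<in> mforms M\<rbrakk> \<Longrightarrow> interior (X + Y) \<alpha> = interior X \<alpha> + interior Y \<alpha>"
  using mforms_slot_add[of \<alpha> X Y "[]"] by (simp add: fun_eq_iff pointwise interior_def)

lemma interior_vfmult:
  "\<lbrakk>X \<in> vfields M; f \<in> Cinf M; \<alpha> \<in> mforms M\<rbrakk> \<Longrightarrow>
     interior (\<lambda>g. f * X g) \<alpha> = (\<lambda>xs. f * interior X \<alpha> xs)"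
  using mforms_slot_fmult[of \<alpha> X f "[]"] by (simp add: fun_eq_iff pointwise interior_def)

lemma interior_vscaleR:
  "\<lbrakk>X \<in> vfields M; \<alpha> \<in> mforms M\<rbrakk> \<Longrightarrow> interior (c *\<^sub>R X) \<alpha> = c *\<^sub>R interior X \<alpha>"
  using mforms_slot_scaleR[of \<alpha> X "[]" c] by (simp add: fun_eq_iff pointwise interior_def)

lemma interior_v0 [simp]: "\<alpha> \<in> mforms M \<Longrightarrow> interior 0 \<alpha> = 0"
  using mforms_slot_0[of \<alpha> "[]"] by (simp add: fun_eq_iff pointwise interior_def)

lemma interior_vuminus:
  "\<lbrakk>X \<in> vfields M; \<alpha> \<in> mforms M\<rbrakk> \<Longrightarrow> interior (- X) \<alpha> = - interior X \<alpha>"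
  using interior_vscaleR[of X \<alpha> "- 1"] by simp

lemma interior_vdiff:
  "\<lbrakk>X \<in> vfields M; Y \<in> vfields M; \<alpha> \<in> mforms M\<rbrakk> \<Longrightarrow> interior (X - Y) \<alpha> = interior X \<alpha> - interior Y \<alpha>"
  using interior_vadd[of X "- Y" \<alpha>] by (simp add: interior_vuminus)

lemma interior_swap: "\<alpha> \<in> mforms M \<Longrightarrow> interior X (interior Y \<alpha>) = - interior Y (interior X \<alpha>)"
  using mforms_swap[of \<alpha> "[]" Y X] by (intro ext) (simp add: interior_def fun_eq_iff pointwise)

lemma interior_interior_self [simp]: "\<alpha> \<in> mforms M \<Longrightarrow> interior X (interior X \<alpha>) = 0"
  using mforms_adj[of \<alpha> "[]"] by (simp add: fun_eq_iff pointwise interior_def)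

lemma lie_add:
  assumes "X \<in> vfields M" "\<alpha> \<in> mforms M" "\<beta> \<in> mforms M"
  shows "lie_deriv M X (\<alpha> + \<beta>) = lie_deriv M X \<alpha> + lie_deriv M X \<beta>"
  by (rule ext) (simp add: lie_deriv_def vfield_simps[OF assms(1)] assms(2,3) sum.distrib)

lemma lie_fmult:
  assumes "X \<in> vfields M" "f \<in> Cinf M" "\<alpha> \<in> mforms M"
  shows "lie_deriv M X (\<lambda>xs. f * \<alpha> xs) = (\<lambda>xs. X f * \<alpha> xs + f * lie_deriv M X \<alpha> xs)"
proof
  fix xs
  show "lie_deriv M X (\<lambda>xs. f * \<alpha> xs) xs = X f * \<alpha> xs + f * lie_deriv M X \<alpha> xs"
  proof (cases "set xs \<subseteq> vfields M")
    case True
    then show ?thesis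
      by (simp add: lie_deriv_def vfield_simps[OF assms(1)] assms sum_distrib_left algebra_simps)
  next
    case False
    then show ?thesis
      by (simp add: lie_outside mforms_outside[OF assms(3)])
  qed
qed

lemma lie_scaleR:
  assumes "X \<in> vfields M" "\<alpha> \<in> mforms M"
  shows "lie_deriv M X (c *\<^sub>R \<alpha>) = c *\<^sub>R lie_deriv M X \<alpha>"
  by (rule ext)
    (simp add: lie_deriv_def vfield_simps[OF assms(1)] assms(2) scaleR_sum_right scaleR_diff_right)

lemma lie_0 [simp]: "X \<in> vfields M \<Longrightarrow> lie_deriv M X 0 = 0"
  using lie_scaleR[of X 0 0] by simp

lemma lie_uminus: "\<lbrakk>X \<in> vfields M; \<alpha> \<in> mforms M\<rbrakk> \<Longrightarrow> lie_deriv M X (- \<alpha>) = - lie_deriv M X \<alpha>"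
  using lie_scaleR[of X \<alpha> "- 1"] by simp

lemma lie_diff:
  "\<lbrakk>X \<in> vfields M; \<alpha> \<in> mforms M; \<beta> \<in> mforms M\<rbrakk> \<Longrightarrow>
     lie_deriv M X (\<alpha> - \<beta>) = lie_deriv M X \<alpha> - lie_deriv M X \<beta>"
  using lie_add[of X \<alpha> "- \<beta>"] by (simp add: lie_uminus)

lemma vbracket_add_left:
  "\<lbrakk>X \<in> vfields M; Y \<in> vfields M; Z \<in> vfields M\<rbrakk> \<Longrightarrow>
     vbracket (X + Y) Z = vbracket X Z + vbracket Y Z"
  using vbracket_add_right[of Z X Y] by (simp add: vbracket_swap[of _ Z])

lemma vbracket_fmult_left:
  assumes "Z \<in> vfields M" "X \<in> vfields M" "f \<in> Cinf M"
  shows "vbracket (\<lambda>g. f * X g) Z = (\<lambda>g. f * vbracket X Z g) + (\<lambda>g. (- Z f) * X g)"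
proof -
  have "vbracket (\<lambda>g. f * X g) Z = - vbracket Z (\<lambda>g. f * X g)"
    by (rule vbracket_swap)
  also have "\<dots> = - ((\<lambda>g. Z f * X g) + (\<lambda>g. f * vbracket Z X g))"
    by (simp only: vbracket_fmult_right[OF assms])
  also have "\<dots> = (\<lambda>g. f * vbracket X Z g) + (\<lambda>g. (- Z f) * X g)"
    by (simp add: vbracket_def fun_eq_iff pointwise algebra_simps)
  finally show ?thesis .
qed

lemma list_update_eq_append: "i < length xs \<Longrightarrow> xs[i := x] = take i xs @ x # drop (Suc i) xs"
  by (simp add: upd_conv_take_nth_drop)

lemma lie_vadd:
  assumes "X \<in> vfields M" "Y \<in> vfields M" "\<alpha> \<in> mforms M"
  shows "lie_deriv M (X + Y) \<alpha> = lie_deriv M X \<alpha> + lie_deriv M Y \<alpha>"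
proof
  fix xs
  show "lie_deriv M (X + Y) \<alpha> xs = (lie_deriv M X \<alpha> + lie_deriv M Y \<alpha>) xs"
  proof (cases "set xs \<subseteq> vfields M")
    case True
    then have "\<alpha> (xs[i := vbracket (X + Y) (xs ! i)])
        = \<alpha> (xs[i := vbracket X (xs ! i)]) + \<alpha> (xs[i := vbracket Y (xs ! i)])"
      if "i < length xs" for i
      using that nth_mem[OF that]
      by (subst vbracket_add_left)
        (auto simp: assms(1,2) list_update_eq_append subset_iff mforms_slot_add[OF assms(3)])
    with True show ?thesis
      by (simp add: lie_deriv_def sum.distrib vfield_apply)
  qed (simp add: lie_outside)
qed

text \<open>The Lie derivative is not linear over functions in \<open>X\<close>. The sum is the
  correction df \<and> \<iota>(X)\<alpha>, written without a wedge product; it cancels against the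
  correction in \<open>ext_fmult\<close> when the exterior derivative is shown to be linear over
  functions.\<close>

lemma lie_vfmult:
  assumes "X \<in> vfields M" "f \<in> Cinf M" "\<alpha> \<in> mforms M" and xs: "set xs \<subseteq> vfields M"
  shows "lie_deriv M (\<lambda>g. f * X g) \<alpha> xs
    = f * lie_deriv M X \<alpha> xs + (\<Sum>i<length xs. (xs ! i) f * \<alpha> (xs[i := X]))"
proof -
  have "\<alpha> (xs[i := vbracket (\<lambda>g. f * X g) (xs ! i)])
      = f * \<alpha> (xs[i := vbracket X (xs ! i)]) - (xs ! i) f * \<alpha> (xs[i := X])"
    if "i < length xs" for i
  proof -
    have "xs ! i \<in> vfields M"
      using that xs nth_mem by blast
    then show ?thesis
      using that assms(1,2)
      by (subst vbracket_fmult_left)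
        (simp_all add: list_update_eq_append mforms_slots[OF assms(3)] del: mult_minus_left, simp)
  qed
  then have "(\<Sum>i<length xs. \<alpha> (xs[i := vbracket (\<lambda>g. f * X g) (xs ! i)]))
      = (\<Sum>i<length xs. f * \<alpha> (xs[i := vbracket X (xs ! i)]) - (xs ! i) f * \<alpha> (xs[i := X]))"
    by (intro sum.cong) simp_all
  with xs show ?thesis
    by (simp add: lie_deriv_def sum_subtractf sum_distrib_left right_diff_distrib)
qed

lemma lie_vscaleR:
  assumes "X \<in> vfields M" "\<alpha> \<in> mforms M"
  shows "lie_deriv M (c *\<^sub>R X) \<alpha> = c *\<^sub>R lie_deriv M X \<alpha>"
proof
  fix xs
  \<comment> \<open>Derivations annihilate constants: \<open>Z\<close> is applied to the multiple of
    \<beta> once by linearity and once by the Leibniz rule. This removes the correction term of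
    \<open>lie_vfmult\<close>.\<close>
  have const: "Z (const_on M c) * \<beta> = 0" if "Z \<in> vfields M" "\<beta> \<in> Cinf M" for Z \<beta>
  proof -
    have "c *\<^sub>R Z \<beta> = Z (const_on M c * \<beta>)"
      using that by (simp add: const_on_mult vfield_scaleR)
    also have "\<dots> = const_on M c * Z \<beta> + \<beta> * Z (const_on M c)"
      using that by (simp only: vfield_mult Cinf_const)
    finally have "\<beta> * Z (const_on M c) = 0"
      using that by (simp add: const_on_mult)
    then show ?thesis
      by (simp only: mult.commute)
  qed
  show "lie_deriv M (c *\<^sub>R X) \<alpha> xs = (c *\<^sub>R lie_deriv M X \<alpha>) xs"
  proof (cases "set xs \<subseteq> vfields M")
    case True
    have "lie_deriv M X \<alpha> xs \<in> Cinf M"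
      using True assms by (auto simp: lie_deriv_def)
    then show ?thesis
      using lie_vfmult[OF assms(1) Cinf_const assms(2) True, of c, unfolded const_on_smult[OF assms(1)]]
        assms True
      by (simp add: const_on_mult const subset_iff)
  qed (simp add: lie_outside)
qed

lemma lie_v0 [simp]: "\<alpha> \<in> mforms M \<Longrightarrow> lie_deriv M 0 \<alpha> = 0"
  using lie_vscaleR[of 0 \<alpha> 0] by simp

text \<open>Induction on the arguments before the slot in question; \<open>lie_Cons\<close> replaces
  \<alpha> by a contraction, so \<alpha> has to vary. At the slot itself, linearity over functions
  holds since \<open>Z f\<close> appears once from differentiating the coefficient and once, with
  the opposite sign, from the bracket of \<open>Z\<close> with the multiple of \<open>X\<close>. For
  a repeated argument, the two terms with \<open>vbracket Z X\<close> cancel by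
  antisymmetry.\<close>

lemma mforms_lie [intro, simp]:
  assumes Z: "Z \<in> vfields M" and "\<alpha> \<in> mforms M"
  shows "lie_deriv M Z \<alpha> \<in> mforms M"
proof (rule mformsI)
  show "lie_deriv M Z \<alpha> xs \<in> Cinf M" for xs
    using assms by (auto simp: lie_deriv_def)
  show "\<not> set xs \<subseteq> vfields M \<Longrightarrow> lie_deriv M Z \<alpha> xs = 0" for xs
    by (rule lie_outside)
next
  fix us ws :: "'a vfield list" and X Y
  assume *: "set us \<subseteq> vfields M" "set ws \<subseteq> vfields M" "X \<in> vfields M" "Y \<in> vfields M"
  show "lie_deriv M Z \<alpha> (us @ (X + Y) # ws) = lie_deriv M Z \<alpha> (us @ X # ws) + lie_deriv M Z \<alpha> (us @ Y # ws)"
    using *(1) \<open>\<alpha> \<in> mforms M\<close>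
  proof (induction us arbitrary: \<alpha>)
    case Nil
    then show ?case
      using * Z mforms_slot_add[OF Nil(2), of _ _ "[]"]
      by (simp add: lie_Cons interior_vadd lie_add vbracket_add_right algebra_simps)
  next
    case (Cons U us)
    then show ?case
      using * Z mforms_slot_add[OF Cons.prems(2) *(3,4), of "vbracket Z U # us"]
      by (simp add: lie_Cons algebra_simps)
  qed
next
  fix us ws :: "'a vfield list" and X f
  assume *: "set us \<subseteq> vfields M" "set ws \<subseteq> vfields M" "X \<in> vfields M" "f \<in> Cinf M"
  show "lie_deriv M Z \<alpha> (us @ (\<lambda>g. f * X g) # ws) = f * lie_deriv M Z \<alpha> (us @ X # ws)"
    using *(1) \<open>\<alpha> \<in> mforms M\<close>
  proof (induction us arbitrary: \<alpha>)
    case Nil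
    then show ?case
      using * Z mforms_slot_add[OF Nil(2), of _ _ "[]" ws] mforms_slot_fmult[OF Nil(2), of _ _ "[]" ws]
      by (simp add: lie_Cons interior_vfmult lie_fmult vbracket_fmult_right)
        (simp add: interior_def algebra_simps)
  next
    case (Cons U us)
    then show ?case
      using * Z mforms_slot_fmult[OF Cons.prems(2) *(3,4), of "vbracket Z U # us"]
      by (simp add: lie_Cons algebra_simps)
  qed
next
  fix us ws :: "'a vfield list" and X
  assume *: "set us \<subseteq> vfields M" "set ws \<subseteq> vfields M" "X \<in> vfields M"
  show "lie_deriv M Z \<alpha> (us @ X # X # ws) = 0"
    using *(1) \<open>\<alpha> \<in> mforms M\<close>
  proof (induction us arbitrary: \<alpha>)
    case Nil
    then show ?case
      using * Z mforms_swap[OF Nil(2), of "[]" X "vbracket Z X" ws]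
      by (simp add: lie_Cons) (simp add: interior_def)
  next
    case (Cons U us)
    then show ?case
      using * Z mforms_adj[OF Cons.prems(2), of "vbracket Z U # us"]
      by (simp add: lie_Cons)
  qed
qed

section \<open>The Cartan relations\<close>

lemma dform_ext:
  assumes "\<And>xs. \<not> set xs \<subseteq> vfields M \<Longrightarrow> \<alpha> xs = 0" "\<And>xs. \<not> set xs \<subseteq> vfields M \<Longrightarrow> \<beta> xs = 0"
    and "\<And>xs. set xs \<subseteq> vfields M \<Longrightarrow> \<alpha> xs = \<beta> xs"
  shows "\<alpha> = \<beta>"
  using assms by (metis ext)

lemma lie_interior:
  assumes "X \<in> vfields M" "Y \<in> vfields M" "\<alpha> \<in> mforms M"
  shows "lie_deriv M X (interior Y \<alpha>) = interior (vbracket X Y) \<alpha> + interior Y (lie_deriv M X \<alpha>)"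
proof (rule dform_ext)
  fix xs :: "'a vfield list"
  show "set xs \<subseteq> vfields M \<Longrightarrow> lie_deriv M X (interior Y \<alpha>) xs
      = (interior (vbracket X Y) \<alpha> + interior Y (lie_deriv M X \<alpha>)) xs"
    using assms by (simp add: lie_Cons interior_def[of Y "lie_deriv M X \<alpha>"])
      (simp add: interior_def)
  assume xs: "\<not> set xs \<subseteq> vfields M"
  then show "lie_deriv M X (interior Y \<alpha>) xs = 0"
    by (rule lie_outside)
  show "(interior (vbracket X Y) \<alpha> + interior Y (lie_deriv M X \<alpha>)) xs = 0"
    using xs mforms_outside[OF assms(3)] by (simp add: interior_def lie_outside)
qed

text \<open>On the empty list this is the definition of the bracket. In the step, \<iota>(Z) is
  moved past the Lie derivatives, and the contractions with brackets that this produces match by the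
  Jacobi identity.\<close>

lemma lie_vbracket:
  assumes X: "X \<in> vfields M" and Y: "Y \<in> vfields M" and "\<alpha> \<in> mforms M"
  shows "lie_deriv M (vbracket X Y) \<alpha> = lie_deriv M X (lie_deriv M Y \<alpha>) - lie_deriv M Y (lie_deriv M X \<alpha>)"
proof (rule dform_ext)
  fix xs :: "'a vfield list"
  show "set xs \<subseteq> vfields M \<Longrightarrow> lie_deriv M (vbracket X Y) \<alpha> xs
      = (lie_deriv M X (lie_deriv M Y \<alpha>) - lie_deriv M Y (lie_deriv M X \<alpha>)) xs"
    using \<open>\<alpha> \<in> mforms M\<close>
  proof (induction xs arbitrary: \<alpha>)
    case Nil
    then show ?case
      by (simp add: vbracket_def)
  next
    case (Cons Z xs)
    then have *: "Z \<in> vfields M" "set xs \<subseteq> vfields M" "\<alpha> \<in> mforms M"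
      by auto
    have sw: "interior Z (lie_deriv M V \<alpha>) = lie_deriv M V (interior Z \<alpha>) - interior (vbracket V Z) \<alpha>"
      if "V \<in> vfields M" for V
      using lie_interior[OF that *(1,3)] by simp
    moreover have "\<alpha> (vbracket (vbracket X Y) Z # xs)
        = \<alpha> (vbracket X (vbracket Y Z) # xs) - \<alpha> (vbracket Y (vbracket X Z) # xs)"
      using interior_vdiff[of "vbracket X (vbracket Y Z)" "vbracket Y (vbracket X Z)" \<alpha>] * X Y
      unfolding interior_def
      by (simp add: vbracket_jacobi[OF X Y *(1)] fun_eq_iff pointwise)
    ultimately show ?case
      using Cons.IH[of "interior Z \<alpha>"] * X Y
      by (simp add: lie_Cons sw lie_diff)
  qed
qed (simp_all add: lie_outside)

lemma ext_add:
  assumes "\<alpha> \<in> mforms M" "\<beta> \<in> mforms M"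
  shows "ext_deriv M (\<alpha> + \<beta>) = ext_deriv M \<alpha> + ext_deriv M \<beta>"
proof (rule dform_ext)
  show "set xs \<subseteq> vfields M \<Longrightarrow> ext_deriv M (\<alpha> + \<beta>) xs = (ext_deriv M \<alpha> + ext_deriv M \<beta>) xs" for xs
    using assms by (induction xs arbitrary: \<alpha> \<beta>) (simp_all add: ext_Cons lie_add)
qed (simp_all add: ext_outside)

lemma ext_scaleR:
  assumes "\<alpha> \<in> mforms M"
  shows "ext_deriv M (c *\<^sub>R \<alpha>) = c *\<^sub>R ext_deriv M \<alpha>"
proof (rule dform_ext)
  show "set xs \<subseteq> vfields M \<Longrightarrow> ext_deriv M (c *\<^sub>R \<alpha>) xs = (c *\<^sub>R ext_deriv M \<alpha>) xs" for xs
    using assms by (induction xs arbitrary: \<alpha>) (simp_all add: ext_Cons lie_scaleR scaleR_diff_right)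
qed (simp_all add: ext_outside)

lemma ext_0 [simp]: "ext_deriv M 0 = 0"
  using ext_scaleR[of 0 0] by simp

lemma ext_uminus: "\<alpha> \<in> mforms M \<Longrightarrow> ext_deriv M (- \<alpha>) = - ext_deriv M \<alpha>"
  using ext_scaleR[of \<alpha> "- 1"] by simp

lemma ext_diff:
  "\<lbrakk>\<alpha> \<in> mforms M; \<beta> \<in> mforms M\<rbrakk> \<Longrightarrow> ext_deriv M (\<alpha> - \<beta>) = ext_deriv M \<alpha> - ext_deriv M \<beta>"
  using ext_add[of \<alpha> "- \<beta>"] by (simp add: ext_uminus)

text \<open>The sum is the value of df \<and> \<alpha>.\<close>

lemma ext_fmult:
  assumes "\<alpha> \<in> mforms M" "f \<in> Cinf M" "set xs \<subseteq> vfields M"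
  shows "ext_deriv M (\<lambda>xs. f * \<alpha> xs) xs
    = f * ext_deriv M \<alpha> xs + (\<Sum>i<length xs. (- 1) ^ i *\<^sub>R ((xs ! i) f * \<alpha> (omit i xs)))"
  using assms
proof (induction xs arbitrary: \<alpha>)
  case Nil
  then show ?case
    by simp
next
  case (Cons X xs)
  have "interior X (\<lambda>xs. f * \<alpha> xs) = (\<lambda>xs. f * interior X \<alpha> xs)"
    by (rule ext) (simp add: interior_def)
  then show ?case
    using Cons
    by (simp add: ext_Cons lie_fmult sum.lessThan_Suc_shift sum_negf algebra_simps del: sum.lessThan_Suc)
      (simp add: interior_def)
qed

text \<open>As for the Lie derivative, by induction on the preceding arguments. At the slot,
  \<open>ext_Cons\<close> gives a difference in which both terms have the correction df \<and>
  \<iota>(X)\<alpha>. For a repeated argument, applying the recursions twice leaves a contraction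
  with \<open>vbracket X X = 0\<close> and one with \<open>X\<close> taken twice.\<close>

lemma mforms_ext [intro, simp]:
  assumes "\<alpha> \<in> mforms M"
  shows "ext_deriv M \<alpha> \<in> mforms M"
proof (rule mformsI)
  show "ext_deriv M \<alpha> xs \<in> Cinf M" for xs
  proof (cases "set xs \<subseteq> vfields M")
    case True
    then show ?thesis
      using assms
    proof (induction xs arbitrary: \<alpha>)
      case (Cons X xs)
      then show ?case
        using mforms_Cinf[OF mforms_lie[of X \<alpha>], of xs] by (simp add: ext_Cons)
    qed simp
  qed (simp add: ext_outside)
  show "\<not> set xs \<subseteq> vfields M \<Longrightarrow> ext_deriv M \<alpha> xs = 0" for xs
    by (rule ext_outside)
next
  fix us ws :: "'a vfield list" and X Y
  assume *: "set us \<subseteq> vfields M" "set ws \<subseteq> vfields M" "X \<in> vfields M" "Y \<in> vfields M"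
  show "ext_deriv M \<alpha> (us @ (X + Y) # ws) = ext_deriv M \<alpha> (us @ X # ws) + ext_deriv M \<alpha> (us @ Y # ws)"
    using *(1) \<open>\<alpha> \<in> mforms M\<close>
  proof (induction us arbitrary: \<alpha>)
    case Nil
    then show ?case
      using * by (simp add: ext_Cons interior_vadd ext_add lie_vadd algebra_simps)
  next
    case (Cons U us)
    then show ?case
      using * mforms_slot_add[OF mforms_lie[of U \<alpha>] *(3,4), of us] by (simp add: ext_Cons)
  qed
next
  fix us ws :: "'a vfield list" and X f
  assume *: "set us \<subseteq> vfields M" "set ws \<subseteq> vfields M" "X \<in> vfields M" "f \<in> Cinf M"
  show "ext_deriv M \<alpha> (us @ (\<lambda>g. f * X g) # ws) = f * ext_deriv M \<alpha> (us @ X # ws)"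
    using *(1) \<open>\<alpha> \<in> mforms M\<close>
  proof (induction us arbitrary: \<alpha>)
    case Nil
    have "(- 1) ^ i *\<^sub>R ((ws ! i) f * interior X \<alpha> (omit i ws)) = (ws ! i) f * \<alpha> (ws[i := X])"
      if "i < length ws" for i
    proof -
      have "(- 1) ^ i *\<^sub>R ((ws ! i) f * ((- 1) ^ i *\<^sub>R \<alpha> (ws[i := X]))) = (ws ! i) f * \<alpha> (ws[i := X])"
        by (simp add: fun_eq_iff pointwise flip: power_add mult_2)
      then show ?thesis
        using mforms_move[OF Nil(2) that, of X] by (simp add: interior_def)
    qed
    with Nil show ?case
      using * by (simp add: ext_Cons interior_vfmult lie_vfmult ext_fmult algebra_simps)
  next
    case (Cons U us)
    then show ?case
      using * mforms_slot_fmult[OF mforms_lie[of U \<alpha>] *(3,4), of us]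
      by (simp add: ext_Cons algebra_simps)
  qed
next
  fix us ws :: "'a vfield list" and X
  assume *: "set us \<subseteq> vfields M" "set ws \<subseteq> vfields M" "X \<in> vfields M"
  show "ext_deriv M \<alpha> (us @ X # X # ws) = 0"
    using *(1) \<open>\<alpha> \<in> mforms M\<close>
  proof (induction us arbitrary: \<alpha>)
    case Nil
    then show ?case
      using * mforms_slot_0[OF Nil(2), of "[]"] by (simp add: ext_Cons lie_Cons)
  next
    case (Cons U us)
    then show ?case
      using * mforms_adj[OF mforms_lie[of U \<alpha>], of us] by (simp add: ext_Cons)
  qed
qed

lemma cartan:
  assumes "X \<in> vfields M" "\<alpha> \<in> mforms M"
  shows "interior X (ext_deriv M \<alpha>) = lie_deriv M X \<alpha> - ext_deriv M (interior X \<alpha>)"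
proof (rule dform_ext)
  show "set xs \<subseteq> vfields M \<Longrightarrow>
      interior X (ext_deriv M \<alpha>) xs = (lie_deriv M X \<alpha> - ext_deriv M (interior X \<alpha>)) xs" for xs
    using assms by (simp add: interior_def[of X "ext_deriv M \<alpha>"] ext_Cons)
qed (simp_all add: interior_def ext_outside lie_outside)

text \<open>Both sides are compared after contraction with \<open>Y\<close>. There d turns into
  \<L>(Y) - d\<iota>(Y): the Lie derivatives are handled by \<open>lie_vbracket\<close>, the rest by
  the induction hypothesis for \<iota>(Y)\<alpha>.\<close>

lemma lie_ext:
  assumes X: "X \<in> vfields M" and "\<alpha> \<in> mforms M"
  shows "lie_deriv M X (ext_deriv M \<alpha>) = ext_deriv M (lie_deriv M X \<alpha>)"
proof (rule dform_ext)
  show "set xs \<subseteq> vfields M \<Longrightarrow>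
      lie_deriv M X (ext_deriv M \<alpha>) xs = ext_deriv M (lie_deriv M X \<alpha>) xs" for xs
    using \<open>\<alpha> \<in> mforms M\<close>
  proof (induction xs arbitrary: \<alpha>)
    case Nil
    then show ?case
      using X by (simp add: vfield_0)
  next
    case (Cons Y xs)
    then have *: "Y \<in> vfields M" "set xs \<subseteq> vfields M" "\<alpha> \<in> mforms M"
      by auto
    have sw: "interior Y (lie_deriv M X \<alpha>) = lie_deriv M X (interior Y \<alpha>) - interior (vbracket X Y) \<alpha>"
      using lie_interior[OF X *(1,3)] by simp
    show ?case
      using Cons.IH[of "interior Y \<alpha>"] * X
      by (simp add: lie_Cons ext_Cons cartan lie_diff ext_diff sw lie_vbracket)
  qed
qed (simp_all add: ext_outside lie_outside)

text \<open>Contracting dd\<alpha> with \<open>X\<close> gives \<L>(X)d\<alpha> - d\<L>(X)\<alpha> +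
  dd\<iota>(X)\<alpha>. The first two terms cancel by \<open>lie_ext\<close>, the last is covered by
  induction.\<close>

lemma ext_ext [simp]:
  assumes "\<alpha> \<in> mforms M"
  shows "ext_deriv M (ext_deriv M \<alpha>) = 0"
proof (rule dform_ext)
  show "set xs \<subseteq> vfields M \<Longrightarrow> ext_deriv M (ext_deriv M \<alpha>) xs = 0 xs" for xs
    using assms by (induction xs arbitrary: \<alpha>) (simp_all add: ext_Cons cartan ext_diff lie_ext)
qed (simp_all add: ext_outside)

end

section \<open>Hamiltonian vector fields\<close>

context smooth_mfd
begin

section \<open>Homogeneous forms among the inhomogeneous ones\<close>

lemma forms_mforms:
  assumes "\<alpha> \<in> forms M k"
  shows "\<alpha> \<in> mforms M"
proof (rule mformsI)
  show "\<alpha> xs \<in> Cinf M" for xs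
    using assms unfolding forms_def mem_Collect_eq by (elim conjE, elim allE)
  have "\<forall>xs. \<not> (length xs = k \<and> set xs \<subseteq> vfields M) \<longrightarrow> \<alpha> xs = 0"
    using assms unfolding forms_def mem_Collect_eq by (elim conjE)
  note zero = this[rule_format]
  have slots: "\<forall>xs. length xs = k \<and> set xs \<subseteq> vfields M \<longrightarrow>
        (\<forall>i<k. \<forall>X\<in>vfields M. \<forall>Y\<in>vfields M.
           \<alpha> (xs[i := X + Y]) = \<alpha> (xs[i := X]) + \<alpha> (xs[i := Y])) \<and>
        (\<forall>i<k. \<forall>X\<in>vfields M. \<forall>f\<in>Cinf M.
           \<alpha> (xs[i := (\<lambda>g. f * X g)]) = f * \<alpha> (xs[i := X])) \<and>
        (\<forall>i j. i < j \<and> j < k \<and> xs ! i = xs ! j \<longrightarrow> \<alpha> xs = 0)"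
    using assms unfolding forms_def mem_Collect_eq by (elim conjE)
  show "\<alpha> xs = 0" if "\<not> set xs \<subseteq> vfields M" for xs
    using that by (intro zero) blast
  fix us ws :: "'a vfield list" and X
  assume *: "set us \<subseteq> vfields M" "set ws \<subseteq> vfields M" "X \<in> vfields M"
  let ?xs = "us @ X # ws"
  have upd: "?xs[length us := Z] = us @ Z # ws" for Z
    by simp
  show "\<alpha> (us @ (X + Y) # ws) = \<alpha> (us @ X # ws) + \<alpha> (us @ Y # ws)" if "Y \<in> vfields M" for Y
  proof (cases "length ?xs = k")
    case True
    have "\<alpha> (?xs[length us := X + Y]) = \<alpha> (?xs[length us := X]) + \<alpha> (?xs[length us := Y])"
      using slots[THEN spec, of ?xs, THEN mp, THEN conjunct1, THEN spec, of "length us"] True * that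
      by simp
    then show ?thesis
      by (simp only: upd)
  next
    case False
    then show ?thesis
      by (subst (1 2 3) zero) auto
  qed
  show "\<alpha> (us @ (\<lambda>g. f * X g) # ws) = f * \<alpha> (us @ X # ws)" if "f \<in> Cinf M" for f
  proof (cases "length ?xs = k")
    case True
    have "\<alpha> (?xs[length us := (\<lambda>g. f * X g)]) = f * \<alpha> (?xs[length us := X])"
      using slots[THEN spec, of ?xs, THEN mp, THEN conjunct2, THEN conjunct1, THEN spec, of "length us"]
        True * that
      by simp
    then show ?thesis
      by (simp only: upd)
  next
    case False
    then show ?thesis
      by (subst (1 2) zero) auto
  qed
  show "\<alpha> (us @ X # X # ws) = 0"
  proof (cases "length (us @ X # X # ws) = k")
    case True
    have "\<forall>i j. i < j \<and> j < k \<and> (us @ X # X # ws) ! i = (us @ X # X # ws) ! j \<longrightarrow> \<alpha> (us @ X # X # ws) = 0"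
      using slots[THEN spec, of "us @ X # X # ws"] True * by simp
    from this[THEN spec, of "length us", THEN spec, of "Suc (length us)"] show ?thesis
      using True by (simp add: nth_append)
  next
    case False
    then show ?thesis
      by (intro zero) auto
  qed
qed

lemma forms_length:
  assumes "\<alpha> \<in> forms M k" "length xs \<noteq> k"
  shows "\<alpha> xs = 0"
proof -
  have "\<forall>xs. \<not> (length xs = k \<and> set xs \<subseteq> vfields M) \<longrightarrow> \<alpha> xs = 0"
    using assms(1) unfolding forms_def mem_Collect_eq by (elim conjE)
  with assms(2) show ?thesis
    by simp
qed

text \<open>The definition of \<open>forms\<close> demands alternation in arbitrary positions;
  splitting the list at the two equal entries reduces this to \<open>mforms_alt\<close>.\<close>

lemma formsI:
  assumes "\<alpha> \<in> mforms M" and zero: "\<And>xs. length xs \<noteq> k \<Longrightarrow> \<alpha> xs = 0"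
  shows "\<alpha> \<in> forms M k"
proof -
  have alt: "\<alpha> xs = 0" if "i < j" "j < length xs" "xs ! i = xs ! j" for xs :: "'a vfield list" and i j
  proof -
    have "xs = take i xs @ xs ! i # drop (Suc i) xs"
      using that by (intro id_take_nth_drop) simp
    also have "drop (Suc i) xs = take (j - Suc i) (drop (Suc i) xs) @ xs ! i # drop (Suc j) xs"
      using that id_take_nth_drop[of "j - Suc i" "drop (Suc i) xs"] by simp
    finally show ?thesis
      using mforms_alt[OF assms(1)] by metis
  qed
  show ?thesis
    unfolding forms_def mem_Collect_eq
  proof (intro conjI allI impI ballI; (elim conjE)?)
    show "\<alpha> xs = 0" if "\<not> (length xs = k \<and> set xs \<subseteq> vfields M)" for xs
      using that zero[of xs] mforms_outside[OF assms(1), of xs] by linarith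
    show "\<alpha> xs = 0" if "length xs = k" "i < j" "j < k" "xs ! i = xs ! j" for xs i j
      using that alt by simp
  qed (use assms in \<open>simp_all add: list_update_eq_append mforms_slots\<close>)
qed

lemma forms_lin [intro]:
  assumes "\<alpha> \<in> forms M k" "\<beta> \<in> forms M k"
  shows "a *\<^sub>R \<alpha> + b *\<^sub>R \<beta> \<in> forms M k"
  using assms by (intro formsI) (simp_all add: forms_mforms forms_length[OF assms(1)] forms_length[OF assms(2)])

lemma forms_0 [simp]: "0 \<in> forms M k"
  by (rule formsI) simp_all

lemma forms_add [simp]: "\<alpha> \<in> forms M k \<Longrightarrow> \<beta> \<in> forms M k \<Longrightarrow> \<alpha> + \<beta> \<in> forms M k"
  using forms_lin[of \<alpha> k \<beta> 1 1] by simp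

lemma forms_scaleR [simp]: "\<alpha> \<in> forms M k \<Longrightarrow> c *\<^sub>R \<alpha> \<in> forms M k"
  using forms_lin[of \<alpha> k \<alpha> c 0] by simp

lemma forms_uminus [simp]: "\<alpha> \<in> forms M k \<Longrightarrow> - \<alpha> \<in> forms M k"
  using forms_scaleR[of \<alpha> k "- 1"] by simp

lemma forms_interior: "\<alpha> \<in> forms M (Suc k) \<Longrightarrow> interior X \<alpha> \<in> forms M k"
  by (intro formsI) (simp_all add: forms_mforms interior_def forms_length)

lemma interior_forms_0: "\<alpha> \<in> forms M 0 \<Longrightarrow> interior X \<alpha> = 0"
  by (rule ext) (simp add: interior_def forms_length)

text \<open>Cartan's formula loses its term d\<iota>(X)\<alpha>, as \<iota>(X) annihilates
  functions. This is the shape in which degree reasons enter the long computations later.\<close>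

lemma lie_function:
  "\<alpha> \<in> forms M 0 \<Longrightarrow> X \<in> vfields M \<Longrightarrow> lie_deriv M X \<alpha> = interior X (ext_deriv M \<alpha>)"
  by (simp add: cartan forms_mforms interior_forms_0)

lemma forms_lie:
  assumes "X \<in> vfields M" "\<alpha> \<in> forms M k"
  shows "lie_deriv M X \<alpha> \<in> forms M k"
  using assms
  by (intro formsI)
    (simp_all add: forms_mforms lie_deriv_def forms_length[OF assms(2)] vfield_0 flip: zero_fun_def)

lemma forms_ext:
  assumes "\<alpha> \<in> forms M k"
  shows "ext_deriv M \<alpha> \<in> forms M (Suc k)"
proof (rule formsI)
  fix xs :: "'a vfield list"
  assume "length xs \<noteq> Suc k"
  then have "\<alpha> ys = 0" if "Suc (length ys) = length xs" for ys
    using that assms by (metis forms_length)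
  then show "ext_deriv M \<alpha> xs = 0"
    by (auto simp: ext_deriv_def omit_def subset_iff vfield_0 intro!: sum.neutral)
qed (use assms forms_mforms in simp)

end

section \<open>Existence and uniqueness of Hamiltonian vector fields\<close>

locale plectic3 =
  fixes M :: "'a smfd" and \<omega> :: "'a dform"
  assumes plectic: "plectic_manifold 3 M \<omega>"
begin

sublocale smooth_mfd M
  using plectic by unfold_locales (simp add: plectic_manifold_def)

abbreviation vf :: "'a dform \<Rightarrow> 'a vfield" where
  "vf \<equiv> ham_vfield 3 M \<omega>"

abbreviation Ham :: "'a dform set" where
  "Ham \<equiv> ham_forms 3 M \<omega>"

lemma omega: "\<omega> \<in> forms M 4" "ext_deriv M \<omega> = 0"
  using plectic by (simp_all add: plectic_manifold_def)

lemma omega_mforms [simp]: "\<omega> \<in> mforms M"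
  using omega forms_mforms by blast

text \<open>Non-degeneracy at each point shows that the difference of the fields annihilates smooth
  functions on the manifold. Off the manifold, and on functions that are not smooth, both fields
  give 0 by convention, so they are equal as functions.\<close>

lemma interior_omega_inj:
  assumes X: "X \<in> vfields M" and Y: "Y \<in> vfields M" and eq: "interior X \<omega> = interior Y \<omega>"
  shows "X = Y"
proof (intro ext)
  fix f p
  have "interior (X - Y) \<omega> = 0"
    using assms by (simp add: interior_vdiff)
  then have *: "(X - Y) f p = 0" if "p \<in> topspace (mtop M)" "f \<in> Cinf M"
    using plectic X Y that unfolding plectic_manifold_def nondegenerate_def
    by (metis vfields_diff dform_apply(4) zero_fun_apply)
  consider "f \<notin> Cinf M" | "f \<in> Cinf M" "p \<notin> topspace (mtop M)" | "f \<in> Cinf M" "p \<in> topspace (mtop M)"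
    by blast
  then show "X f p = Y f p"
  proof cases
    case 1
    then show ?thesis
      using vfield_outside[OF X] vfield_outside[OF Y] by simp
  next
    case 2
    then show ?thesis
      using Cinf_outside[OF vfield_Cinf[OF X]] Cinf_outside[OF vfield_Cinf[OF Y]] by simp
  next
    case 3
    then show ?thesis
      using * by (simp add: vfield_apply pointwise)
  qed
qed

text \<open>Uniqueness lets the description in \<open>ham_vfield\<close> denote the given field.
  Later Hamiltonian fields are found by exhibiting a candidate and checking its equation.\<close>

lemma vf_eqI:
  assumes "\<alpha> \<in> forms M 2" "X \<in> vfields M" "ext_deriv M \<alpha> = - interior X \<omega>"
  shows "\<alpha> \<in> Ham" "vf \<alpha> = X"
proof -
  show ham: "\<alpha> \<in> Ham"
    unfolding ham_forms_def using assms by auto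
  have "(THE v. v \<in> vfields M \<and> ext_deriv M \<alpha> = - interior v \<omega>) = X"
  proof (rule the_equality)
    show "v = X" if "v \<in> vfields M \<and> ext_deriv M \<alpha> = - interior v \<omega>" for v
      using that assms by (intro interior_omega_inj) auto
  qed (use assms in blast)
  with ham show "vf \<alpha> = X"
    by (simp add: ham_vfield_def)
qed

lemma Ham_forms: "\<alpha> \<in> Ham \<Longrightarrow> \<alpha> \<in> forms M 2"
  by (simp add: ham_forms_def)

lemma Ham_mforms [simp]: "\<alpha> \<in> Ham \<Longrightarrow> \<alpha> \<in> mforms M"
  using Ham_forms forms_mforms by blast

lemma Ham_vf: assumes "\<alpha> \<in> Ham" shows "vf \<alpha> \<in> vfields M \<and> ext_deriv M \<alpha> = - interior (vf \<alpha>) \<omega>"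
proof -
  obtain X where "X \<in> vfields M" "ext_deriv M \<alpha> = - interior X \<omega>"
    using assms unfolding ham_forms_def by blast
  with vf_eqI[of \<alpha> X] Ham_forms[OF assms] show ?thesis
    by simp
qed

lemma ext_Ham: "\<alpha> \<in> Ham \<Longrightarrow> ext_deriv M \<alpha> = - interior (vf \<alpha>) \<omega>"
  using Ham_vf by blast

text \<open>Holds for every \<alpha> thanks to the default value 0, so that the Cartan relations
  apply to all structure maps without a case distinction.\<close>

lemma vf_vfields [simp]: "vf \<alpha> \<in> vfields M"
  using Ham_vf by (cases "\<alpha> \<in> Ham") (auto simp: ham_vfield_def)

lemma closed_Ham:
  assumes "\<alpha> \<in> forms M 2" "ext_deriv M \<alpha> = 0"
  shows "\<alpha> \<in> Ham" "vf \<alpha> = 0"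
  using vf_eqI[of \<alpha> 0] assms by simp_all

lemma zero_Ham [simp]: "0 \<in> Ham" "vf 0 = 0"
  using closed_Ham[of 0] by simp_all

lemma Ham_lin:
  assumes "\<alpha> \<in> Ham" "\<beta> \<in> Ham"
  shows "a *\<^sub>R \<alpha> + b *\<^sub>R \<beta> \<in> Ham" "vf (a *\<^sub>R \<alpha> + b *\<^sub>R \<beta>) = a *\<^sub>R vf \<alpha> + b *\<^sub>R vf \<beta>"
proof -
  have "ext_deriv M (a *\<^sub>R \<alpha> + b *\<^sub>R \<beta>) = - interior (a *\<^sub>R vf \<alpha> + b *\<^sub>R vf \<beta>) \<omega>"
    using assms
    by (simp add: ext_add ext_scaleR interior_vadd interior_vscaleR ext_Ham)
  with assms show "a *\<^sub>R \<alpha> + b *\<^sub>R \<beta> \<in> Ham" "vf (a *\<^sub>R \<alpha> + b *\<^sub>R \<beta>) = a *\<^sub>R vf \<alpha> + b *\<^sub>R vf \<beta>"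
    using vf_eqI[of "a *\<^sub>R \<alpha> + b *\<^sub>R \<beta>" "a *\<^sub>R vf \<alpha> + b *\<^sub>R vf \<beta>"] Ham_forms by auto
qed

text \<open>By Cartan's formula only d\<iota>(v_\<alpha>)\<omega> = -dd\<alpha> remains.\<close>

lemma lie_vf_omega [simp]: "lie_deriv M (vf \<alpha>) \<omega> = 0"
proof (cases "\<alpha> \<in> Ham")
  case True
  then have "interior (vf \<alpha>) \<omega> = - ext_deriv M \<alpha>"
    by (simp add: ext_Ham)
  then have "ext_deriv M (interior (vf \<alpha>) \<omega>) = 0"
    using True by (simp add: ext_uminus)
  then show ?thesis
    using cartan[of "vf \<alpha>" \<omega>] omega by simp
next
  case False
  then show ?thesis
    by (simp add: ham_vfield_def)
qed

lemma Ham_lie: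
  assumes "\<alpha> \<in> Ham" "\<beta> \<in> Ham"
  shows "lie_deriv M (vf \<alpha>) \<beta> \<in> Ham" "vf (lie_deriv M (vf \<alpha>) \<beta>) = vbracket (vf \<alpha>) (vf \<beta>)"
proof -
  have "ext_deriv M (lie_deriv M (vf \<alpha>) \<beta>) = - interior (vbracket (vf \<alpha>) (vf \<beta>)) \<omega>"
    using assms
    by (simp add: ext_Ham lie_uminus lie_interior flip: lie_ext)
  with assms show "lie_deriv M (vf \<alpha>) \<beta> \<in> Ham" "vf (lie_deriv M (vf \<alpha>) \<beta>) = vbracket (vf \<alpha>) (vf \<beta>)"
    using vf_eqI[of "lie_deriv M (vf \<alpha>) \<beta>" "vbracket (vf \<alpha>) (vf \<beta>)"] forms_lie Ham_forms by simp_all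
qed

text \<open>The field is the same as for \<L>(v_\<alpha>)\<beta>, in accordance with the fact that
  the two brackets differ by the exact form d\<iota>(v_\<alpha>)\<beta>.\<close>

lemma Ham_omega2:
  assumes "\<alpha> \<in> Ham" "\<beta> \<in> Ham"
  shows "interior (vf \<beta>) (interior (vf \<alpha>) \<omega>) \<in> Ham"
    "vf (interior (vf \<beta>) (interior (vf \<alpha>) \<omega>)) = vbracket (vf \<alpha>) (vf \<beta>)"
proof -
  have "interior (vf \<alpha>) \<omega> \<in> forms M 3"
    using omega forms_interior[of \<omega> 3] by simp
  then have "interior (vf \<beta>) (interior (vf \<alpha>) \<omega>) \<in> forms M 2"
    using forms_interior[of _ 2] by simp
  moreover have "ext_deriv M (interior (vf \<alpha>) \<omega>) = 0"
    using cartan[of "vf \<alpha>" \<omega>] omega by simp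
  then have "ext_deriv M (interior (vf \<beta>) (interior (vf \<alpha>) \<omega>))
      = - interior (vbracket (vf \<alpha>) (vf \<beta>)) \<omega>"
    using cartan[of "vf \<beta>" "interior (vf \<alpha>) \<omega>"]
    by (simp add: lie_interior vbracket_swap[of "vf \<beta>" "vf \<alpha>"] interior_vuminus)
  ultimately show "interior (vf \<beta>) (interior (vf \<alpha>) \<omega>) \<in> Ham"
    "vf (interior (vf \<beta>) (interior (vf \<alpha>) \<omega>)) = vbracket (vf \<alpha>) (vf \<beta>)"
    using vf_eqI[of _ "vbracket (vf \<alpha>) (vf \<beta>)"] by simp_all
qed

end

section \<open>Evaluation of graded maps\<close>

lemma app_simps [simp]:
  "app (\<mu> + \<nu>) xs = app \<mu> xs + app \<nu> xs" "app (\<mu> - \<nu>) xs = app \<mu> xs - app \<nu> xs"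
  "app (- \<mu>) xs = - app \<mu> xs" "app (zero_map n k) xs = 0" "app id_map xs = snd (xs ! 0)"
  by (simp_all add: plus_gmap_def minus_gmap_def uminus_gmap_def zero_map_def id_map_def)

lemma arity_simps [simp]:
  "arity (\<mu> + \<nu>) = arity \<mu>" "arity (\<mu> - \<nu>) = arity \<mu>" "arity (- \<mu>) = arity \<mu>"
  "arity (zero_map n k) = n" "arity id_map = 1" "arity (\<mu>\<^bsup>\<sigma>\<^esup>) = arity \<mu>"
  "arity (\<partial>\<^bsub>A,B\<^esub> \<mu>) = arity \<mu>"
  "arity (\<mu> \<circ>\<^bsub>i\<^esub> \<nu>') = arity \<mu> + arity \<nu>' - 1"
  "arity (\<mu> \<odot> \<nu>s) = (\<Sum>\<nu>\<leftarrow>\<nu>s. arity \<nu>)"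
  by (simp_all add: plus_gmap_def minus_gmap_def uminus_gmap_def zero_map_def id_map_def
      perm_map_def bdry_def partial_comp_def full_comp_def)

lemma deg_simps [simp]:
  "deg (\<mu> + \<nu>) = deg \<mu>" "deg (\<mu> - \<nu>) = deg \<mu>" "deg (- \<mu>) = deg \<mu>"
  "deg (zero_map n k) = k" "deg id_map = 0" "deg (\<mu>\<^bsup>\<sigma>\<^esup>) = deg \<mu>"
  "deg (\<partial>\<^bsub>A,B\<^esub> \<mu>) = deg \<mu> - 1"
  "deg (\<mu> \<circ>\<^bsub>i\<^esub> \<nu>') = deg \<mu> + deg \<nu>'"
  "deg (\<mu> \<odot> \<nu>s) = deg \<mu> + (\<Sum>\<nu>\<leftarrow>\<nu>s. deg \<nu>)"
  by (simp_all add: plus_gmap_def minus_gmap_def uminus_gmap_def zero_map_def id_map_def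
      perm_map_def bdry_def partial_comp_def full_comp_def)

lemma ksign_simps [simp]: "ksign 0 = 1" "ksign 1 = - 1" "ksign (- 1) = - 1" "ksign 2 = 1"
  by (simp_all add: ksign_def)

lemma tdeg_simps [simp]: "tdeg [] = 0" "tdeg (x # xs) = fst x + tdeg xs"
  by (simp_all add: tdeg_def)

lemma app_partial_comp:
  "app (\<mu> \<circ>\<^bsub>i\<^esub> \<nu>) xs = ksign (deg \<nu> * tdeg (take (i - 1) xs)) *\<^sub>R
     app \<mu> (take (i - 1) xs @ happ \<nu> (take (arity \<nu>) (drop (i - 1) xs)) # drop (i - 1 + arity \<nu>) xs)"
  by (simp add: partial_comp_def Let_def)

lemma app_full_comp:
  "app (\<mu> \<odot> \<nu>s) xs = fst (tensor_app \<nu>s xs) *\<^sub>R app \<mu> (snd (tensor_app \<nu>s xs))"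
  by (simp add: full_comp_def split_beta)

lemma tensor_app_Cons:
  "tensor_app (\<nu> # \<nu>s) xs =
     (ksign ((\<Sum>\<rho>\<leftarrow>\<nu>s. deg \<rho>) * tdeg (take (arity \<nu>) xs)) * fst (tensor_app \<nu>s (drop (arity \<nu>) xs)),
      happ \<nu> (take (arity \<nu>) xs) # snd (tensor_app \<nu>s (drop (arity \<nu>) xs)))"
  by (simp add: Let_def split_beta)

text \<open>Each factor of the sign pairs two different arguments, one of which has degree
  0.\<close>

lemma koszul_one:
  assumes "\<And>j. \<lbrakk>j < length xs; j \<noteq> k\<rbrakk> \<Longrightarrow> fst (xs ! j) = 0"
  shows "koszul \<sigma> xs = 1"
  unfolding koszul_def
proof (intro prod.neutral ballI; clarify)
  fix i j
  assume "1 \<le> i" "i < j" "j \<le> length xs"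
  then have "fst (xs ! (i - 1)) = 0 \<or> fst (xs ! (j - 1)) = 0"
    using assms[of "i - 1"] assms[of "j - 1"] by fastforce
  then show "ksign (fst (xs ! (i - 1)) * fst (xs ! (j - 1))) = 1"
    by auto
qed

lemma koszul_simps [simp]:
  "koszul \<sigma> [(i, a), (0, b)] = 1"
  "koszul \<sigma> [(0, a), (i, b)] = 1"
  "koszul \<sigma> [(i, a), (0, b), (0, c)] = 1"
  "koszul \<sigma> [(0, a), (i, b), (0, c)] = 1"
  "koszul \<sigma> [(0, a), (0, b), (i, c)] = 1"
  "koszul \<sigma> [(i, a), (0, b), (0, c), (0, d)] = 1"
  "koszul \<sigma> [(0, a), (i, b), (0, c), (0, d)] = 1"
  "koszul \<sigma> [(0, a), (0, b), (i, c), (0, d)] = 1"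
  "koszul \<sigma> [(0, a), (0, b), (0, c), (i, d)] = 1"
  "koszul \<sigma> [(i, a), (0, b), (0, c), (0, d), (0, e)] = 1"
  "koszul \<sigma> [(0, a), (i, b), (0, c), (0, d), (0, e)] = 1"
  "koszul \<sigma> [(0, a), (0, b), (i, c), (0, d), (0, e)] = 1"
  "koszul \<sigma> [(0, a), (0, b), (0, c), (i, d), (0, e)] = 1"
  "koszul \<sigma> [(0, a), (0, b), (0, c), (0, d), (i, e)] = 1"
  by (rule koszul_one[where k = 0] koszul_one[where k = 1] koszul_one[where k = 2]
      koszul_one[where k = 3] koszul_one[where k = 4]; force simp: less_Suc_eq)+

declare cycle_of_list.simps [simp del]

lemma bij_cyc: "bij (cyc cs)"
  using cycle_permutes permutes_bij by blast

text \<open>\<open>cycle_of_list\<close> unfolds to a product of transpositions. Each is its own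
  inverse, so the inverse of a concrete cycle can be evaluated by reversing the product.\<close>

lemma inv_cyc_simps:
  "inv (cyc (i # j # cs)) = inv (cyc (j # cs)) \<circ> Transposition.transpose i j" "inv (cyc [i]) = id"
  "inv (cyc cs \<circ> cyc cs') = inv (cyc cs') \<circ> inv (cyc cs)"
  by (simp_all add: cycle_of_list.simps bij_cyc o_inv_distrib)

lemma app_perm_map:
  "app (\<mu>\<^bsup>\<sigma>\<^esup>) xs = koszul \<sigma> xs *\<^sub>R app \<mu> (map (\<lambda>i. xs ! (inv \<sigma> i - 1)) [1..<Suc (arity \<mu>)])"
  by (simp add: perm_map_def)

text \<open>The cycles are written with \<open>Suc 0\<close>, the form that the simplifier gives to
  the position 1; otherwise the rules would not match during evaluation.\<close>

lemma app_perm_2: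
  assumes "arity \<mu> = 2"
  shows "app (\<mu>\<^bsup>cyc [Suc 0, 2]\<^esup>) [a, b] = koszul (cyc [Suc 0, 2]) [a, b] *\<^sub>R app \<mu> [b, a]"
  using assms by (simp_all add: app_perm_map inv_cyc_simps Transposition.transpose_def upt_rec)

lemma app_perm_3:
  assumes "arity \<mu> = 3"
  shows "app (\<mu>\<^bsup>cyc [Suc 0, 2]\<^esup>) [a, b, c] = koszul (cyc [Suc 0, 2]) [a, b, c] *\<^sub>R app \<mu> [b, a, c]"
    "app (\<mu>\<^bsup>cyc [2, 3]\<^esup>) [a, b, c] = koszul (cyc [2, 3]) [a, b, c] *\<^sub>R app \<mu> [a, c, b]"
    "app (\<mu>\<^bsup>cyc [Suc 0, 2, 3]\<^esup>) [a, b, c] = koszul (cyc [Suc 0, 2, 3]) [a, b, c] *\<^sub>R app \<mu> [c, a, b]"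
    "app (\<mu>\<^bsup>cyc [Suc 0, 3, 2]\<^esup>) [a, b, c] = koszul (cyc [Suc 0, 3, 2]) [a, b, c] *\<^sub>R app \<mu> [b, c, a]"
  using assms by (simp_all add: app_perm_map inv_cyc_simps Transposition.transpose_def upt_rec)

lemma app_perm_4:
  assumes "arity \<mu> = 4"
  shows "app (\<mu>\<^bsup>cyc [Suc 0, 2]\<^esup>) [a, b, c, d] = koszul (cyc [Suc 0, 2]) [a, b, c, d] *\<^sub>R app \<mu> [b, a, c, d]"
    "app (\<mu>\<^bsup>cyc [2, 3]\<^esup>) [a, b, c, d] = koszul (cyc [2, 3]) [a, b, c, d] *\<^sub>R app \<mu> [a, c, b, d]"
    "app (\<mu>\<^bsup>cyc [3, 4]\<^esup>) [a, b, c, d] = koszul (cyc [3, 4]) [a, b, c, d] *\<^sub>R app \<mu> [a, b, d, c]"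
    "app (\<mu>\<^bsup>cyc [Suc 0, 2, 3]\<^esup>) [a, b, c, d] = koszul (cyc [Suc 0, 2, 3]) [a, b, c, d] *\<^sub>R app \<mu> [c, a, b, d]"
    "app (\<mu>\<^bsup>cyc [Suc 0, 3, 2]\<^esup>) [a, b, c, d] = koszul (cyc [Suc 0, 3, 2]) [a, b, c, d] *\<^sub>R app \<mu> [b, c, a, d]"
  using assms by (simp_all add: app_perm_map inv_cyc_simps Transposition.transpose_def upt_rec)

lemma app_perm_5:
  assumes "arity \<mu> = 5"
  shows "app (\<mu>\<^bsup>cyc [Suc 0, 2]\<^esup>) [a, b, c, d, e] = koszul (cyc [Suc 0, 2]) [a, b, c, d, e] *\<^sub>R app \<mu> [b, a, c, d, e]"
    "app (\<mu>\<^bsup>cyc [Suc 0, 2, 3]\<^esup>) [a, b, c, d, e] = koszul (cyc [Suc 0, 2, 3]) [a, b, c, d, e] *\<^sub>R app \<mu> [c, a, b, d, e]"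
    "app (\<mu>\<^bsup>cyc [Suc 0, 2, 3, 4]\<^esup>) [a, b, c, d, e] = koszul (cyc [Suc 0, 2, 3, 4]) [a, b, c, d, e] *\<^sub>R app \<mu> [d, a, b, c, e]"
    "app (\<mu>\<^bsup>cyc [2, 3]\<^esup>) [a, b, c, d, e] = koszul (cyc [2, 3]) [a, b, c, d, e] *\<^sub>R app \<mu> [a, c, b, d, e]"
    "app (\<mu>\<^bsup>cyc [Suc 0, 3, 2]\<^esup>) [a, b, c, d, e] = koszul (cyc [Suc 0, 3, 2]) [a, b, c, d, e] *\<^sub>R app \<mu> [b, c, a, d, e]"
    "app (\<mu>\<^bsup>cyc [2, 3, 4]\<^esup>) [a, b, c, d, e] = koszul (cyc [2, 3, 4]) [a, b, c, d, e] *\<^sub>R app \<mu> [a, d, b, c, e]"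
    "app (\<mu>\<^bsup>cyc [Suc 0, 3, 4, 2]\<^esup>) [a, b, c, d, e] = koszul (cyc [Suc 0, 3, 4, 2]) [a, b, c, d, e] *\<^sub>R app \<mu> [b, d, a, c, e]"
    "app (\<mu>\<^bsup>cyc [Suc 0, 3] \<circ> cyc [2, 4]\<^esup>) [a, b, c, d, e] = koszul (cyc [Suc 0, 3] \<circ> cyc [2, 4]) [a, b, c, d, e] *\<^sub>R app \<mu> [c, d, a, b, e]"
    "app (\<mu>\<^bsup>cyc [3, 4]\<^esup>) [a, b, c, d, e] = koszul (cyc [3, 4]) [a, b, c, d, e] *\<^sub>R app \<mu> [a, b, d, c, e]"
    "app (\<mu>\<^bsup>cyc [2, 4, 3]\<^esup>) [a, b, c, d, e] = koszul (cyc [2, 4, 3]) [a, b, c, d, e] *\<^sub>R app \<mu> [a, c, d, b, e]"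
    "app (\<mu>\<^bsup>cyc [Suc 0, 4, 3, 2]\<^esup>) [a, b, c, d, e] = koszul (cyc [Suc 0, 4, 3, 2]) [a, b, c, d, e] *\<^sub>R app \<mu> [b, c, d, a, e]"
  using assms by (simp_all add: app_perm_map inv_cyc_simps Transposition.transpose_def upt_rec)

lemma app_bdry_1:
  "app (\<partial>\<^bsub>A,B\<^esub> \<mu>) [(i, x)] = df B (i + deg \<mu>) (app \<mu> [(i, x)])
     - ksign (deg \<mu>) *\<^sub>R app \<mu> [(i - 1, df A i x)]"
  by (simp add: bdry_def)

lemma app_bdry_2:
  "app (\<partial>\<^bsub>A,B\<^esub> \<mu>) [(i, x), (j, y)] = df B (i + j + deg \<mu>) (app \<mu> [(i, x), (j, y)])
     - ksign (deg \<mu>) *\<^sub>R (app \<mu> [(i - 1, df A i x), (j, y)] + ksign i *\<^sub>R app \<mu> [(i, x), (j - 1, df A j y)])"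
  by (simp add: bdry_def)

lemma app_bdry_3:
  "app (\<partial>\<^bsub>A,B\<^esub> \<mu>) [(i, x), (j, y), (k, z)] = df B (i + j + k + deg \<mu>) (app \<mu> [(i, x), (j, y), (k, z)])
     - ksign (deg \<mu>) *\<^sub>R (app \<mu> [(i - 1, df A i x), (j, y), (k, z)]
         + ksign i *\<^sub>R app \<mu> [(i, x), (j - 1, df A j y), (k, z)]
         + ksign (i + j) *\<^sub>R app \<mu> [(i, x), (j, y), (k - 1, df A k z)])"
  by (simp add: bdry_def numeral_3_eq_3 add.assoc)

lemma app_bdry_4:
  "app (\<partial>\<^bsub>A,B\<^esub> \<mu>) [(i, x), (j, y), (k, z), (l, u)] =
     df B (i + j + k + l + deg \<mu>) (app \<mu> [(i, x), (j, y), (k, z), (l, u)])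
     - ksign (deg \<mu>) *\<^sub>R (app \<mu> [(i - 1, df A i x), (j, y), (k, z), (l, u)]
         + ksign i *\<^sub>R app \<mu> [(i, x), (j - 1, df A j y), (k, z), (l, u)]
         + ksign (i + j) *\<^sub>R app \<mu> [(i, x), (j, y), (k - 1, df A k z), (l, u)]
         + ksign (i + j + k) *\<^sub>R app \<mu> [(i, x), (j, y), (k, z), (l - 1, df A l u)])"
  by (simp add: bdry_def eval_nat_numeral add.assoc)

lemma map_eqI_1:
  assumes "arity \<mu> = 1" "arity \<nu> = 1" "deg \<mu> = deg \<nu>"
    and "\<And>i x. \<lbrakk>x \<in> gr A i\<rbrakk> \<Longrightarrow>
      app \<mu> [(i, x)] = app \<nu> [(i, x)]"
  shows "\<mu> \<approx>\<^bsub>A\<^esub> \<nu>"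
  using assms by (auto simp: map_eq_def hom_tuples_def eval_nat_numeral length_Suc_conv)

lemma map_eqI_2:
  assumes "arity \<mu> = 2" "arity \<nu> = 2" "deg \<mu> = deg \<nu>"
    and "\<And>i x j y. \<lbrakk>x \<in> gr A i; y \<in> gr A j\<rbrakk> \<Longrightarrow>
      app \<mu> [(i, x), (j, y)] = app \<nu> [(i, x), (j, y)]"
  shows "\<mu> \<approx>\<^bsub>A\<^esub> \<nu>"
  using assms by (auto simp: map_eq_def hom_tuples_def eval_nat_numeral length_Suc_conv)

lemma map_eqI_3:
  assumes "arity \<mu> = 3" "arity \<nu> = 3" "deg \<mu> = deg \<nu>"
    and "\<And>i x j y k z. \<lbrakk>x \<in> gr A i; y \<in> gr A j; z \<in> gr A k\<rbrakk> \<Longrightarrow>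
      app \<mu> [(i, x), (j, y), (k, z)] = app \<nu> [(i, x), (j, y), (k, z)]"
  shows "\<mu> \<approx>\<^bsub>A\<^esub> \<nu>"
  using assms by (auto simp: map_eq_def hom_tuples_def eval_nat_numeral length_Suc_conv)

lemma map_eqI_4:
  assumes "arity \<mu> = 4" "arity \<nu> = 4" "deg \<mu> = deg \<nu>"
    and "\<And>i x j y k z l u. \<lbrakk>x \<in> gr A i; y \<in> gr A j; z \<in> gr A k; u \<in> gr A l\<rbrakk> \<Longrightarrow>
      app \<mu> [(i, x), (j, y), (k, z), (l, u)] = app \<nu> [(i, x), (j, y), (k, z), (l, u)]"
  shows "\<mu> \<approx>\<^bsub>A\<^esub> \<nu>"
  using assms by (auto simp: map_eq_def hom_tuples_def eval_nat_numeral length_Suc_conv)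

lemma map_eqI_5:
  assumes "arity \<mu> = 5" "arity \<nu> = 5" "deg \<mu> = deg \<nu>"
    and "\<And>i x j y k z l u m w. \<lbrakk>x \<in> gr A i; y \<in> gr A j; z \<in> gr A k; u \<in> gr A l; w \<in> gr A m\<rbrakk> \<Longrightarrow>
      app \<mu> [(i, x), (j, y), (k, z), (l, u), (m, w)] = app \<nu> [(i, x), (j, y), (k, z), (l, u), (m, w)]"
  shows "\<mu> \<approx>\<^bsub>A\<^esub> \<nu>"
  using assms by (auto simp: map_eq_def hom_tuples_def eval_nat_numeral length_Suc_conv)

text \<open>The definition of \<open>multilin\<close> quantifies over all splittings
  \<open>us @ (i, x) # ws\<close>. For a fixed arity only finitely many shapes remain, one for each
  slot; the same holds for the higher arities below.\<close>

lemma multilinI_1: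
  assumes "arity \<mu> = 1" "deg \<mu> = d"
    and "\<And>i x. \<lbrakk>x \<in> gr A i\<rbrakk> \<Longrightarrow> app \<mu> [(i, x)] \<in> gr B (i + d)"
    and "\<And>i x v a b. \<lbrakk>x \<in> gr A i; v \<in> gr A i\<rbrakk> \<Longrightarrow>
      app \<mu> [(i, a *\<^sub>R x + b *\<^sub>R v)]
        = a *\<^sub>R app \<mu> [(i, x)] + b *\<^sub>R app \<mu> [(i, v)]"
  shows "multilin A B 1 d \<mu>"
  unfolding multilin_def
proof (intro conjI ballI allI impI)
  show "app \<mu> xs \<in> gr B (tdeg xs + d)" if "xs \<in> hom_tuples A 1" for xs
    using that assms(3) by (auto simp: hom_tuples_def eval_nat_numeral length_Suc_conv add.assoc)
next
  fix us ws i x y a b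
  assume H: "us @ (i, x) # ws \<in> hom_tuples A 1 \<and> us @ (i, y) # ws \<in> hom_tuples A 1"
  then have "length us + length ws = 0"
    by (simp add: hom_tuples_def)
  then consider "us = []" "ws = []"
    by (cases us; cases "tl us"; cases "tl (tl us)"; cases "tl (tl (tl us))";
        cases ws; cases "tl ws"; cases "tl (tl ws)"; cases "tl (tl (tl ws))") auto
  then show "app \<mu> (us @ (i, a *\<^sub>R x + b *\<^sub>R y) # ws)
      = a *\<^sub>R app \<mu> (us @ (i, x) # ws) + b *\<^sub>R app \<mu> (us @ (i, y) # ws)"
    using H assms by cases (auto simp: hom_tuples_def)
qed (use assms in auto)

lemma multilinI_2:
  assumes "arity \<mu> = 2" "deg \<mu> = d"
    and "\<And>i x j y. \<lbrakk>x \<in> gr A i; y \<in> gr A j\<rbrakk> \<Longrightarrow> app \<mu> [(i, x), (j, y)] \<in> gr B (i + j + d)"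
    and "\<And>i x j y v a b. \<lbrakk>x \<in> gr A i; y \<in> gr A j; v \<in> gr A i\<rbrakk> \<Longrightarrow>
      app \<mu> [(i, a *\<^sub>R x + b *\<^sub>R v), (j, y)]
        = a *\<^sub>R app \<mu> [(i, x), (j, y)] + b *\<^sub>R app \<mu> [(i, v), (j, y)]"
    and "\<And>i x j y v a b. \<lbrakk>x \<in> gr A i; y \<in> gr A j; v \<in> gr A j\<rbrakk> \<Longrightarrow>
      app \<mu> [(i, x), (j, a *\<^sub>R y + b *\<^sub>R v)]
        = a *\<^sub>R app \<mu> [(i, x), (j, y)] + b *\<^sub>R app \<mu> [(i, x), (j, v)]"
  shows "multilin A B 2 d \<mu>"
  unfolding multilin_def
proof (intro conjI ballI allI impI)
  show "app \<mu> xs \<in> gr B (tdeg xs + d)" if "xs \<in> hom_tuples A 2" for xs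
    using that assms(3) by (auto simp: hom_tuples_def eval_nat_numeral length_Suc_conv add.assoc)
next
  fix us ws i x y a b
  assume H: "us @ (i, x) # ws \<in> hom_tuples A 2 \<and> us @ (i, y) # ws \<in> hom_tuples A 2"
  then have "length us + length ws = 1"
    by (simp add: hom_tuples_def)
  then consider p where "us = []" "ws = [p]" | p where "us = [p]" "ws = []"
    by (cases us; cases "tl us"; cases "tl (tl us)"; cases "tl (tl (tl us))";
        cases ws; cases "tl ws"; cases "tl (tl ws)"; cases "tl (tl (tl ws))") auto
  then show "app \<mu> (us @ (i, a *\<^sub>R x + b *\<^sub>R y) # ws)
      = a *\<^sub>R app \<mu> (us @ (i, x) # ws) + b *\<^sub>R app \<mu> (us @ (i, y) # ws)"
    using H assms by cases (auto simp: hom_tuples_def)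
qed (use assms in auto)

lemma multilinI_3:
  assumes "arity \<mu> = 3" "deg \<mu> = d"
    and "\<And>i x j y k z. \<lbrakk>x \<in> gr A i; y \<in> gr A j; z \<in> gr A k\<rbrakk> \<Longrightarrow> app \<mu> [(i, x), (j, y), (k, z)] \<in> gr B (i + j + k + d)"
    and "\<And>i x j y k z v a b. \<lbrakk>x \<in> gr A i; y \<in> gr A j; z \<in> gr A k; v \<in> gr A i\<rbrakk> \<Longrightarrow>
      app \<mu> [(i, a *\<^sub>R x + b *\<^sub>R v), (j, y), (k, z)]
        = a *\<^sub>R app \<mu> [(i, x), (j, y), (k, z)] + b *\<^sub>R app \<mu> [(i, v), (j, y), (k, z)]"
    and "\<And>i x j y k z v a b. \<lbrakk>x \<in> gr A i; y \<in> gr A j; z \<in> gr A k; v \<in> gr A j\<rbrakk> \<Longrightarrow>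
      app \<mu> [(i, x), (j, a *\<^sub>R y + b *\<^sub>R v), (k, z)]
        = a *\<^sub>R app \<mu> [(i, x), (j, y), (k, z)] + b *\<^sub>R app \<mu> [(i, x), (j, v), (k, z)]"
    and "\<And>i x j y k z v a b. \<lbrakk>x \<in> gr A i; y \<in> gr A j; z \<in> gr A k; v \<in> gr A k\<rbrakk> \<Longrightarrow>
      app \<mu> [(i, x), (j, y), (k, a *\<^sub>R z + b *\<^sub>R v)]
        = a *\<^sub>R app \<mu> [(i, x), (j, y), (k, z)] + b *\<^sub>R app \<mu> [(i, x), (j, y), (k, v)]"
  shows "multilin A B 3 d \<mu>"
  unfolding multilin_def
proof (intro conjI ballI allI impI)
  show "app \<mu> xs \<in> gr B (tdeg xs + d)" if "xs \<in> hom_tuples A 3" for xs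
    using that assms(3) by (auto simp: hom_tuples_def eval_nat_numeral length_Suc_conv add.assoc)
next
  fix us ws i x y a b
  assume H: "us @ (i, x) # ws \<in> hom_tuples A 3 \<and> us @ (i, y) # ws \<in> hom_tuples A 3"
  then have "length us + length ws = 2"
    by (simp add: hom_tuples_def)
  then consider p q where "us = []" "ws = [p, q]" | p q where "us = [p]" "ws = [q]" | p q where "us = [p, q]" "ws = []"
    by (cases us; cases "tl us"; cases "tl (tl us)"; cases "tl (tl (tl us))";
        cases ws; cases "tl ws"; cases "tl (tl ws)"; cases "tl (tl (tl ws))") auto
  then show "app \<mu> (us @ (i, a *\<^sub>R x + b *\<^sub>R y) # ws)
      = a *\<^sub>R app \<mu> (us @ (i, x) # ws) + b *\<^sub>R app \<mu> (us @ (i, y) # ws)"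
    using H assms by cases (auto simp: hom_tuples_def)
qed (use assms in auto)

lemma multilinI_4:
  assumes "arity \<mu> = 4" "deg \<mu> = d"
    and "\<And>i x j y k z l u. \<lbrakk>x \<in> gr A i; y \<in> gr A j; z \<in> gr A k; u \<in> gr A l\<rbrakk> \<Longrightarrow> app \<mu> [(i, x), (j, y), (k, z), (l, u)] \<in> gr B (i + j + k + l + d)"
    and "\<And>i x j y k z l u v a b. \<lbrakk>x \<in> gr A i; y \<in> gr A j; z \<in> gr A k; u \<in> gr A l; v \<in> gr A i\<rbrakk> \<Longrightarrow>
      app \<mu> [(i, a *\<^sub>R x + b *\<^sub>R v), (j, y), (k, z), (l, u)]
        = a *\<^sub>R app \<mu> [(i, x), (j, y), (k, z), (l, u)] + b *\<^sub>R app \<mu> [(i, v), (j, y), (k, z), (l, u)]"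
    and "\<And>i x j y k z l u v a b. \<lbrakk>x \<in> gr A i; y \<in> gr A j; z \<in> gr A k; u \<in> gr A l; v \<in> gr A j\<rbrakk> \<Longrightarrow>
      app \<mu> [(i, x), (j, a *\<^sub>R y + b *\<^sub>R v), (k, z), (l, u)]
        = a *\<^sub>R app \<mu> [(i, x), (j, y), (k, z), (l, u)] + b *\<^sub>R app \<mu> [(i, x), (j, v), (k, z), (l, u)]"
    and "\<And>i x j y k z l u v a b. \<lbrakk>x \<in> gr A i; y \<in> gr A j; z \<in> gr A k; u \<in> gr A l; v \<in> gr A k\<rbrakk> \<Longrightarrow>
      app \<mu> [(i, x), (j, y), (k, a *\<^sub>R z + b *\<^sub>R v), (l, u)]
        = a *\<^sub>R app \<mu> [(i, x), (j, y), (k, z), (l, u)] + b *\<^sub>R app \<mu> [(i, x), (j, y), (k, v), (l, u)]"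
    and "\<And>i x j y k z l u v a b. \<lbrakk>x \<in> gr A i; y \<in> gr A j; z \<in> gr A k; u \<in> gr A l; v \<in> gr A l\<rbrakk> \<Longrightarrow>
      app \<mu> [(i, x), (j, y), (k, z), (l, a *\<^sub>R u + b *\<^sub>R v)]
        = a *\<^sub>R app \<mu> [(i, x), (j, y), (k, z), (l, u)] + b *\<^sub>R app \<mu> [(i, x), (j, y), (k, z), (l, v)]"
  shows "multilin A B 4 d \<mu>"
  unfolding multilin_def
proof (intro conjI ballI allI impI)
  show "app \<mu> xs \<in> gr B (tdeg xs + d)" if "xs \<in> hom_tuples A 4" for xs
    using that assms(3) by (auto simp: hom_tuples_def eval_nat_numeral length_Suc_conv add.assoc)
next
  fix us ws i x y a b
  assume H: "us @ (i, x) # ws \<in> hom_tuples A 4 \<and> us @ (i, y) # ws \<in> hom_tuples A 4"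
  then have "length us + length ws = 3"
    by (simp add: hom_tuples_def)
  then consider p q r where "us = []" "ws = [p, q, r]" | p q r where "us = [p]" "ws = [q, r]" | p q r where "us = [p, q]" "ws = [r]" | p q r where "us = [p, q, r]" "ws = []"
    by (cases us; cases "tl us"; cases "tl (tl us)"; cases "tl (tl (tl us))";
        cases ws; cases "tl ws"; cases "tl (tl ws)"; cases "tl (tl (tl ws))") auto
  then show "app \<mu> (us @ (i, a *\<^sub>R x + b *\<^sub>R y) # ws)
      = a *\<^sub>R app \<mu> (us @ (i, x) # ws) + b *\<^sub>R app \<mu> (us @ (i, y) # ws)"
    using H assms by cases (auto simp: hom_tuples_def)
qed (use assms in auto)

section \<open>The two weak Lie 3-algebras\<close>

context plectic3
begin

text \<open>
  The elements of positive degree are in \<open>low\<close>, which unlike the set of these elements is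
  closed under addition.
\<close>

definition low :: "'a dform set" where
  "low = {\<alpha> \<in> mforms M. \<forall>xs. length xs \<ge> 2 \<longrightarrow> \<alpha> xs = 0}"

lemma low_mforms [simp]: "\<alpha> \<in> low \<Longrightarrow> \<alpha> \<in> mforms M"
  by (simp add: low_def)

lemma lowD: "\<alpha> \<in> low \<Longrightarrow> 2 \<le> length xs \<Longrightarrow> \<alpha> xs = 0"
  unfolding low_def mem_Collect_eq by (drule conjunct2, drule spec, erule mp)

lemma lowI: "\<alpha> \<in> mforms M \<Longrightarrow> (\<And>xs. 2 \<le> length xs \<Longrightarrow> \<alpha> xs = 0) \<Longrightarrow> \<alpha> \<in> low"
  unfolding low_def mem_Collect_eq by (intro conjI allI impI)

lemma low_forms: "\<alpha> \<in> forms M k \<Longrightarrow> k < 2 \<Longrightarrow> \<alpha> \<in> low"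
  by (rule lowI) (simp_all add: forms_mforms forms_length[of \<alpha> k])

lemma low_forms01 [simp]: "\<alpha> \<in> forms M 0 \<Longrightarrow> \<alpha> \<in> low" "\<alpha> \<in> forms M 1 \<Longrightarrow> \<alpha> \<in> low"
  "\<alpha> \<in> forms M (Suc 0) \<Longrightarrow> \<alpha> \<in> low"
  using low_forms by simp_all

lemma low_0 [simp]: "0 \<in> low"
  by (rule lowI) simp_all

lemma low_add [simp]: "\<alpha> \<in> low \<Longrightarrow> \<beta> \<in> low \<Longrightarrow> \<alpha> + \<beta> \<in> low"
  by (rule lowI) (simp_all add: lowD[of \<alpha>] lowD[of \<beta>])

lemma low_uminus [simp]: "\<alpha> \<in> low \<Longrightarrow> - \<alpha> \<in> low"
  by (rule lowI) (simp_all add: lowD[of \<alpha>])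

lemma low_scaleR [simp]: "\<alpha> \<in> low \<Longrightarrow> c *\<^sub>R \<alpha> \<in> low"
  by (rule lowI) (simp_all add: lowD[of \<alpha>])

lemma low_interior [simp]: "\<alpha> \<in> low \<Longrightarrow> interior X \<alpha> \<in> low"
  by (rule lowI) (simp_all add: lowD[of \<alpha>] interior_def)

lemma low_interior_Ham [simp]: "\<alpha> \<in> Ham \<Longrightarrow> interior X \<alpha> \<in> low"
  using forms_interior[of \<alpha> 1 X] Ham_forms[of \<alpha>] by (simp add: numeral_2_eq_2)

lemma low_lie [simp]: "\<alpha> \<in> low \<Longrightarrow> X \<in> vfields M \<Longrightarrow> lie_deriv M X \<alpha> \<in> low"
  by (rule lowI) (simp_all add: lowD[of \<alpha>] lie_deriv_def vfield_0)

lemma interior_interior_low [simp]: "\<alpha> \<in> low \<Longrightarrow> interior X (interior Y \<alpha>) = 0"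
  by (rule ext) (simp add: lowD[of \<alpha>] interior_def)

text \<open>\<open>vf\<close> sees the bare form and not its degree tag, so it must be excluded that
  a form of positive degree is a non-zero Hamiltonian 2-form. A form of both kinds is supported on
  lists of length 2 and vanishes on them.\<close>

lemma vf_low [simp]:
  assumes "\<alpha> \<in> low"
  shows "vf \<alpha> = 0"
proof (cases "\<alpha> \<in> Ham")
  case True
  have "\<alpha> xs = 0" for xs
    using forms_length[OF Ham_forms[OF True], of xs] lowD[OF assms, of xs] by (cases "length xs = 2") auto
  then have "\<alpha> = 0"
    by (intro ext) simp
  then show ?thesis
    by simp
qed (simp add: ham_vfield_def)

lemma ext_forms [simp]:
  "\<alpha> \<in> forms M 1 \<Longrightarrow> ext_deriv M \<alpha> \<in> Ham" "\<alpha> \<in> forms M 1 \<Longrightarrow> vf (ext_deriv M \<alpha>) = 0"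
  "\<alpha> \<in> forms M 0 \<Longrightarrow> ext_deriv M \<alpha> \<in> forms M (Suc 0)" "\<alpha> \<in> forms M 0 \<Longrightarrow> vf (ext_deriv M \<alpha>) = 0"
  using closed_Ham[of "ext_deriv M \<alpha>"] forms_ext[of \<alpha> 1] forms_ext[of \<alpha> 0] forms_mforms
  by (simp_all add: numeral_2_eq_2)

lemma gr_cases2:
  assumes "x \<in> plectic_gr M \<omega> i"
  obtains "i = 0" "x \<in> Ham" | "i \<noteq> 0" "x \<in> low"
  using assms by (auto simp: plectic_gr_def split: if_splits)

text \<open>Finer than \<open>gr_cases2\<close>, for computations in which the differential or the
  target degree distinguishes functions from 1-forms. The last case collects the degrees in which
  the complex is zero.\<close>

lemma gr_cases4:
  assumes "x \<in> plectic_gr M \<omega> i"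
  obtains "i = 0" "x \<in> Ham" | "i = 1" "x \<in> forms M 1" | "i = 2" "x \<in> forms M 0"
    | "i \<noteq> 0" "i \<noteq> 1" "i \<noteq> 2" "x = 0"
  using assms by (auto simp: plectic_gr_def split: if_splits)

lemma gr_mforms [simp]: "x \<in> plectic_gr M \<omega> i \<Longrightarrow> x \<in> mforms M"
  by (erule gr_cases2) simp_all

lemma gr_lin:
  assumes "x \<in> plectic_gr M \<omega> i" "y \<in> plectic_gr M \<omega> i"
  shows "a *\<^sub>R x + b *\<^sub>R y \<in> plectic_gr M \<omega> i"
  using assms Ham_lin(1)[of x y a b] by (auto simp: plectic_gr_def)

lemma gr_0 [simp]: "0 \<in> plectic_gr M \<omega> i"
  by (simp add: plectic_gr_def)

lemma vf_lin:
  assumes "x \<in> plectic_gr M \<omega> i" "y \<in> plectic_gr M \<omega> i"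
  shows "vf (a *\<^sub>R x + b *\<^sub>R y) = a *\<^sub>R vf x + b *\<^sub>R vf y"
  using assms(1)
proof (cases rule: gr_cases2)
  case 1
  with assms show ?thesis
    by (simp add: plectic_gr_def Ham_lin)
next
  case 2
  with assms(2) have "y \<in> low"
    by (auto elim: gr_cases2)
  with 2 show ?thesis
    by simp
qed

lemma complex3_plectic:
  assumes "gr A = plectic_gr M \<omega>" "df A = plectic_df M"
  shows "complex3 A"
proof -
  have "subspace (plectic_gr M \<omega> i)" for i
    using gr_lin[of _ i _ 1 1] gr_lin[of _ i 0 _ 0] by (auto simp: subspace_def)
  moreover have "plectic_df M i x \<in> plectic_gr M \<omega> (i - 1)" if "x \<in> plectic_gr M \<omega> i" for i x
    using that by (cases rule: gr_cases4) (auto simp: plectic_df_def plectic_gr_def)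
  moreover have "plectic_df M i (a *\<^sub>R x + b *\<^sub>R y) = a *\<^sub>R plectic_df M i x + b *\<^sub>R plectic_df M i y"
    if "x \<in> plectic_gr M \<omega> i" "y \<in> plectic_gr M \<omega> i" for i x y a b
    using that by (simp add: plectic_df_def ext_add ext_scaleR)
  moreover have "plectic_df M (i - 1) (plectic_df M i x) = 0" if "x \<in> plectic_gr M \<omega> i" for i x
    using that by (simp add: plectic_df_def)
  ultimately show ?thesis
    by (auto simp: complex3_def assms plectic_gr_def)
qed

text \<open>Boundaries are closed, so their field is 0. Hence the boundary of a map has no
  contribution from differentiating an argument that enters only through its field.\<close>

lemma vf_df [simp]: "x \<in> plectic_gr M \<omega> i \<Longrightarrow> vf (plectic_df M i x) = 0"
  by (erule gr_cases4) (auto simp: plectic_df_def)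

abbreviation LI where "LI \<equiv> Linfty M \<omega>"
abbreviation LB where "LB \<equiv> Leib M \<omega>"

lemma LI_simps [simp]:
  "gr LI = plectic_gr M \<omega>" "df LI = plectic_df M"
  "lam21 LI = zero_map 2 1" "lam211 LI = zero_map 2 2" "lam31 LI = zero_map 3 2" "lam32 LI = zero_map 3 2"
  "arity (lam2 LI) = 2" "arity (lam3 LI) = 3" "arity (lam4 LI) = 4"
  "deg (lam2 LI) = 0" "deg (lam3 LI) = 1" "deg (lam4 LI) = 2"
  "app (lam2 LI) [(i, x), (j, y)] = interior (vf y) (interior (vf x) \<omega>)"
  "app (lam3 LI) [(i, x), (j, y), (k, z)] = - interior (vf z) (interior (vf y) (interior (vf x) \<omega>))"
  "app (lam4 LI) [(i, x), (j, y), (k, z), (l, u)]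
     = - interior (vf u) (interior (vf z) (interior (vf y) (interior (vf x) \<omega>)))"
  by (simp_all add: Linfty_def Let_def interiors_def)

lemma LB_simps [simp]:
  "gr LB = plectic_gr M \<omega>" "df LB = plectic_df M"
  "lam3 LB = zero_map 3 1" "lam4 LB = zero_map 4 2"
  "lam211 LB = zero_map 2 2" "lam31 LB = zero_map 3 2" "lam32 LB = zero_map 3 2"
  "arity (lam2 LB) = 2" "arity (lam21 LB) = 2" "deg (lam2 LB) = 0" "deg (lam21 LB) = 1"
  "app (lam2 LB) [(i, x), (j, y)] = lie_deriv M (vf x) y"
  "app (lam21 LB) [(i, x), (j, y)] = interior (vf x) y + interior (vf y) x"
  by (simp_all add: Leib_def Let_def)

declare tensor_app.simps(2) [simp del]

lemmas eval = app_partial_comp app_full_comp tensor_app_Cons happ_def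
  app_bdry_1 app_bdry_2 app_bdry_3 app_bdry_4 app_perm_2 app_perm_3 app_perm_4 app_perm_5

lemma omega3: "interior X \<omega> \<in> forms M 3" "interior Y (interior X \<omega>) \<in> forms M 2"
  "interior Z (interior Y (interior X \<omega>)) \<in> forms M 1"
  "interior U (interior Z (interior Y (interior X \<omega>))) \<in> forms M 0"
proof -
  show 3: "interior X \<omega> \<in> forms M 3" for X
    using omega forms_interior[of \<omega> 3] by simp
  show 2: "interior Y (interior X \<omega>) \<in> forms M 2" for X Y
    using forms_interior[of "interior X \<omega>" 2] 3 by simp
  show 1: "interior Z (interior Y (interior X \<omega>)) \<in> forms M 1" for X Y Z
    using forms_interior[of "interior Y (interior X \<omega>)" 1] 2 by (simp add: numeral_2_eq_2)
  show "interior U (interior Z (interior Y (interior X \<omega>))) \<in> forms M 0"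
    using forms_interior[of "interior Z (interior Y (interior X \<omega>))" 0] 1 by simp
qed

lemma multilin_LI:
  "multilin LI LI 2 0 (lam2 LI)" "multilin LI LI 3 1 (lam3 LI)" "multilin LI LI 4 2 (lam4 LI)"
proof -
  show "multilin LI LI 2 0 (lam2 LI)"
  proof (rule multilinI_2)
    show "app (lam2 LI) [(i, x), (j, y)] \<in> gr LI (i + j + 0)" if "x \<in> gr LI i" "y \<in> gr LI j" for i x j y
      using that by (auto elim!: gr_cases2 simp: Ham_omega2 plectic_gr_def[of _ _ 0])
  qed (simp_all add: vf_lin interior_vadd interior_vscaleR)
  show "multilin LI LI 3 1 (lam3 LI)"
  proof (rule multilinI_3)
    show "app (lam3 LI) [(i, x), (j, y), (k, z)] \<in> gr LI (i + j + k + 1)"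
      if "x \<in> gr LI i" "y \<in> gr LI j" "z \<in> gr LI k" for i x j y k z
      using that omega3 by (auto elim!: gr_cases2 simp: plectic_gr_def[of _ _ 1])
  qed (simp_all add: vf_lin interior_vadd interior_vscaleR)
  show "multilin LI LI 4 2 (lam4 LI)"
  proof (rule multilinI_4)
    show "app (lam4 LI) [(i, x), (j, y), (k, z), (l, u)] \<in> gr LI (i + j + k + l + 2)"
      if "x \<in> gr LI i" "y \<in> gr LI j" "z \<in> gr LI k" "u \<in> gr LI l" for i x j y k z l u
      using that omega3 by (auto elim!: gr_cases2 simp: plectic_gr_def[of _ _ 2])
  qed (simp_all add: vf_lin interior_vadd interior_vscaleR)
qed

text \<open>Anticommutation rules loop in general form. Instantiated at ordered pairs of arguments
  they sort: the field of the earlier argument goes outermost among contractions and to the left in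
  a bracket.\<close>

lemmas swap_vf = vbracket_swap[of "vf y" "vf x" for x y] interior_swap[of _ "vf y" "vf x" for x y]

lemma ext_interior:
  "\<lbrakk>X \<in> vfields M; \<alpha> \<in> mforms M\<rbrakk> \<Longrightarrow>
     ext_deriv M (interior X \<alpha>) = lie_deriv M X \<alpha> - interior X (ext_deriv M \<alpha>)"
  by (simp add: cartan)

lemma plectic_df_zero [simp]: "plectic_df M i 0 = 0" "plectic_df M 0 x = 0"
  "plectic_df M 1 x = ext_deriv M x" "plectic_df M 2 x = ext_deriv M x" "plectic_df M 3 x = 0"
  by (simp_all add: plectic_df_def)

text \<open>Complements \<open>swap_vf\<close>: a contraction with a bracket is placed outside the
  contractions with the fields of single arguments.\<close>

lemma interior_vbracket_outer:
  "\<alpha> \<in> mforms M \<Longrightarrow> interior (vf x) (interior (vbracket Y Z) \<alpha>) = - interior (vbracket Y Z) (interior (vf x) \<alpha>)"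
  by (rule interior_swap)

lemma Ham_uminus: "x \<in> Ham \<Longrightarrow> - x \<in> Ham" "x \<in> Ham \<Longrightarrow> vf (- x) = - vf x"
  using Ham_lin[of x 0 "- 1" 0] by simp_all

text \<open>The name refers to the Poincare-Birkhoff-Witt theorem: words in \<iota>, \<L> and d are
  ordered like monomials in an enveloping algebra.\<close>

lemmas pbw = ext_interior lie_ext[symmetric] lie_interior lie_vbracket
  ext_add ext_diff ext_uminus ext_scaleR lie_add lie_diff lie_uminus lie_scaleR
  interior_vuminus ext_Ham omega(2) Ham_omega2 Ham_lie Ham_uminus interior_vbracket_outer

section \<open>The axioms for the L-infinity structure\<close>

lemma multilin_zero_map: "(\<And>i. 0 \<in> gr B i) \<Longrightarrow> multilin A B n k (zero_map n k)"
  by (simp add: multilin_def)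

lemma leibniz3_LI: "leibniz3_algebra LI"
  unfolding leibniz3_algebra_def Let_def
proof (intro conjI, goal_cases)
  case 1
  show ?case
    by (rule complex3_plectic) simp_all
next
  case 2
  show ?case
    by (rule multilin_LI)
next
  case 3
  show ?case
    by (rule multilin_LI)
next
  case 4
  show ?case
    by (rule multilin_LI)
next
  case 5
  show ?case
  proof (rule map_eqI_2, goal_cases)
    case (4 i x j y)
    then show ?case
      unfolding LI_simps(1) LB_simps(1)
      by (elim gr_cases2; simp add: eval pbw
        swap_vf[where x = x and y = y])
  qed simp_all
next
  case 6
  show ?case
  proof (rule map_eqI_3, goal_cases)
    \<comment> \<open>The Jacobiator is exact: when d is moved through the triple contraction of
      \<omega>, only contractions of \<omega> with one bracket survive.\<close>
    case (4 i x j y k z)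
    then show ?case
      unfolding LI_simps(1) LB_simps(1)
      by (elim gr_cases2; simp add: eval pbw
        swap_vf[where x = x and y = y] swap_vf[where x = x and y = z]
        swap_vf[where x = y and y = z])
  qed simp_all
next
  case 7
  show ?case
  proof (rule map_eqI_4, goal_cases)
    case (4 i x j y k z l u)
    then show ?case
      unfolding LI_simps(1) LB_simps(1)
      by (elim gr_cases2; simp add: eval pbw
        swap_vf[where x = x and y = y] swap_vf[where x = x and y = z]
        swap_vf[where x = x and y = u] swap_vf[where x = y and y = z]
        swap_vf[where x = y and y = u] swap_vf[where x = z and y = u])
  qed simp_all
next
  case 8
  show ?case
  proof (rule map_eqI_5, goal_cases)
    case (4 i x j y k z l u m w)
    \<comment> \<open>All arguments enter through their fields, so a single one of positive degree
      annihilates every term. Six cases thus replace the 32 combinations of degrees in the costly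
      simplification.\<close>
    consider "x \<in> low" | "y \<in> low" | "z \<in> low" | "u \<in> low" | "w \<in> low"
      | "i = 0" "j = 0" "k = 0" "l = 0" "m = 0"
        "x \<in> Ham" "y \<in> Ham" "z \<in> Ham" "u \<in> Ham" "w \<in> Ham"
      using 4 unfolding LI_simps(1) LB_simps(1) by (elim gr_cases2) blast+
    then show ?case
    proof cases
      case 6
      then show ?thesis
        \<comment> \<open>the contraction of \<open>\<omega>\<close> with all five fields vanishes, and so does its derivative\<close>
        using lie_function[OF omega3(4)[of "vf x" "vf y" "vf z" "vf u"] vf_vfields[of w]]
        by (simp add: eval Ham_omega2 Ham_uminus, (simp add: pbw
        swap_vf[where x = x and y = y] swap_vf[where x = x and y = z]
        swap_vf[where x = x and y = u] swap_vf[where x = x and y = w]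
        swap_vf[where x = y and y = z] swap_vf[where x = y and y = u]
        swap_vf[where x = y and y = w] swap_vf[where x = z and y = u]
        swap_vf[where x = z and y = w] swap_vf[where x = u and y = w]; simp add: algebra_simps))
    qed (simp_all add: eval)
  qed simp_all
qed

text \<open>As the symmetrising maps are zero, the remaining axioms reduce to the graded
  antisymmetry of the brackets, which is that of \<omega>.\<close>

lemma weak_lie3_LI: "weak_lie3_algebra LI"
  unfolding weak_lie3_algebra_def Let_def
proof (intro conjI, goal_cases)
  case 1
  show ?case
    by (rule leibniz3_LI)
next
  case 2
  show ?case
    by (simp add: multilin_zero_map)
next
  case 3
  show ?case
    by (simp add: multilin_zero_map)
next
  case 4
  show ?case
    by (simp add: multilin_zero_map)
next
  case 5
  show ?case
    by (simp add: multilin_zero_map)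
next
  case 6
  show ?case
  proof (rule map_eqI_2, goal_cases)
    case (4 i x j y)
    then show ?case
      unfolding LI_simps(1) LB_simps(1)
      by (elim gr_cases2; simp add: eval pbw
        swap_vf[where x = x and y = y])
  qed simp_all
next
  case 7
  show ?case
  proof (rule map_eqI_2, goal_cases)
    case (4 i x j y)
    then show ?case
      unfolding LI_simps(1) LB_simps(1)
      by (elim gr_cases2; simp add: eval pbw
        swap_vf[where x = x and y = y])
  qed simp_all
next
  case 8
  show ?case
  proof (rule map_eqI_3, goal_cases)
    case (4 i x j y k z)
    then show ?case
      unfolding LI_simps(1) LB_simps(1)
      by (elim gr_cases2; simp add: eval pbw
        swap_vf[where x = x and y = y] swap_vf[where x = x and y = z]
        swap_vf[where x = y and y = z])
  qed simp_all
next
  case 9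
  show ?case
  proof (rule map_eqI_3, goal_cases)
    case (4 i x j y k z)
    then show ?case
      unfolding LI_simps(1) LB_simps(1)
      by (elim gr_cases2; simp add: eval pbw
        swap_vf[where x = x and y = y] swap_vf[where x = x and y = z]
        swap_vf[where x = y and y = z])
  qed simp_all
next
  case 10
  show ?case
  proof (rule map_eqI_2, goal_cases)
    case (4 i x j y)
    then show ?case
      unfolding LI_simps(1) LB_simps(1)
      by (elim gr_cases2; simp add: eval pbw
        swap_vf[where x = x and y = y])
  qed simp_all
next
  case 11
  show ?case
  proof (rule map_eqI_3, goal_cases)
    case (4 i x j y k z)
    then show ?case
      unfolding LI_simps(1) LB_simps(1)
      by (elim gr_cases2; simp add: eval pbw
        swap_vf[where x = x and y = y] swap_vf[where x = x and y = z]
        swap_vf[where x = y and y = z])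
  qed simp_all
next
  case 12
  show ?case
  proof (rule map_eqI_3, goal_cases)
    case (4 i x j y k z)
    then show ?case
      unfolding LI_simps(1) LB_simps(1)
      by (elim gr_cases2; simp add: eval pbw
        swap_vf[where x = x and y = y] swap_vf[where x = x and y = z]
        swap_vf[where x = y and y = z])
  qed simp_all
next
  case 13
  show ?case
  proof (rule map_eqI_3, goal_cases)
    case (4 i x j y k z)
    then show ?case
      unfolding LI_simps(1) LB_simps(1)
      by (elim gr_cases2; simp add: eval pbw
        swap_vf[where x = x and y = y] swap_vf[where x = x and y = z]
        swap_vf[where x = y and y = z])
  qed simp_all
next
  case 14
  show ?case
  proof (rule map_eqI_4, goal_cases)
    case (4 i x j y k z l u)
    then show ?case
      unfolding LI_simps(1) LB_simps(1)
      by (elim gr_cases2; simp add: eval pbw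
        swap_vf[where x = x and y = y] swap_vf[where x = x and y = z]
        swap_vf[where x = x and y = u] swap_vf[where x = y and y = z]
        swap_vf[where x = y and y = u] swap_vf[where x = z and y = u])
  qed simp_all
next
  case 15
  show ?case
  proof (rule map_eqI_4, goal_cases)
    case (4 i x j y k z l u)
    then show ?case
      unfolding LI_simps(1) LB_simps(1)
      by (elim gr_cases2; simp add: eval pbw
        swap_vf[where x = x and y = y] swap_vf[where x = x and y = z]
        swap_vf[where x = x and y = u] swap_vf[where x = y and y = z]
        swap_vf[where x = y and y = u] swap_vf[where x = z and y = u])
  qed simp_all
next
  case 16
  show ?case
  proof (rule map_eqI_4, goal_cases)
    case (4 i x j y k z l u)
    then show ?case
      unfolding LI_simps(1) LB_simps(1)
      by (elim gr_cases2; simp add: eval pbw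
        swap_vf[where x = x and y = y] swap_vf[where x = x and y = z]
        swap_vf[where x = x and y = u] swap_vf[where x = y and y = z]
        swap_vf[where x = y and y = u] swap_vf[where x = z and y = u])
  qed simp_all
qed

section \<open>The axioms for the Leibniz structure\<close>

lemma forms_mforms01 [simp]: "\<alpha> \<in> forms M 0 \<Longrightarrow> \<alpha> \<in> mforms M" "\<alpha> \<in> forms M 1 \<Longrightarrow> \<alpha> \<in> mforms M"
  "\<alpha> \<in> forms M (Suc 0) \<Longrightarrow> \<alpha> \<in> mforms M"
  by (simp_all add: forms_mforms)

lemma interior_Ham: "\<alpha> \<in> Ham \<Longrightarrow> interior X \<alpha> \<in> forms M (Suc 0)"
  using Ham_forms[of \<alpha>] forms_interior[of \<alpha> "Suc 0"] by (simp add: numeral_2_eq_2)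

lemma interior_ext_function [simp]:
  "\<alpha> \<in> forms M 0 \<Longrightarrow> X \<in> vfields M \<Longrightarrow> interior X (ext_deriv M \<alpha>) = lie_deriv M X \<alpha>"
  by (simp add: lie_function)

lemma multilin_LB: "multilin LB LB 2 0 (lam2 LB)" "multilin LB LB 2 1 (lam21 LB)"
proof -
  show "multilin LB LB 2 0 (lam2 LB)"
  proof (rule multilinI_2)
    show "app (lam2 LB) [(i, x), (j, y)] \<in> gr LB (i + j + 0)" if "x \<in> gr LB i" "y \<in> gr LB j" for i x j y
      using that unfolding LB_simps(1)
      by (elim gr_cases4; simp add: Ham_lie plectic_gr_def forms_lie)
  qed (simp_all add: vf_lin lie_vadd lie_vscaleR lie_add lie_scaleR)
  show "multilin LB LB 2 1 (lam21 LB)"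
  proof (rule multilinI_2)
    show "app (lam21 LB) [(i, x), (j, y)] \<in> gr LB (i + j + 1)" if "x \<in> gr LB i" "y \<in> gr LB j" for i x j y
      using that unfolding LB_simps(1)
      by (elim gr_cases4; simp add: plectic_gr_def forms_interior interior_Ham interior_forms_0)
  qed (simp_all add: vf_lin interior_vadd interior_vscaleR algebra_simps)
qed

text \<open>With \<open>lam3\<close> and \<open>lam4\<close> equal to zero, the substance is the
  strict Leibniz identity for \<open>lam2\<close>. It is the commutator formula
  \<open>lie_vbracket\<close>, because \<L>(v_x)y has the field
  \<open>vbracket (vf x) (vf y)\<close>.\<close>

lemma leibniz3_LB: "leibniz3_algebra LB"
  unfolding leibniz3_algebra_def Let_def
proof (intro conjI, goal_cases)
  case 1
  show ?case
    by (rule complex3_plectic) simp_all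
next
  case 2
  show ?case
    by (rule multilin_LB)
next
  case 3
  show ?case
    by (simp add: multilin_zero_map)
next
  case 4
  show ?case
    by (simp add: multilin_zero_map)
next
  case 5
  show ?case
  proof (rule map_eqI_2, goal_cases)
    case (4 i x j y)
    then show ?case
      unfolding LI_simps(1) LB_simps(1)
      by (elim gr_cases4; simp add: eval pbw interior_forms_0)
  qed simp_all
next
  case 6
  show ?case
  proof (rule map_eqI_3, goal_cases)
    case (4 i x j y k z)
    then show ?case
      unfolding LI_simps(1) LB_simps(1)
      by (elim gr_cases2; simp add: eval pbw)
  qed simp_all
next
  case 7
  show ?case
  proof (rule map_eqI_4, goal_cases)
    case (4 i x j y k z l u)
    then show ?case
      unfolding LI_simps(1) LB_simps(1)
      by (elim gr_cases2; simp add: eval )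
  qed simp_all
next
  case 8
  show ?case
  proof (rule map_eqI_5, goal_cases)
    case (4 i x j y k z l u m w)
    then show ?case
      unfolding LI_simps(1) LB_simps(1)
      by (simp add: eval)
  qed simp_all
qed

text \<open>In the symmetrised bracket of Hamiltonian forms the contractions of \<omega> cancel and
  d\<iota>(v_x)y + d\<iota>(v_y)x remains, the differential of \<open>lam21\<close>. The latter is
  graded symmetric, in accordance with \<open>lam211\<close> being zero.\<close>

lemma weak_lie3_LB: "weak_lie3_algebra LB"
  unfolding weak_lie3_algebra_def Let_def
proof (intro conjI, goal_cases)
  case 1
  show ?case
    by (rule leibniz3_LB)
next
  case 2
  show ?case
    by (rule multilin_LB)
next
  case 3
  show ?case
    by (simp add: multilin_zero_map)
next
  case 4
  show ?case
    by (simp add: multilin_zero_map)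
next
  case 5
  show ?case
    by (simp add: multilin_zero_map)
next
  case 6
  show ?case
  proof (rule map_eqI_2, goal_cases)
    case (4 i x j y)
    then show ?case
      unfolding LI_simps(1) LB_simps(1)
      by (elim gr_cases4; simp add: eval pbw interior_forms_0
        swap_vf[where x = x and y = y])
  qed simp_all
next
  case 7
  show ?case
  proof (rule map_eqI_2, goal_cases)
    case (4 i x j y)
    then show ?case
      unfolding LI_simps(1) LB_simps(1)
      by (elim gr_cases4; simp add: eval pbw interior_forms_0
        swap_vf[where x = x and y = y])
  qed simp_all
next
  case 8
  show ?case
  proof (rule map_eqI_3, goal_cases)
    case (4 i x j y k z)
    then show ?case
      unfolding LI_simps(1) LB_simps(1)
      by (elim gr_cases2; simp add: eval pbw interior_forms_0
        swap_vf[where x = x and y = y] swap_vf[where x = x and y = z]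
        swap_vf[where x = y and y = z])
  qed simp_all
next
  case 9
  show ?case
  proof (rule map_eqI_3, goal_cases)
    \<comment> \<open>This axiom says that \<L>(v_x) is a derivation of the pairing
      \<open>lam21\<close>.\<close>
    case (4 i x j y k z)
    then show ?case
      unfolding LI_simps(1) LB_simps(1)
      by (elim gr_cases2; simp add: eval pbw interior_forms_0
        swap_vf[where x = x and y = y] swap_vf[where x = x and y = z]
        swap_vf[where x = y and y = z])
  qed simp_all
next
  case 10
  show ?case
  proof (rule map_eqI_2, goal_cases)
    case (4 i x j y)
    then show ?case
      unfolding LI_simps(1) LB_simps(1)
      by (elim gr_cases4; simp add: eval pbw interior_forms_0
        swap_vf[where x = x and y = y])
  qed simp_all
next
  case 11
  show ?case
  proof (rule map_eqI_3, goal_cases)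
    case (4 i x j y k z)
    then show ?case
      unfolding LI_simps(1) LB_simps(1)
      by (elim gr_cases2; simp add: eval pbw interior_forms_0
        swap_vf[where x = x and y = y] swap_vf[where x = x and y = z]
        swap_vf[where x = y and y = z])
  qed simp_all
next
  case 12
  show ?case
  proof (rule map_eqI_3, goal_cases)
    \<comment> \<open>For Hamiltonian arguments there are six double contractions, two of each
      argument, which cancel in pairs because contractions anticommute.\<close>
    case (4 i x j y k z)
    then show ?case
      unfolding LI_simps(1) LB_simps(1)
      by (elim gr_cases2; simp add: eval pbw interior_forms_0
        swap_vf[where x = x and y = y] swap_vf[where x = x and y = z]
        swap_vf[where x = y and y = z])
  qed simp_all
next
  case 13
  show ?case
  proof (rule map_eqI_3, goal_cases)
    case (4 i x j y k z)
    then show ?case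
      unfolding LI_simps(1) LB_simps(1)
      by (elim gr_cases2; simp add: eval pbw interior_forms_0
        swap_vf[where x = x and y = y] swap_vf[where x = x and y = z]
        swap_vf[where x = y and y = z])
  qed simp_all
next
  case 14
  show ?case
  proof (rule map_eqI_4, goal_cases)
    case (4 i x j y k z l u)
    then show ?case
      unfolding LI_simps(1) LB_simps(1)
      by (elim gr_cases2; simp add: eval pbw interior_forms_0
        swap_vf[where x = x and y = y] swap_vf[where x = x and y = z]
        swap_vf[where x = x and y = u] swap_vf[where x = y and y = z]
        swap_vf[where x = y and y = u] swap_vf[where x = z and y = u])
  qed simp_all
next
  case 15
  show ?case
  proof (rule map_eqI_4, goal_cases)
    case (4 i x j y k z l u)
    then show ?case
      unfolding LI_simps(1) LB_simps(1)
      by (elim gr_cases2; simp add: eval pbw interior_forms_0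
        swap_vf[where x = x and y = y] swap_vf[where x = x and y = z]
        swap_vf[where x = x and y = u] swap_vf[where x = y and y = z]
        swap_vf[where x = y and y = u] swap_vf[where x = z and y = u])
  qed simp_all
next
  case 16
  show ?case
  proof (rule map_eqI_4, goal_cases)
    case (4 i x j y k z l u)
    then show ?case
      unfolding LI_simps(1) LB_simps(1)
      by (elim gr_cases2; simp add: eval pbw interior_forms_0
        swap_vf[where x = x and y = y] swap_vf[where x = x and y = z]
        swap_vf[where x = x and y = u] swap_vf[where x = y and y = z]
        swap_vf[where x = y and y = u] swap_vf[where x = z and y = u])
  qed simp_all
qed

end

section \<open>The isomorphism\<close>

text \<open>The parameter \<open>c\<close> is -1 towards the Leibniz structure and 1 in the other
  direction. The component \<open>mor3\<close> is free of \<open>c\<close>: it has to balance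
  products of two components \<open>mor2\<close>, where only the square of the sign counts.\<close>

definition contraction_mor :: "'a smfd \<Rightarrow> 'a dform \<Rightarrow> real \<Rightarrow> ('a dform, 'a dform) weak_mor" where
  "contraction_mor M \<omega> c = (let v = \<lambda>x. ham_vfield 3 M \<omega> (snd x) in
     \<lparr> mor1 = id_map,
       mor2 = GMap 2 1 (\<lambda>xs. c *\<^sub>R interior (v (xs ! 0)) (snd (xs ! 1))),
       mor21 = zero_map 2 2,
       mor3 = GMap 3 2 (\<lambda>xs. interior (v (xs ! 0)) (interior (v (xs ! 1)) (snd (xs ! 2)))) \<rparr>)"

context plectic3
begin

abbreviation cmor where "cmor \<equiv> contraction_mor M \<omega>"

lemma cmor_simps [simp]:
  "mor1 (cmor c) = id_map" "mor21 (cmor c) = zero_map 2 2"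
  "arity (mor2 (cmor c)) = 2" "deg (mor2 (cmor c)) = 1"
  "arity (mor3 (cmor c)) = 3" "deg (mor3 (cmor c)) = 2"
  "app (mor2 (cmor c)) [(i, x), (j, y)] = c *\<^sub>R interior (vf x) y"
  "app (mor3 (cmor c)) [(i, x), (j, y), (k, z)] = interior (vf x) (interior (vf y) z)"
  by (simp_all add: contraction_mor_def Let_def)

lemma low_interior_gr [simp]: "x \<in> plectic_gr M \<omega> i \<Longrightarrow> interior X x \<in> low"
  by (erule gr_cases2) simp_all

text \<open>One of the relations particular to a degree: \<iota>(Y)\<alpha> is a function, so
  \<iota>(X)d acts on it as \<L>(X). The result is the invariant formula for the differential of a
  1-form.\<close>

lemma interior_interior_ext:
  assumes "\<alpha> \<in> forms M (Suc 0)" "X \<in> vfields M" "Y \<in> vfields M"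
  shows "interior X (interior Y (ext_deriv M \<alpha>))
    = interior X (lie_deriv M Y \<alpha>) - interior (vbracket X Y) \<alpha> - interior Y (lie_deriv M X \<alpha>)"
proof -
  have "interior Y \<alpha> \<in> forms M 0"
    using assms(1) by (rule forms_interior)
  then have "interior X (ext_deriv M (interior Y \<alpha>)) = lie_deriv M X (interior Y \<alpha>)"
    using assms(2) by (rule interior_ext_function)
  with assms show ?thesis
    by (simp add: cartan lie_interior)
qed

lemma omega3_low: "interior Z (interior Y (interior X \<omega>)) \<in> low"
  using omega3(3) low_forms by simp

section \<open>The two weak morphisms\<close>

lemma multilin_id_map: "gr A = gr B \<Longrightarrow> multilin A B 1 0 id_map"
  by (rule multilinI_1) simp_all

lemma multilin_cmor:
  assumes "gr A = plectic_gr M \<omega>" "gr B = plectic_gr M \<omega>"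
  shows "multilin A B 2 1 (mor2 (cmor c))" "multilin A B 3 2 (mor3 (cmor c))"
proof -
  show "multilin A B 2 1 (mor2 (cmor c))"
  proof (rule multilinI_2)
    show "app (mor2 (cmor c)) [(i, x), (j, y)] \<in> gr B (i + j + 1)"
      if "x \<in> gr A i" "y \<in> gr A j" for i x j y
      using that unfolding assms
      by (elim gr_cases4; simp add: plectic_gr_def forms_interior interior_Ham interior_forms_0)
  qed (simp_all add: assms vf_lin interior_vadd interior_vscaleR algebra_simps)
  show "multilin A B 3 2 (mor3 (cmor c))"
  proof (rule multilinI_3)
    show "app (mor3 (cmor c)) [(i, x), (j, y), (k, z)] \<in> gr B (i + j + k + 2)"
      if "x \<in> gr A i" "y \<in> gr A j" "z \<in> gr A k" for i x j y k z
      using that unfolding assms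
      by (elim gr_cases2; simp add: plectic_gr_def forms_interior interior_Ham)
  qed (simp_all add: assms vf_lin interior_vadd interior_vscaleR)
qed

lemma weak_morphism_LI_LB: "weak_morphism LI LB (cmor (- 1))"
  unfolding weak_morphism_def Let_def
proof (intro conjI, goal_cases)
  case 1
  show ?case
    unfolding cmor_simps by (rule multilin_id_map) simp
next
  case 2
  show ?case
    by (rule multilin_cmor) simp_all
next
  case 3
  show ?case
    by (simp add: multilin_zero_map)
next
  case 4
  show ?case
    by (rule multilin_cmor) simp_all
next
  case 5
  show ?case
  proof (rule map_eqI_1, goal_cases)
    case (4 i x)
    then show ?case
      unfolding LI_simps(1) LB_simps(1)
      by (elim gr_cases2; simp add: eval pbw)
  qed simp_all
next
  case 6
  show ?case
  proof (rule map_eqI_2, goal_cases)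
    case (4 i x j y)
    then show ?case
      unfolding LI_simps(1) LB_simps(1)
      by (elim gr_cases4; simp add: eval pbw interior_forms_0
        swap_vf[where x = x and y = y])
  qed simp_all
next
  case 7
  show ?case
  proof (rule map_eqI_3, goal_cases)
    case (4 i x j y k z)
    then have m: "x \<in> plectic_gr M \<omega> i" "y \<in> plectic_gr M \<omega> j" "z \<in> plectic_gr M \<omega> k"
      by simp_all
    show ?case
      \<comment> \<open>Only \<open>z\<close> enters other than through its field, so its exact
        degree matters, while for \<open>x\<close> and \<open>y\<close> it suffices to know whether
        the degree is 0.\<close>
      by (insert m, rule gr_cases4[OF m(3)]; rule gr_cases2[OF m(1)]; rule gr_cases2[OF m(2)];
          simp add: eval pbw interior_forms_0 forms_lie interior_interior_ext
        swap_vf[where x = x and y = y] swap_vf[where x = x and y = z]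
        swap_vf[where x = y and y = z])
  qed simp_all
next
  case 8
  show ?case
  proof (rule map_eqI_4, goal_cases)
    case (4 i x j y k z l u)
    then have m: "x \<in> plectic_gr M \<omega> i" "y \<in> plectic_gr M \<omega> j" "z \<in> plectic_gr M \<omega> k" "u \<in> plectic_gr M \<omega> l"
      by simp_all
    \<comment> \<open>In the terms not already zero, an argument enters through its field or under
      at least two contractions; either way one of positive degree makes the term vanish.\<close>
    consider "x \<in> low" | "y \<in> low" | "z \<in> low" | "u \<in> low"
      | "i = 0" "j = 0" "k = 0" "l = 0"
        "x \<in> Ham" "y \<in> Ham" "z \<in> Ham" "u \<in> Ham"
      using m by (elim gr_cases2) blast+
    then show ?case
    proof cases
      case 5
      then have "interior (vf y) (interior (vf z) u) \<in> forms M 0"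
        using interior_Ham[of u "vf z"] by (simp add: forms_interior)
      \<comment> \<open>expresses that \<open>d\<iota>(v\<^sub>x)\<iota>(v\<^sub>y)\<iota>(v\<^sub>z)u = 0\<close>, which follows by degree reasons\<close>
      note F = lie_function[OF this vf_vfields[of x]]
      \<comment> \<open>The rule \<open>interior_ext_function\<close> is removed because it is the
        relation \<open>F\<close> in the opposite direction and would work against it.\<close>
      from 5 show ?thesis
        by (simp add: eval Ham_omega2 Ham_lie Ham_uminus, insert F,
            (simp add: pbw del: interior_ext_function add:
        swap_vf[where x = x and y = y] swap_vf[where x = x and y = z]
        swap_vf[where x = x and y = u] swap_vf[where x = y and y = z]
        swap_vf[where x = y and y = u] swap_vf[where x = z and y = u]; simp add: algebra_simps))
    qed (use m in \<open>simp_all add: eval omega3_low\<close>)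
  qed simp_all
next
  case 9
  show ?case
  proof (rule map_eqI_2, goal_cases)
    case (4 i x j y)
    then show ?case
      unfolding LI_simps(1) LB_simps(1)
      by (elim gr_cases2; simp add: eval pbw interior_forms_0
        swap_vf[where x = x and y = y])
  qed simp_all
next
  case 10
  show ?case
  proof (rule map_eqI_2, goal_cases)
    case (4 i x j y)
    then show ?case
      unfolding LI_simps(1) LB_simps(1)
      by (elim gr_cases2; simp add: eval pbw
        swap_vf[where x = x and y = y])
  qed simp_all
next
  case 11
  show ?case
  proof (rule map_eqI_3, goal_cases)
    case (4 i x j y k z)
    then show ?case
      unfolding LI_simps(1) LB_simps(1)
      by (elim gr_cases2; simp add: eval pbw
        swap_vf[where x = x and y = y] swap_vf[where x = x and y = z]
        swap_vf[where x = y and y = z])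
  qed simp_all
next
  case 12
  show ?case
  proof (rule map_eqI_3, goal_cases)
    case (4 i x j y k z)
    then show ?case
      unfolding LI_simps(1) LB_simps(1)
      by (elim gr_cases2; simp add: eval pbw
        swap_vf[where x = x and y = y] swap_vf[where x = x and y = z]
        swap_vf[where x = y and y = z])
  qed simp_all
qed

lemma weak_morphism_LB_LI: "weak_morphism LB LI (cmor 1)"
  unfolding weak_morphism_def Let_def
proof (intro conjI, goal_cases)
  case 1
  show ?case
    unfolding cmor_simps by (rule multilin_id_map) simp
next
  case 2
  show ?case
    by (rule multilin_cmor) simp_all
next
  case 3
  show ?case
    by (simp add: multilin_zero_map)
next
  case 4
  show ?case
    by (rule multilin_cmor) simp_all
next
  case 5
  show ?case
  proof (rule map_eqI_1, goal_cases)
    case (4 i x)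
    then show ?case
      unfolding LI_simps(1) LB_simps(1)
      by (elim gr_cases2; simp add: eval pbw)
  qed simp_all
next
  case 6
  show ?case
  proof (rule map_eqI_2, goal_cases)
    case (4 i x j y)
    then show ?case
      unfolding LI_simps(1) LB_simps(1)
      by (elim gr_cases4; simp add: eval pbw interior_forms_0
        swap_vf[where x = x and y = y])
  qed simp_all
next
  case 7
  show ?case
  proof (rule map_eqI_3, goal_cases)
    case (4 i x j y k z)
    then have m: "x \<in> plectic_gr M \<omega> i" "y \<in> plectic_gr M \<omega> j" "z \<in> plectic_gr M \<omega> k"
      by simp_all
    show ?case
      by (insert m, rule gr_cases4[OF m(3)]; rule gr_cases2[OF m(1)]; rule gr_cases2[OF m(2)];
          simp add: eval pbw interior_forms_0 forms_lie interior_interior_ext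
        swap_vf[where x = x and y = y] swap_vf[where x = x and y = z]
        swap_vf[where x = y and y = z])
  qed simp_all
next
  case 8
  show ?case
  proof (rule map_eqI_4, goal_cases)
    case (4 i x j y k z l u)
    then have m: "x \<in> plectic_gr M \<omega> i" "y \<in> plectic_gr M \<omega> j" "z \<in> plectic_gr M \<omega> k" "u \<in> plectic_gr M \<omega> l"
      by simp_all
    consider "x \<in> low" | "y \<in> low" | "z \<in> low" | "u \<in> low"
      | "i = 0" "j = 0" "k = 0" "l = 0"
        "x \<in> Ham" "y \<in> Ham" "z \<in> Ham" "u \<in> Ham"
      using m by (elim gr_cases2) blast+
    then show ?case
    proof cases
      case 5
      then have "interior (vf y) (interior (vf z) u) \<in> forms M 0"
        using interior_Ham[of u "vf z"] by (simp add: forms_interior)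
      \<comment> \<open>The degree relation again: three contractions of the 2-form \<open>u\<close>
        give zero, which has to be supplied to the normal form.\<close>
      note F = lie_function[OF this vf_vfields[of x]]
      from 5 show ?thesis
        by (simp add: eval Ham_omega2 Ham_lie Ham_uminus, insert F,
            (simp add: pbw del: interior_ext_function add:
        swap_vf[where x = x and y = y] swap_vf[where x = x and y = z]
        swap_vf[where x = x and y = u] swap_vf[where x = y and y = z]
        swap_vf[where x = y and y = u] swap_vf[where x = z and y = u]; simp add: algebra_simps))
    qed (use m in \<open>simp_all add: eval omega3_low\<close>)
  qed simp_all
next
  case 9
  show ?case
  proof (rule map_eqI_2, goal_cases)
    case (4 i x j y)
    then show ?case
      unfolding LI_simps(1) LB_simps(1)
      by (elim gr_cases2; simp add: eval pbw interior_forms_0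
        swap_vf[where x = x and y = y])
  qed simp_all
next
  case 10
  show ?case
  proof (rule map_eqI_2, goal_cases)
    case (4 i x j y)
    then show ?case
      unfolding LI_simps(1) LB_simps(1)
      by (elim gr_cases2; simp add: eval pbw
        swap_vf[where x = x and y = y])
  qed simp_all
next
  case 11
  show ?case
  proof (rule map_eqI_3, goal_cases)
    case (4 i x j y k z)
    then show ?case
      unfolding LI_simps(1) LB_simps(1)
      by (elim gr_cases2; simp add: eval pbw
        swap_vf[where x = x and y = y] swap_vf[where x = x and y = z]
        swap_vf[where x = y and y = z])
  qed simp_all
next
  case 12
  show ?case
  proof (rule map_eqI_3, goal_cases)
    case (4 i x j y k z)
    then show ?case
      unfolding LI_simps(1) LB_simps(1)
      by (elim gr_cases2; simp add: eval pbw
        swap_vf[where x = x and y = y] swap_vf[where x = x and y = z]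
        swap_vf[where x = y and y = z])
  qed simp_all
qed

text \<open>In arity three, \<open>mor2\<close> after \<open>mor2\<close> in the second slot and its
  transposed term each contribute -c^2 \<iota>(v_x)\<iota>(v_y)z, which cancels the two copies of
  \<open>mor3\<close>. The term with \<open>mor2\<close> in the first slot is zero, since the values
  of \<open>mor2\<close> have no field.\<close>

lemma mor_comp_cmor:
  assumes "gr A = plectic_gr M \<omega>" and "c * c = 1"
  shows "mor_eq A (mor_comp (cmor (- c)) (cmor c)) mor_id"
  unfolding mor_eq_def mor_comp_def mor_id_def Let_def weak_mor.simps
proof (intro conjI, goal_cases)
  case 1
  show ?case
    by (rule map_eqI_1) (simp_all add: eval)
next
  case 2
  show ?case
    by (rule map_eqI_2) (simp_all add: eval)
next
  case 3
  show ?case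
    by (rule map_eqI_2) (simp_all add: eval)
next
  case 4
  show ?case
  proof (rule map_eqI_3, goal_cases)
    case (4 i x j y k z)
    then show ?case
      unfolding assms(1)
      by (elim gr_cases2; simp add: eval assms(2) interior_swap[of _ "vf y" "vf x"])
  qed simp_all
qed

end

theorem proposition5p2:
  fixes M :: "'a smfd" and \<omega> :: "'a dform"
  assumes "plectic_manifold 3 M \<omega>"
  shows "weak_lie3_isomorphic (Linfty M \<omega>) (Leib M \<omega>)"
proof -
  interpret plectic3 M \<omega>
    using assms by unfold_locales
  show ?thesis
    unfolding weak_lie3_isomorphic_def
    using weak_lie3_LI weak_lie3_LB weak_morphism_LI_LB weak_morphism_LB_LI
      mor_comp_cmor[of LI "- 1"] mor_comp_cmor[of LB 1]
    by auto
qed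

end
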